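(* Let $G$ be a graph generated by the generalized configuration model construction algorithm (described in the context) with parameters $b$, $q$, $h$ and degree distribution $\{p_k\}$, under the even-block assumption and in the large-network limit described in the context. Randomly select an edge from the graph, and let $X$ and $Y$ be the degrees of the two vertices at the two ends of this edge. Then the Pearson degree correlation function of $X$ and $Y$, $\rho(X,Y)=\frac{E(XY)-E(X)E(Y)}{\sigma_X\sigma_Y}$, is $$\rho(X,Y)=cq,\qquad c=\frac{b\sum_{i=1}^b u_iu_{h(i)}-\sum_{i=1}^b\sum_{j=1}^b u_iu_j}{\sigma_X\sigma_Y\,(E(Z))^2},$$ where $u_i=\sum_{x\in H_i}x^2p_x$, $E(Z)=\sum_{k\ge 0} kp_k$, and $\sigma_X$, $\sigma_Y$ are the standard deviations of the marginal probability mass functions $\Pr(X=x)=\frac{xp_x}{E(Z)}$ and $\Pr(Y=k)=\frac{kp_k}{E(Z)}$.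
   Context: Construction algorithm. Let $p_k$ be the probability that a randomly selected vertex has degree $k$, and let $Z$ denote the degree of a randomly selected vertex. A degree sequence $k_1,\dots,k_n$ is sampled from $\{p_k\}$ for $n$ vertices, and vertex $i$ is given $k_i$ stubs (half-edges), for a total of $2m=\sum_i k_i$ stubs. The stubs are sorted by the degree of the vertex to which they belong and partitioned, in this order, into $b$ blocks of $2m/b$ stubs each ($b$ an integer dividing $2m$). A permutation $h$ of $\{1,\dots,b\}$ with $h(h(i))=i$ for all $i$ is chosen. In each block, $\lceil 2mq/b\rceil$ randomly chosen stubs are designated type 1, where $q\in[0,1)$ is a parameter; the other stubs are type 2. Repeatedly, a random unconnected stub is selected: if it is a type 1 stub in block $i$, it is connected to a randomly selected unconnected type 1 stub in block $h(i)$; if it is a type 2 stub, it is connected to a randomly selected unconnected type 2 stub among all blocks. This is repeated until all stubs are connected. Even-block assumption. There are mutually disjoint sets $H_1,\dots,H_b$ with $\bigcup_{i=1}^b H_i=\{0,1,2,\dots\}$ and $\sum_{k\in H_i}kp_k=E(Z)/b$ for all $i$. In addition, the sampled degree sequence can be evenly placed in the blocks: $\{1,\dots,n\}$ is a union of mutually disjoint sets $V_1,\dots,V_b$ such that $k_i\neq k_j$ whenever $i\in V_{\ell_1}$, $j\in V_{\ell_2}$, $\ell_1\neq\ell_2$, and $\sum_{j\in V_i}k_j=2m/b$ for all $i$. Thus all stubs of vertices with degree in $H_i$ are in block $i$. Large-network limit. The distribution of $(X,Y)$ is the limit as $n\to\infty$, $m\to\infty$ with $2m/n=E(Z)$ held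 fixed. *)

theory Defs
  imports "HOL-Probability.Probability" "HOL-Library.Monad_Syntax"
begin

text \<open>
  Vertices are the numbers below \<open>n\<close>, stubs the numbers below the total number of stubs, and
  blocks the numbers below \<open>b\<close>. A degree sequence is a function \<open>k\<close> with \<open>k v\<close> the degree of
  vertex \<open>v\<close>. The degree distribution \<open>p\<close> is a pmf on the natural numbers.
\<close>

definition mean_degree :: "nat pmf \<Rightarrow> real" where
  "mean_degree p = (\<Sum>k. real k * pmf p k)"

definition num_stubs :: "nat \<Rightarrow> (nat \<Rightarrow> nat) \<Rightarrow> nat" where
  "num_stubs n k = (\<Sum>v<n. k v)"

text \<open>
  Stubs are numbered in nondecreasing order of the degree of their vertex: position \<open>s\<close> of the
  following list is the vertex owning stub \<open>s\<close>.
\<close>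

definition stub_owners :: "nat \<Rightarrow> (nat \<Rightarrow> nat) \<Rightarrow> nat list" where
  "stub_owners n k = concat (map (\<lambda>v. replicate (k v) v) (sort_key k [0..<n]))"

definition stub_degree :: "nat \<Rightarrow> (nat \<Rightarrow> nat) \<Rightarrow> nat \<Rightarrow> nat" where
  "stub_degree n k s = k (stub_owners n k ! s)"

definition block_of :: "nat \<Rightarrow> nat \<Rightarrow> nat \<Rightarrow> nat" where
  "block_of b N s = s div (N div b)"

definition block :: "nat \<Rightarrow> nat \<Rightarrow> nat \<Rightarrow> nat set" where
  "block b N i = {s. s < N \<and> block_of b N s = i}"

definition type1_count :: "nat \<Rightarrow> real \<Rightarrow> nat \<Rightarrow> nat" where
  "type1_count b q N = nat \<lceil>real N * q / real b\<rceil>"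

text \<open>The value at \<open>i\<close> of the sampled function is the set of type 1 stubs of block \<open>i\<close>.\<close>

definition type1_choice :: "nat \<Rightarrow> real \<Rightarrow> nat \<Rightarrow> (nat \<Rightarrow> nat set) pmf" where
  "type1_choice b q N =
     Pi_pmf {..<b} {} (\<lambda>i. pmf_of_set {A. A \<subseteq> block b N i \<and> card A = type1_count b q N})"

definition partners :: "nat \<Rightarrow> (nat \<Rightarrow> nat) \<Rightarrow> nat \<Rightarrow> (nat \<Rightarrow> nat set) \<Rightarrow> nat \<Rightarrow> nat set" where
  "partners b h N A s =
     (if s \<in> A (block_of b N s) then A (h (block_of b N s)) else {..<N} - (\<Union>i<b. A i))"

text \<open>
  \<open>connect C r U\<close> performs \<open>r\<close> connection steps on the set \<open>U\<close> of unconnected stubs, where \<open>C s\<close> is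
  the set of stubs to which \<open>s\<close> may be connected. The result is the set of edges, an edge being
  the set of its two stubs; self-loops and multiple edges of the graph are thus accounted for.
\<close>

primrec connect :: "(nat \<Rightarrow> nat set) \<Rightarrow> nat \<Rightarrow> nat set \<Rightarrow> nat set set pmf" where
  "connect C 0 U = return_pmf {}"
| "connect C (Suc r) U = do {
     s \<leftarrow> pmf_of_set U;
     t \<leftarrow> pmf_of_set (C s \<inter> U - {s});
     M \<leftarrow> connect C r (U - {s, t});
     return_pmf (insert {s, t} M)
   }"

definition random_graph ::
  "nat \<Rightarrow> real \<Rightarrow> (nat \<Rightarrow> nat) \<Rightarrow> nat \<Rightarrow> (nat \<Rightarrow> nat) \<Rightarrow> nat set set pmf" where
  "random_graph b q h n k = do {
     let N = num_stubs n k;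
     A \<leftarrow> type1_choice b q N;
     connect (partners b h N A) (N div 2) {..<N}
   }"

text \<open>
  In \<open>evenly_placed\<close> the vertices in \<open>V i\<close> are those with degree in \<open>H i\<close>, so that the sets \<open>H i\<close>
  and the partition of the sample describe the same blocks.
\<close>

definition evenly_placed :: "nat \<Rightarrow> (nat \<Rightarrow> nat set) \<Rightarrow> nat \<Rightarrow> (nat \<Rightarrow> nat) \<Rightarrow> bool" where
  "evenly_placed b H n k \<longleftrightarrow>
     (\<exists>V. (\<Union>i<b. V i) = {..<n} \<and> disjoint_family_on V {..<b} \<and>
          (\<forall>l1<b. \<forall>l2<b. l1 \<noteq> l2 \<longrightarrow> (\<forall>i\<in>V l1. \<forall>j\<in>V l2. k i \<noteq> k j)) \<and>
          (\<forall>i<b. (\<Sum>j\<in>V i. k j) = num_stubs n k div b) \<and>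
          (\<forall>i<b. \<forall>j\<in>V i. k j \<in> H i))"

text \<open>
  The construction can connect all stubs only if the number of type 1 stubs is even in every block
  \<open>i\<close> with \<open>h i = i\<close>, since these stubs are connected among themselves. Conversely, if this holds
  and the total number of stubs is even, the process never runs out of partners.
\<close>

definition completable :: "nat \<Rightarrow> real \<Rightarrow> (nat \<Rightarrow> nat) \<Rightarrow> nat \<Rightarrow> bool" where
  "completable b q h N \<longleftrightarrow> even N \<and> (\<forall>i<b. h i = i \<longrightarrow> even (type1_count b q N))"

definition admissible_seqs ::
  "nat pmf \<Rightarrow> nat \<Rightarrow> real \<Rightarrow> (nat \<Rightarrow> nat) \<Rightarrow> (nat \<Rightarrow> nat set) \<Rightarrow> nat \<Rightarrow> (nat \<Rightarrow> nat) set" where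
  "admissible_seqs p b q h H n =
     {k. b dvd num_stubs n k \<and> completable b q h (num_stubs n k) \<and>
         real (num_stubs n k) / real n = mean_degree p \<and> evenly_placed b H n k}"

abbreviation iid_degrees :: "nat pmf \<Rightarrow> nat \<Rightarrow> (nat \<Rightarrow> nat) pmf" where
  "iid_degrees p n \<equiv> Pi_pmf {..<n} 0 (\<lambda>_. p)"

definition admissible_sizes ::
  "nat pmf \<Rightarrow> nat \<Rightarrow> real \<Rightarrow> (nat \<Rightarrow> nat) \<Rightarrow> (nat \<Rightarrow> nat set) \<Rightarrow> nat set" where
  "admissible_sizes p b q h H =
     {n. set_pmf (iid_degrees p n) \<inter> admissible_seqs p b q h H n \<noteq> {}}"

text \<open>
  Joint law of the degrees at the two ends of a uniformly chosen edge, for graphs with \<open>n\<close> vertices.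
  Which end comes first is decided by a fair choice. Only meaningful for admissible \<open>n\<close>, as otherwise
  the conditioning event has probability zero.
\<close>

definition edge_degrees ::
  "nat pmf \<Rightarrow> nat \<Rightarrow> real \<Rightarrow> (nat \<Rightarrow> nat) \<Rightarrow> (nat \<Rightarrow> nat set) \<Rightarrow> nat \<Rightarrow> (nat \<times> nat) pmf" where
  "edge_degrees p b q h H n = do {
     k \<leftarrow> cond_pmf (iid_degrees p n) (admissible_seqs p b q h H n);
     M \<leftarrow> random_graph b q h n k;
     e \<leftarrow> pmf_of_set M;
     s \<leftarrow> pmf_of_set e;
     t \<leftarrow> pmf_of_set (e - {s});
     return_pmf (stub_degree n k s, stub_degree n k t)
   }"

text \<open>The number of stubs is \<open>n * mean_degree p\<close> for admissible \<open>n\<close>, so it tends to infinity with \<open>n\<close>.\<close>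

definition limit_edge_degrees ::
  "nat pmf \<Rightarrow> nat \<Rightarrow> real \<Rightarrow> (nat \<Rightarrow> nat) \<Rightarrow> (nat \<Rightarrow> nat set) \<Rightarrow> (nat \<times> nat) pmf \<Rightarrow> bool" where
  "limit_edge_degrees p b q h H D \<longleftrightarrow>
     (\<forall>x y. ((\<lambda>n. pmf (edge_degrees p b q h H n) (x, y)) \<longlongrightarrow> pmf D (x, y))
              (inf sequentially (principal (admissible_sizes p b q h H))))"

definition std_dev :: "'a pmf \<Rightarrow> ('a \<Rightarrow> real) \<Rightarrow> real" where
  "std_dev D f = sqrt (measure_pmf.variance D f)"

definition pearson :: "(nat \<times> nat) pmf \<Rightarrow> real" where
  "pearson D =
     (measure_pmf.expectation D (\<lambda>(x, y). real x * real y) -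
      measure_pmf.expectation D (\<lambda>(x, y). real x) * measure_pmf.expectation D (\<lambda>(x, y). real y)) /
     (std_dev D (\<lambda>(x, y). real x) * std_dev D (\<lambda>(x, y). real y))"

definition size_biased :: "nat pmf \<Rightarrow> nat pmf" where
  "size_biased p = embed_pmf (\<lambda>x. real x * pmf p x / mean_degree p)"

definition block_moment :: "nat pmf \<Rightarrow> (nat \<Rightarrow> nat set) \<Rightarrow> nat \<Rightarrow> real" where
  "block_moment p H i = (\<Sum>\<^sub>\<infinity>x\<in>H i. (real x)\<^sup>2 * pmf p x)"

text \<open>Both \<open>X\<close> and \<open>Y\<close> have the size-biased marginal, hence the square of its standard deviation.\<close>

definition corr_coeff :: "nat pmf \<Rightarrow> nat \<Rightarrow> (nat \<Rightarrow> nat) \<Rightarrow> (nat \<Rightarrow> nat set) \<Rightarrow> real" where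
  "corr_coeff p b h H =
     (let u = block_moment p H; \<sigma> = std_dev (size_biased p) real in
        (real b * (\<Sum>i<b. u i * u (h i)) - (\<Sum>i<b. \<Sum>j<b. u i * u j)) /
        (\<sigma> * \<sigma> * (mean_degree p)\<^sup>2))"

text \<open>
  Blocks consist of consecutive stubs in the order of their degrees, so block \<open>i\<close> can hold the stubs
  with degree in \<open>H i\<close> only if the sets \<open>H i\<close> are arranged in increasing order. This concerns only
  degrees which occur and which contribute stubs.
\<close>

definition blocks_sorted :: "nat pmf \<Rightarrow> nat \<Rightarrow> (nat \<Rightarrow> nat set) \<Rightarrow> bool" where
  "blocks_sorted p b H \<longleftrightarrow>
     (\<forall>i<b. \<forall>j<b. i < j \<longrightarrow>
        (\<forall>x\<in>H i \<inter> set_pmf p. \<forall>y\<in>H j \<inter> set_pmf p. 0 < x \<longrightarrow> 0 < y \<longrightarrow> x < y))"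

end

theory Submission
  imports Defs
begin

text \<open>
  Given the degree sequence, the law of the edge degrees is explicit: swapping two stubs of the same
  type and block preserves the law of the graph, so the partner of a stub is uniform on its
  admissible stubs, and the probability that two stubs are connected depends only on their blocks.
  Blocks being sorted by degree, the probability of the degrees \<open>(x, y)\<close> becomes a function of the
  numbers of vertices of degree \<open>x\<close> and of degree \<open>y\<close>. It remains to show that the proportion of
  vertices of degree \<open>x\<close> tends to \<open>p x\<close> although the i.i.d. degrees are conditioned on the rare event
  that all block sums agree exactly with their means. By Hoeffding's inequality a deviation of this
  proportion has exponentially small probability, so it suffices that the conditioning event has no
  exponentially small probability. For this, \<open>p\<close> is replaced by nearby finitely supported weights with
  the same block means, Dirichlet's approximation theorem turns these into integral counts which meet the
  constraints exactly, and the multinomial coefficient of the counts is estimated.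
\<close>

text \<open>The conditioning event is an exact arithmetic equality in every block, while
  \<open>p\<close> may have infinite support and the admissible sizes may be irregular. So its
  probability is only bounded below, by \<open>C / ((exp 1 * n) ^ r * \<kappa> ^ n)\<close> for an
  arbitrary \<open>\<kappa> > 1\<close>, which is enough because Hoeffding's bound decays at a fixed
  exponential rate. The freedom in \<open>\<kappa>\<close> decides the form of the approximations:
  the new weights need only be positive and at most \<open>1 + \<epsilon>\<close> times the old
  ones, since a sample whose counts are at most \<open>\<kappa> * n * p x\<close> has a composition
  of probability at least \<open>\<kappa> ^ (- n)\<close> up to a polynomial factor. On the graph
  side, the two connection rules become one when all type 2 stubs form an additional class fixed by
  \<open>h\<close>: a stub of class \<open>c\<close> is joined to a stub of class
  \<open>h c\<close>. The quantity to follow is then the number of stubs per class, which decides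
  both that the process never runs out of partners and how many partners a stub has.\<close>

section \<open>Random matchings\<close>

text \<open>Every draw of \<open>connect\<close> must be from a nonempty set, as
  \<open>pmf_of_set {}\<close> has no useful meaning. The predicate demands this along all possible
  histories, and that exactly \<open>r\<close> steps exhaust \<open>U\<close>.\<close>

primrec never_stuck :: "(nat \<Rightarrow> nat set) \<Rightarrow> nat \<Rightarrow> nat set \<Rightarrow> bool" where
  "never_stuck C 0 U \<longleftrightarrow> U = {}"
| "never_stuck C (Suc r) U \<longleftrightarrow>
     U \<noteq> {} \<and> (\<forall>s\<in>U. C s \<inter> U - {s} \<noteq> {} \<and> (\<forall>t\<in>C s \<inter> U - {s}. never_stuck C r (U - {s, t})))"

definition perfect_matching :: "'a set \<Rightarrow> 'a set set \<Rightarrow> bool" where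
  "perfect_matching U M \<longleftrightarrow> \<Union>M = U \<and> disjoint M \<and> (\<forall>e\<in>M. card e = 2)"

lemma set_pmf_connect_Suc:
  assumes "finite U" "never_stuck C (Suc r) U" "M \<in> set_pmf (connect C (Suc r) U)"
  obtains s t M' where "s \<in> U" "t \<in> C s" "t \<in> U" "t \<noteq> s" "never_stuck C r (U - {s, t})"
    "M' \<in> set_pmf (connect C r (U - {s, t}))" "M = insert {s, t} M'"
proof -
  from assms obtain s where s: "s \<in> U" and
    M: "M \<in> set_pmf (pmf_of_set (C s \<inter> U - {s}) \<bind> (\<lambda>t. connect C r (U - {s, t}) \<bind>
          (\<lambda>M. return_pmf (insert {s, t} M))))"
    by (auto simp: set_pmf_of_set)
  have "finite (C s \<inter> U - {s})" "C s \<inter> U - {s} \<noteq> {}"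
    using assms s by auto
  with M obtain t where t: "t \<in> C s \<inter> U - {s}" and
    "M \<in> set_pmf (connect C r (U - {s, t}) \<bind> (\<lambda>M. return_pmf (insert {s, t} M)))"
    by (auto simp: set_pmf_of_set)
  then show thesis
    using that[of s t] s assms(2) by auto
qed

lemma connect_perfect_matching:
  assumes "finite U" "never_stuck C r U" "M \<in> set_pmf (connect C r U)"
  shows "perfect_matching U M"
  using assms
proof (induction r arbitrary: U M)
  case 0
  then show ?case by (simp add: perfect_matching_def)
next
  case (Suc r)
  from Suc.prems obtain s t M' where st: "s \<in> U" "t \<in> U" "t \<noteq> s"
    "never_stuck C r (U - {s, t})" "M' \<in> set_pmf (connect C r (U - {s, t}))" "M = insert {s, t} M'"
    by (rule set_pmf_connect_Suc)
  then have "perfect_matching (U - {s, t}) M'"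
    using Suc.IH[of "U - {s, t}" M'] Suc.prems(1) by blast
  then show ?case
    unfolding perfect_matching_def \<open>M = _\<close> using st(1-3)
    by (auto simp: pairwise_insert disjnt_def)
qed

text \<open>An edge does not record which of its stubs was drawn first, so one step gives
  admissibility in one direction only; the symmetry of \<open>C\<close> on \<open>U\<close> supplies
  the other.\<close>

lemma connect_respects:
  assumes "finite U" "never_stuck C r U" "M \<in> set_pmf (connect C r U)"
    and "\<And>s t. s \<in> U \<Longrightarrow> t \<in> U \<Longrightarrow> t \<in> C s \<Longrightarrow> s \<in> C t"
    and "{s, t} \<in> M"
  shows "t \<in> C s"
  using assms
proof (induction r arbitrary: U M)
  case 0
  then show ?case by simp
next
  case (Suc r)
  from Suc.prems(1-3) obtain s' t' M' where st: "s' \<in> U" "t' \<in> C s'" "t' \<in> U" "t' \<noteq> s'"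
    "never_stuck C r (U - {s', t'})" "M' \<in> set_pmf (connect C r (U - {s', t'}))"
    "M = insert {s', t'} M'"
    by (rule set_pmf_connect_Suc)
  show ?case
  proof (cases "{s, t} = {s', t'}")
    case True
    then show ?thesis
      using st Suc.prems(4) by (auto simp: doubleton_eq_iff)
  next
    case False
    show ?thesis
    proof (rule Suc.IH[of "U - {s', t'}" M'])
      show "{s, t} \<in> M'" using False Suc.prems(5) st(7) by blast
    qed (use Suc.prems(1,4) st in \<open>blast+\<close>)
  qed
qed

text \<open>A relabelling that respects \<open>C\<close> commutes with every single draw, because an
  injection carries the uniform law on a nonempty finite set to the uniform law on its
  image.\<close>

lemma connect_equivariant:
  assumes "finite U" "never_stuck C r U" "inj \<pi>"
    and "\<And>s t. s \<in> U \<Longrightarrow> t \<in> U \<Longrightarrow> \<pi> t \<in> C (\<pi> s) \<longleftrightarrow> t \<in> C s"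
  shows "connect C r (\<pi> ` U) = map_pmf ((`) ((`) \<pi>)) (connect C r U)"
  using assms
proof (induction r arbitrary: U)
  case 0
  then show ?case by simp
next
  case (Suc r)
  have inj: "inj_on \<pi> X" for X
    using Suc.prems(3) inj_on_subset by blast
  have U: "pmf_of_set (\<pi> ` U) = map_pmf \<pi> (pmf_of_set U)"
    using Suc.prems by (subst map_pmf_of_set_inj) (auto intro: inj)
  have C: "pmf_of_set (C (\<pi> s) \<inter> \<pi> ` U - {\<pi> s}) = map_pmf \<pi> (pmf_of_set (C s \<inter> U - {s}))"
    if "s \<in> U" for s
  proof -
    have "C (\<pi> s) \<inter> \<pi> ` U - {\<pi> s} = \<pi> ` (C s \<inter> U - {s})"
      using Suc.prems(3,4) that by (auto dest: injD)
    then show ?thesis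
      using Suc.prems that by (subst map_pmf_of_set_inj) (auto intro: inj)
  qed
  have R: "connect C r (\<pi> ` U - {\<pi> s, \<pi> t}) = map_pmf ((`) ((`) \<pi>)) (connect C r (U - {s, t}))"
    if "s \<in> U" "t \<in> C s \<inter> U - {s}" for s t
  proof -
    have "\<pi> ` U - {\<pi> s, \<pi> t} = \<pi> ` (U - {s, t})"
      using Suc.prems(3) by (auto dest: injD)
    moreover have "never_stuck C r (U - {s, t})"
      using Suc.prems(2) that by simp
    ultimately show ?thesis
      using Suc.IH[of "U - {s, t}"] Suc.prems(1,3,4) by simp
  qed
  have S: "set_pmf (pmf_of_set U) = U" 
    using Suc.prems by simp
  have S': "set_pmf (pmf_of_set (C s \<inter> U - {s})) = C s \<inter> U - {s}" if "s \<in> U" for s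
    using Suc.prems that by (intro set_pmf_of_set) auto
  have "connect C (Suc r) (\<pi> ` U) = pmf_of_set U \<bind>
          (\<lambda>s. pmf_of_set (C (\<pi> s) \<inter> \<pi> ` U - {\<pi> s}) \<bind> (\<lambda>t. connect C r (\<pi> ` U - {\<pi> s, t}) \<bind>
            (\<lambda>M. return_pmf (insert {\<pi> s, t} M))))"
    unfolding connect.simps U bind_map_pmf ..
  also have "\<dots> = pmf_of_set U \<bind>
          (\<lambda>s. pmf_of_set (C s \<inter> U - {s}) \<bind> (\<lambda>t. connect C r (U - {s, t}) \<bind>
            (\<lambda>M. map_pmf ((`) ((`) \<pi>)) (return_pmf (insert {s, t} M)))))"
  proof (rule bind_pmf_cong[OF refl])
    fix s assume "s \<in> set_pmf (pmf_of_set U)"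
    then have s: "s \<in> U" by (simp add: S)
    show "pmf_of_set (C (\<pi> s) \<inter> \<pi> ` U - {\<pi> s}) \<bind> (\<lambda>t. connect C r (\<pi> ` U - {\<pi> s, t}) \<bind>
            (\<lambda>M. return_pmf (insert {\<pi> s, t} M))) =
          pmf_of_set (C s \<inter> U - {s}) \<bind> (\<lambda>t. connect C r (U - {s, t}) \<bind>
            (\<lambda>M. map_pmf ((`) ((`) \<pi>)) (return_pmf (insert {s, t} M))))"
      unfolding C[OF s] bind_map_pmf
    proof (rule bind_pmf_cong[OF refl])
      fix t assume "t \<in> set_pmf (pmf_of_set (C s \<inter> U - {s}))"
      then have t: "t \<in> C s \<inter> U - {s}" using S'[OF s] by simp
      show "connect C r (\<pi> ` U - {\<pi> s, \<pi> t}) \<bind> (\<lambda>M. return_pmf (insert {\<pi> s, \<pi> t} M)) =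
        connect C r (U - {s, t}) \<bind> (\<lambda>M. map_pmf ((`) ((`) \<pi>)) (return_pmf (insert {s, t} M)))"
        unfolding R[OF s t] bind_map_pmf by simp
    qed
  qed
  also have "\<dots> = map_pmf ((`) ((`) \<pi>)) (connect C (Suc r) U)"
    unfolding connect.simps map_bind_pmf ..
  finally show ?case .
qed

text \<open>Invariant of the process when stubs of class \<open>c\<close> are joined to stubs of
  class \<open>g c\<close>: paired classes have the same size, and a class paired with itself can be
  matched internally.\<close>

definition balanced :: "('a \<Rightarrow> 'c) \<Rightarrow> ('c \<Rightarrow> 'c) \<Rightarrow> 'a set \<Rightarrow> bool" where
  "balanced cl g U \<longleftrightarrow>
     (\<forall>c. card {t\<in>U. cl t = c} = card {t\<in>U. cl t = g c} \<and> (g c = c \<longrightarrow> even (card {t\<in>U. cl t = c})))"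

text \<open>A step removes one stub of some class and one of its partner class, so balance persists.
  If \<open>s\<close> had no partner, its partner class would be nonempty by balance and contained
  in \<open>{s}\<close>, hence a self-paired class of size 1, against parity.\<close>

lemma balanced_never_stuck:
  assumes "finite U" "balanced cl g U" "card U = 2 * r" "\<And>c. g (g c) = c"
    and "\<And>s t. s \<in> U \<Longrightarrow> t \<in> U \<Longrightarrow> t \<in> C s \<longleftrightarrow> cl t = g (cl s)"
  shows "never_stuck C r U"
  using assms
proof (induction r arbitrary: U)
  case 0
  then show ?case by simp
next
  case (Suc r)
  have "U \<noteq> {}" using Suc.prems by auto
  moreover have "C s \<inter> U - {s} \<noteq> {}" if s: "s \<in> U" for s
  proof
    assume "C s \<inter> U - {s} = {}"
    then have sub: "{t\<in>U. cl t = g (cl s)} \<subseteq> {s}"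
      using Suc.prems(5) s by auto
    have pos: "card {t\<in>U. cl t = cl s} > 0"
      using s Suc.prems(1) by (auto simp: card_gt_0_iff)
    have eq: "card {t\<in>U. cl t = cl s} = card {t\<in>U. cl t = g (cl s)}"
      using Suc.prems(2) by (auto simp: balanced_def)
    with pos have single: "{t\<in>U. cl t = g (cl s)} = {s}"
      using sub by (metis card.empty less_irrefl subset_singletonD)
    have "s \<in> {t\<in>U. cl t = g (cl s)}" unfolding single by (rule singletonI)
    then have "g (cl s) = cl s" unfolding mem_Collect_eq by (rule conjunct2[THEN sym])
    moreover have "card {t\<in>U. cl t = cl s} = 1" unfolding eq single by simp
    moreover have "g (cl s) = cl s \<longrightarrow> even (card {t\<in>U. cl t = cl s})"
      using Suc.prems(2) unfolding balanced_def by blast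
    ultimately show False by simp
  qed
  moreover have "never_stuck C r (U - {s, t})" if s: "s \<in> U" and t: "t \<in> C s \<inter> U - {s}" for s t
  proof -
    have cl: "cl t = g (cl s)" "cl s = g (cl t)"
      using Suc.prems(4,5) s t by auto
    have cd: "card {u\<in>U. cl u = c} = card {u\<in>U - {s, t}. cl u = c} + of_bool (cl s = c) + of_bool (cl t = c)"
      for c
    proof -
      have card_filter: "card {u\<in>X. cl u = c} = (\<Sum>u\<in>X. of_bool (cl u = c))" if "finite X" for X
        using that by (simp add: Int_def)
      have "(\<Sum>u\<in>U. of_bool (cl u = c)) = of_bool (cl s = c) + (\<Sum>u\<in>U - {s}. of_bool (cl u = c) :: nat)"
        by (rule sum.remove[OF Suc.prems(1) s])
      also have "(\<Sum>u\<in>U - {s}. of_bool (cl u = c) :: nat) =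
          of_bool (cl t = c) + (\<Sum>u\<in>U - {s} - {t}. of_bool (cl u = c))"
        using s t Suc.prems(1) by (intro sum.remove) auto
      also have "U - {s} - {t} = U - {s, t}" by blast
      finally show ?thesis
        unfolding card_filter[OF Suc.prems(1)] card_filter[OF finite_Diff[OF Suc.prems(1)]]
        by (simp only: add_ac)
    qed
    have g: "g c = d \<longleftrightarrow> c = g d" for c d
      using Suc.prems(4) by metis
    have "balanced cl g (U - {s, t})"
      unfolding balanced_def
    proof (intro allI conjI impI)
      fix c
      have "card {u\<in>U. cl u = c} = card {u\<in>U. cl u = g c}"
        using Suc.prems(2) by (auto simp: balanced_def)
      moreover have "cl s = g c \<longleftrightarrow> cl t = c" "cl t = g c \<longleftrightarrow> cl s = c"
        using cl g by metis+
      ultimately show "card {u\<in>U - {s, t}. cl u = c} = card {u\<in>U - {s, t}. cl u = g c}"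
        using cd[of c] cd[of "g c"] by simp
    next
      fix c assume c: "g c = c"
      then have "even (card {u\<in>U. cl u = c})"
        using Suc.prems(2) by (auto simp: balanced_def)
      moreover have "cl s = c \<longleftrightarrow> cl t = c" using c cl g by metis
      ultimately show "even (card {u\<in>U - {s, t}. cl u = c})"
        using cd[of c] by (auto split: if_splits simp: of_bool_def)
    qed
    moreover have "card (U - {s, t}) = 2 * r"
      using s t Suc.prems(1,3) by (subst card_Diff_subset) auto
    ultimately show ?thesis
      using Suc.IH[of "U - {s, t}"] Suc.prems(1,4,5) by blast
  qed
  ultimately show ?case by simp
qed

lemma perfect_matching_unique_partner:
  assumes "perfect_matching U M" "s \<in> U"
  shows "\<exists>!t. {s, t} \<in> M"
proof -
  obtain e where e: "e \<in> M" "s \<in> e"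
    using assms by (auto simp: perfect_matching_def)
  then obtain t where "e = {s, t}"
    using assms(1) unfolding perfect_matching_def by (metis card_2_iff insertE insert_commute singletonD)
  moreover have "t' = t" if "{s, t'} \<in> M" for t'
  proof -
    have "{s, t'} = e"
      using assms(1) e that unfolding perfect_matching_def
      by (metis disjnt_iff insertI1 pairwiseD)
    then show ?thesis using \<open>e = {s, t}\<close> by (auto simp: doubleton_eq_iff)
  qed
  ultimately show ?thesis using e by blast
qed

lemma perfect_matching_no_loop:
  assumes "perfect_matching U M" "{s, t} \<in> M"
  shows "s \<in> U" "t \<in> U" "s \<noteq> t"
proof -
  show "s \<in> U" "t \<in> U" using assms by (auto simp: perfect_matching_def)
  have "card {s, t} = 2" using assms by (auto simp: perfect_matching_def)
  then show "s \<noteq> t" by auto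
qed

text \<open>
  Swapping two admissible partners \<open>t\<close>, \<open>t'\<close> of \<open>s\<close> preserves the law of the matching, so the
  partner of \<open>s\<close> is uniform on the admissible stubs.
\<close>

lemma connect_partner_prob:
  assumes fin: "finite U" and ns: "never_stuck C r U" and inv: "\<And>c. g (g c) = c"
    and C: "\<And>s t. s \<in> U \<Longrightarrow> t \<in> U \<Longrightarrow> t \<in> C s \<longleftrightarrow> cl t = g (cl s)"
    and s: "s \<in> U"
  shows "measure_pmf.prob (connect C r U) {M. {s, t} \<in> M} =
           of_bool (t \<in> C s \<inter> U - {s}) / real (card (C s \<inter> U - {s}))"
proof -
  let ?T = "C s \<inter> U - {s}"
  let ?P = "\<lambda>t. measure_pmf.prob (connect C r U) {M. {s, t} \<in> M}"
  have pm: "perfect_matching U M" if "M \<in> set_pmf (connect C r U)" for M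
    using connect_perfect_matching[OF fin ns that] .
  have sym: "s \<in> C t" if "s \<in> U" "t \<in> U" "t \<in> C s" for s t
    using C[of s t] C[of t s] that inv by simp
  have T: "t \<in> ?T" if "M \<in> set_pmf (connect C r U)" "{s, t} \<in> M" for t M
  proof -
    have "t \<in> C s" using connect_respects[OF fin ns that(1) _ that(2)] sym by blast
    then show ?thesis using perfect_matching_no_loop[OF pm[OF that(1)] that(2)] by auto
  qed
  have zero: "?P t = 0" if "t \<notin> ?T" for t
    using T that by (auto simp: measure_pmf_zero_iff)
  have const: "?P t = ?P t'" if t: "t \<in> ?T" "t' \<in> ?T" for t t'
  proof -
    let ?\<pi> = "Transposition.transpose t t'"
    have cl: "cl (?\<pi> u) = cl u" for u
      using t C[of s t] C[of s t'] s by (auto simp: Transposition.transpose_def)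
    have im: "?\<pi> ` U = U"
      using t by (intro transpose_image_eq) auto
    have \<pi>U: "?\<pi> u \<in> U" if "u \<in> U" for u using im that by blast
    have "connect C r (?\<pi> ` U) = map_pmf ((`) ((`) ?\<pi>)) (connect C r U)"
      by (rule connect_equivariant[OF fin ns]) (auto simp: C cl \<pi>U)
    then have "?P t = measure_pmf.prob (connect C r U) (((`) ((`) ?\<pi>)) -` {M. {s, t} \<in> M})"
      unfolding im by (metis measure_map_pmf)
    also have "((`) ((`) ?\<pi>)) -` {M. {s, t} \<in> M} = {M. {s, t'} \<in> M}"
    proof -
      have *: "?\<pi> ` {s, t'} = {s, t}" 
        using t by (auto simp: Transposition.transpose_def)
      have "inj (image ?\<pi>)"
        by (rule injI) (metis inj_image_eq_iff injI transpose_involutory)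
      then have "{s, t} \<in> (`) ?\<pi> ` M \<longleftrightarrow> {s, t'} \<in> M" for M
        unfolding *[symmetric] by (rule inj_image_mem_iff)
      then show ?thesis by auto
    qed
    finally show ?thesis .
  qed
  \<comment> \<open>Each matching in the support gives \<open>s\<close> exactly one partner, so the
    events \<open>E t\<close> are disjoint and exhaust the support. Having equal probabilities, they
    share the total mass 1 evenly.\<close>
  define E where "E = (\<lambda>t. {M. {s, t} \<in> M} \<inter> set_pmf (connect C r U))"
  have unique: "\<exists>!t. {s, t} \<in> M" if "M \<in> set_pmf (connect C r U)" for M
    using perfect_matching_unique_partner[OF pm[OF that] s] .
  have "E t \<inter> E t' = {}" if "t \<noteq> t'" for t t'
    using unique that unfolding E_def by blast
  then have "measure_pmf.prob (connect C r U) (\<Union>t\<in>?T. E t) =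
      (\<Sum>t\<in>?T. measure_pmf.prob (connect C r U) (E t))"
    using fin by (intro measure_pmf.finite_measure_finite_Union) (auto simp: disjoint_family_on_def)
  also have "\<dots> = (\<Sum>t\<in>?T. ?P t)"
    by (simp add: E_def measure_Int_set_pmf)
  finally have "(\<Sum>t\<in>?T. ?P t) = measure_pmf.prob (connect C r U) (\<Union>t\<in>?T. E t)" ..
  also have "\<dots> = 1"
  proof -
    have "M \<in> (\<Union>t\<in>?T. E t)" if "M \<in> set_pmf (connect C r U)" for M
      using T[OF that] unique[OF that] that unfolding E_def by blast
    then show ?thesis
      by (subst measure_pmf.prob_eq_1) (simp_all add: AE_measure_pmf_iff)
  qed
  finally have sum: "(\<Sum>t\<in>?T. ?P t) = 1" .
  show ?thesis
  proof (cases "t \<in> ?T")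
    case True
    have "(\<Sum>t'\<in>?T. ?P t') = (\<Sum>t'\<in>?T. ?P t)"
      by (rule sum.cong[OF refl const[OF _ True]])
    also have "\<dots> = real (card ?T) * ?P t" by simp
    finally have "real (card ?T) * ?P t = 1" using sum by simp
    moreover from this have "real (card ?T) \<noteq> 0" by fastforce
    ultimately have "?P t = 1 / real (card ?T)"
      by (metis nonzero_mult_div_cancel_left)
    then show ?thesis by (simp only: True of_bool_eq)
  next
    case False
    show ?thesis by (simp only: zero[OF False] False of_bool_eq div_0)
  qed
qed

section \<open>Probability that two given stubs are connected\<close>

lemma prob_bind_pmf:
  "measure_pmf.prob (bind_pmf p f) X = measure_pmf.expectation p (\<lambda>x. measure_pmf.prob (f x) X)"
proof -
  have prob: "measure_pmf.prob D X = pmf (map_pmf (\<lambda>x. x \<in> X) D) True" for D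
    by (simp add: pmf_map vimage_def)
  show ?thesis
    unfolding prob map_bind_pmf pmf_bind ..
qed

text \<open>The elements with \<open>x < h x\<close> are exchanged by \<open>h\<close> with those
  with \<open>h x < x\<close>. This serves to show that the number of blocks is even if
  \<open>h\<close> fixes none.\<close>

lemma even_card_fixpoint_free_involution:
  fixes h :: "'a::linorder \<Rightarrow> 'a"
  assumes "finite S" "h ` S \<subseteq> S" "\<And>x. x \<in> S \<Longrightarrow> h (h x) = x" "\<And>x. x \<in> S \<Longrightarrow> h x \<noteq> x"
  shows "even (card S)"
proof -
  have "bij_betw h {x\<in>S. x < h x} {x\<in>S. h x < x}"
    by (rule bij_betw_byWitness[where f' = h]) (use assms(2,3) in auto)
  then have "card {x\<in>S. x < h x} = card {x\<in>S. h x < x}"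
    by (rule bij_betw_same_card)
  moreover have S: "{x\<in>S. x < h x} \<union> {x\<in>S. h x < x} = S"
    using assms(4) by (auto simp: neq_iff)
  have "card ({x\<in>S. x < h x} \<union> {x\<in>S. h x < x}) = card {x\<in>S. x < h x} + card {x\<in>S. h x < x}"
    using assms(1) by (intro card_Un_disjoint) auto
  ultimately show ?thesis unfolding S by simp
qed

text \<open>\<open>B\<close> is the common block size and \<open>T\<close> the number of type 1
  stubs in each block. Both enter only as numbers, so that connection probabilities are computed
  before any degree sequence is mentioned.\<close>

locale block_model =
  fixes b B N T :: nat and q :: real and h :: "nat \<Rightarrow> nat"
  assumes b: "0 < b" and B: "0 < B" and N: "N = b * B"
    and q: "0 \<le> q" "q \<le> 1"
    and h_permutes: "h permutes {..<b}" and h_inv: "\<And>i. i < b \<Longrightarrow> h (h i) = i"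
    and completable: "completable b q h N"
    and T: "T = type1_count b q N"
begin

lemma N_div_b: "N div b = B"
  using N b by simp

lemma block_eq: "i < b \<Longrightarrow> block b N i = {i * B..<Suc i * B}"
proof -
  assume i: "i < b"
  have "s < N" if "s < Suc i * B" for s
  proof -
    have "Suc i * B \<le> N" unfolding N using i by (intro mult_right_mono) auto
    with that show ?thesis by simp
  qed
  moreover have "s div B = i \<longleftrightarrow> i * B \<le> s \<and> s < Suc i * B" for s
    using B by (simp add: div_nat_eqI dividend_less_div_times div_times_less_eq_dividend order_le_less_trans)
      (metis div_nat_eqI mult.commute mult_Suc dividend_less_times_div div_times_less_eq_dividend add.commute)
  ultimately show ?thesis
    unfolding block_def block_of_def N_div_b by auto
qed

lemma card_block: "i < b \<Longrightarrow> card (block b N i) = B"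
  by (simp add: block_eq)

lemma finite_block: "finite (block b N i)"
  by (simp add: block_def)

lemma block_of_less:
  assumes "s < N" shows "block_of b N s < b"
proof -
  have "s < b * B" using assms N by simp
  then show ?thesis unfolding block_of_def N_div_b by (rule less_mult_imp_div_less)
qed

lemma T_le: "T \<le> B"
proof -
  have "real N * q / real b = real B * q" using b by (simp add: N)
  also have "\<dots> \<le> real B" using q by (simp add: mult_left_le)
  finally show ?thesis unfolding T type1_count_def by (simp add: ceiling_le_iff)
qed

lemma h_less: "i < b \<Longrightarrow> h i < b"
  using h_permutes permutes_in_image by fastforce

lemma h_outside: "\<not> i < b \<Longrightarrow> h i = i"
  using h_permutes unfolding permutes_def by auto

lemma h_involution: "h (h i) = i"
  using h_inv h_outside by (cases "i < b") auto

lemma even_T: "i < b \<Longrightarrow> h i = i \<Longrightarrow> even T"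
  using completable unfolding completable_def T by auto

lemma even_N: "even N"
  using completable unfolding completable_def by auto

text \<open>Either some block is paired with itself, which forces \<open>T\<close> to be even, or
  \<open>h\<close> fixes no block, which forces \<open>b\<close> to be even. As \<open>N\<close> is
  even, the number of type 2 stubs is then even as well, as it must be for stubs matched among
  themselves.\<close>

lemma even_bT: "even (b * T)"
proof (cases "\<exists>i<b. h i = i")
  case True
  then show ?thesis using even_T by auto
next
  case False
  then have "even (card {..<b})"
    by (intro even_card_fixpoint_free_involution[of _ h]) (auto simp: h_less h_involution)
  then show ?thesis by simp
qed

lemma type1_sets_nonempty:
  assumes "i < b" shows "{A. A \<subseteq> block b N i \<and> card A = T} \<noteq> {}"
  using obtain_subset_with_card_n[of T "block b N i"] T_le card_block[OF assms] by auto

lemma finite_type1_sets: "finite {A. A \<subseteq> block b N i \<and> card A = T}"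
  by (rule finite_subset[of _ "Pow (block b N i)"]) (auto simp: finite_block)

lemma set_type1_choice:
  "set_pmf (type1_choice b q N) =
     PiE_dflt {..<b} {} (\<lambda>i. {A. A \<subseteq> block b N i \<and> card A = T})"
proof -
  have "set_pmf (pmf_of_set {A. A \<subseteq> block b N i \<and> card A = T}) = {A. A \<subseteq> block b N i \<and> card A = T}"
    if "i < b" for i
    using type1_sets_nonempty[OF that] finite_type1_sets by (rule set_pmf_of_set)
  then show ?thesis
    unfolding type1_choice_def T[symmetric] by (subst set_Pi_pmf) (auto simp: PiE_dflt_def)
qed

lemma finite_type1_choice: "finite (set_pmf (type1_choice b q N))"
  unfolding set_type1_choice by (intro finite_PiE_dflt finite_type1_sets) auto

lemma type1_choiceD:
  assumes "A \<in> set_pmf (type1_choice b q N)" "i < b"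
  shows "A i \<subseteq> block b N i" "card (A i) = T" "finite (A i)"
  using assms finite_subset[OF _ finite_block] unfolding set_type1_choice PiE_dflt_def by auto

text \<open>Stubs of one block are exchangeable: a transposition inside block \<open>j\<close> maps
  every block onto itself and therefore permutes the possible type 1 sets of each block.\<close>

lemma type1_choice_swap:
  assumes "t \<in> block b N j" "t' \<in> block b N j"
  shows "map_pmf (\<lambda>A i. Transposition.transpose t t' ` A i) (type1_choice b q N) = type1_choice b q N"
proof -
  let ?\<pi> = "Transposition.transpose t t'"
  have invol: "?\<pi> ` ?\<pi> ` X = X" for X by (simp add: image_image)
  have block: "?\<pi> ` block b N i = block b N i" for i
    using assms
    by (cases "i = j") (auto intro!: transpose_image_eq simp: block_def)
  have preserve: "?\<pi> ` A \<subseteq> block b N i \<and> card (?\<pi> ` A) = T" if "A \<subseteq> block b N i \<and> card A = T" for A i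
    using that image_mono[of A "block b N i" ?\<pi>] block[of i]
    by (auto simp: card_image)
  have "image ?\<pi> ` {A. A \<subseteq> block b N i \<and> card A = T} = {A. A \<subseteq> block b N i \<and> card A = T}" for i
  proof (intro equalityI subsetI)
    fix A assume "A \<in> {A. A \<subseteq> block b N i \<and> card A = T}"
    then have "?\<pi> ` A \<in> {A. A \<subseteq> block b N i \<and> card A = T}" using preserve by blast
    then show "A \<in> image ?\<pi> ` {A. A \<subseteq> block b N i \<and> card A = T}"
      by (rule image_eqI[rotated]) (rule invol[symmetric])
  qed (use preserve in blast)
  moreover have "inj_on (image ?\<pi>) X" for X
    by (metis invol inj_onI)
  ultimately have "map_pmf (image ?\<pi>) (pmf_of_set {A. A \<subseteq> block b N i \<and> card A = T}) =
      pmf_of_set {A. A \<subseteq> block b N i \<and> card A = T}" if "i < b" for i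
    using type1_sets_nonempty[OF that] finite_type1_sets by (subst map_pmf_of_set_inj) auto
  then have "Pi_pmf {..<b} {} (\<lambda>i. map_pmf (image ?\<pi>) (pmf_of_set {A. A \<subseteq> block b N i \<and> card A = T})) =
      type1_choice b q N"
    unfolding type1_choice_def T[symmetric] by (intro Pi_pmf_cong) auto
  then show ?thesis
    by (subst (asm) Pi_pmf_map) (simp_all add: type1_choice_def T comp_def[abs_def])
qed

abbreviation E where "E \<equiv> measure_pmf.expectation (type1_choice b q N)"

lemma E_swap:
  assumes "t \<in> block b N j" "t' \<in> block b N j"
  shows "E f = E (\<lambda>A. f (\<lambda>i. Transposition.transpose t t' ` A i) :: real)"
  by (subst type1_choice_swap[OF assms, symmetric]) simp

lemma integrable_E: "integrable (measure_pmf (type1_choice b q N)) f" for f :: "_ \<Rightarrow> real"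
  using finite_type1_choice by (rule integrable_measure_pmf_finite)

lemma E_cong: "(\<And>A. A \<in> set_pmf (type1_choice b q N) \<Longrightarrow> f A = g A) \<Longrightarrow> E f = E g" for f g :: "_ \<Rightarrow> real"
  by (intro integral_cong_AE) (auto simp: AE_measure_pmf_iff)

lemma mem_transpose_image: "u \<in> Transposition.transpose t t' ` X \<longleftrightarrow> Transposition.transpose t t' u \<in> X"
  by (metis image_iff transpose_involutory)

lemma sum_of_bool_mem: "finite X \<Longrightarrow> Y \<subseteq> X \<Longrightarrow> (\<Sum>t\<in>X. of_bool (t \<in> Y) :: real) = real (card Y)"
  by (simp add: Int_absorb1 Int_def[symmetric] inf_commute Collect_mem_eq)

text \<open>By exchangeability all \<open>B\<close> stubs of the block have the same probability,
  and these probabilities add up to \<open>T\<close>, the fixed size of \<open>A i\<close>.\<close>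

lemma E_type1:
  assumes i: "i < b" and s: "s \<in> block b N i"
  shows "E (\<lambda>A. of_bool (s \<in> A i)) = real T / real B"
proof -
  have const: "E (\<lambda>A. of_bool (s' \<in> A i)) = E (\<lambda>A. of_bool (s \<in> A i) :: real)" if "s' \<in> block b N i" for s'
    by (subst E_swap[OF s that]) (simp add: mem_transpose_image)
  have "real B * E (\<lambda>A. of_bool (s \<in> A i)) = (\<Sum>s'\<in>block b N i. E (\<lambda>A. of_bool (s' \<in> A i)))"
    using const card_block[OF i] by simp
  also have "\<dots> = E (\<lambda>A. \<Sum>s'\<in>block b N i. of_bool (s' \<in> A i))"
    by (rule Bochner_Integration.integral_sum[symmetric]) (rule integrable_E)
  also have "\<dots> = E (\<lambda>A. real T)"
    using type1_choiceD[OF _ i] by (intro E_cong) (simp only: sum_of_bool_mem[OF finite_block])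
  finally show ?thesis using B by (simp add: field_simps)
qed

text \<open>The same averaging, over the second stub with \<open>s\<close> held fixed: if
  \<open>s\<close> is of type 1, then \<open>block b N j - {s}\<close> contains exactly
  \<open>T - of_bool (i = j)\<close> type 1 stubs. The indicator treats equal and distinct blocks at
  once.\<close>

lemma E_type1_type1:
  assumes i: "i < b" and j: "j < b" and s: "s \<in> block b N i" and t: "t \<in> block b N j" and st: "s \<noteq> t"
  shows "E (\<lambda>A. of_bool (s \<in> A i) * of_bool (t \<in> A j)) =
           real T / real B * (real T - of_bool (i = j)) / (real B - of_bool (i = j))"
proof -
  have const: "E (\<lambda>A. of_bool (s \<in> A i) * of_bool (t' \<in> A j)) =
      E (\<lambda>A. of_bool (s \<in> A i) * of_bool (t \<in> A j) :: real)" if "t' \<in> block b N j - {s}" for t'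
    by (subst E_swap[OF t, of t']) (use st that in \<open>auto simp: mem_transpose_image transpose_def\<close>)
  have s_in_j: "s \<in> block b N j \<longleftrightarrow> i = j"
    using s by (auto simp: block_def)
  have card: "real (card (block b N j - {s})) = real B - of_bool (i = j)"
    using s_in_j card_block[OF j] finite_block[of j] B by (cases "i = j") (simp_all add: card_Diff_singleton_if of_nat_diff)
  have "(real B - of_bool (i = j)) * E (\<lambda>A. of_bool (s \<in> A i) * of_bool (t \<in> A j)) =
      (\<Sum>t'\<in>block b N j - {s}. E (\<lambda>A. of_bool (s \<in> A i) * of_bool (t' \<in> A j)))"
    unfolding card[symmetric] using const by simp
  also have "\<dots> = E (\<lambda>A. \<Sum>t'\<in>block b N j - {s}. of_bool (s \<in> A i) * of_bool (t' \<in> A j))"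
    by (rule Bochner_Integration.integral_sum[symmetric]) (rule integrable_E)
  also have "\<dots> = E (\<lambda>A. of_bool (s \<in> A i) * (real T - of_bool (i = j)))"
  proof (rule E_cong)
    fix A assume A: "A \<in> set_pmf (type1_choice b q N)"
    have "(\<Sum>t'\<in>block b N j - {s}. of_bool (t' \<in> A j) :: real) = real (card (A j - {s}))"
      if "s \<in> A i"
    proof -
      have "(\<Sum>t'\<in>block b N j - {s}. of_bool (t' \<in> A j) :: real) =
          (\<Sum>t'\<in>block b N j - {s}. of_bool (t' \<in> A j - {s}))"
        by (intro sum.cong) auto
      also have "\<dots> = real (card (A j - {s}))"
        using type1_choiceD[OF A j] by (intro sum_of_bool_mem) (auto simp: finite_block)
      finally show ?thesis .
    qed
    moreover have "real (card (A j - {s})) = real T - of_bool (i = j)" if "s \<in> A i"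
    proof (cases "i = j")
      case True
      then have "card (A j) > 0" using that type1_choiceD[OF A j] by (auto simp: card_gt_0_iff)
      then show ?thesis using True that type1_choiceD[OF A j] by (simp add: of_nat_diff)
    next
      case False
      then have "s \<notin> A j" using s_in_j type1_choiceD[OF A j] by auto
      then show ?thesis using False type1_choiceD[OF A j] by simp
    qed
    ultimately show "(\<Sum>t'\<in>block b N j - {s}. of_bool (s \<in> A i) * of_bool (t' \<in> A j)) =
        of_bool (s \<in> A i) * (real T - of_bool (i = j))"
      unfolding sum_distrib_left[symmetric] by (cases "s \<in> A i") simp_all
  qed
  also have "\<dots> = real T / real B * (real T - of_bool (i = j))"
    using E_type1[OF i s] by simp
  finally have "(real B - of_bool (i = j)) * E (\<lambda>A. of_bool (s \<in> A i) * of_bool (t \<in> A j)) =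
      real T / real B * (real T - of_bool (i = j))" .
  moreover have "real B - of_bool (i = j) \<noteq> 0"
  proof -
    have "t \<in> block b N j - {s}" using t st by blast
    then have "card (block b N j - {s}) > 0" using finite_block[of j] by (auto simp: card_gt_0_iff)
    then show ?thesis unfolding card[symmetric] by linarith
  qed
  ultimately show ?thesis
    by (subst nonzero_eq_divide_eq) (simp_all only: mult.commute not_False_eq_True)
qed

text \<open>Inclusion-exclusion on the two preceding expectations. The denominator is nonzero
  because two distinct stubs of one block rule out \<open>B = 1\<close>.\<close>

lemma E_type2_type2:
  assumes i: "i < b" and j: "j < b" and s: "s \<in> block b N i" and t: "t \<in> block b N j" and st: "s \<noteq> t"
  shows "E (\<lambda>A. of_bool (s \<notin> A i) * of_bool (t \<notin> A j)) =
           (real B - real T) / real B * (real B - real T - of_bool (i = j)) / (real B - of_bool (i = j))"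
proof -
  have "real B - of_bool (i = j) \<noteq> 0"
  proof
    assume *: "real B - of_bool (i = j) = 0"
    then have "i = j" "B = 1" using B by (cases "i = j"; simp)+
    then have "card (block b N i) = 1" using card_block[OF i] by simp
    then show False using s t st \<open>i = j\<close> by (metis card_1_singletonE singletonD)
  qed
  moreover have "E (\<lambda>A. of_bool (s \<notin> A i) * of_bool (t \<notin> A j)) =
      E (\<lambda>A. 1 - of_bool (s \<in> A i) - of_bool (t \<in> A j) + of_bool (s \<in> A i) * of_bool (t \<in> A j) :: real)"
    by (intro E_cong) (simp add: of_bool_not_iff algebra_simps)
  moreover have "\<dots> = 1 - real T / real B - real T / real B +
      real T / real B * (real T - of_bool (i = j)) / (real B - of_bool (i = j))"
    using E_type1[OF i s] E_type1[OF j t] E_type1_type1[OF assms]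
    by (simp add: integrable_E)
  moreover have "1 - x / y - x / y + x / y * (x - e) / (y - e) = (y - x) / y * (y - x - e) / (y - e)"
    if "y \<noteq> 0" "y - e \<noteq> 0" for x y e :: real
    using that by (simp add: divide_simps) algebra
  ultimately show ?thesis using B by simp
qed

end

section \<open>Connection probabilities for a given choice of type 1 stubs, and their
  average\<close>

context block_model
begin

text \<open>Classes below \<open>b\<close> hold the type 1 stubs of the blocks, class
  \<open>b\<close> holds all type 2 stubs. Since \<open>h\<close> fixes everything outside
  \<open>{..<b}\<close>, both connection rules say that the class of the partner is \<open>h\<close>
  of the class of the stub.\<close>

definition stub_class :: "(nat \<Rightarrow> nat set) \<Rightarrow> nat \<Rightarrow> nat" where
  "stub_class A s = (if s \<in> A (block_of b N s) then block_of b N s else b)"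

lemma mem_block_iff: "s \<in> block b N i \<longleftrightarrow> s < N \<and> block_of b N s = i"
  by (simp add: block_def)

lemma mem_type1D:
  assumes "A \<in> set_pmf (type1_choice b q N)" "i < b" "s \<in> A i"
  shows "s < N" "block_of b N s = i"
  using type1_choiceD(1)[OF assms(1,2)] assms(3) by (auto simp: mem_block_iff)

lemma mem_Union_type1:
  assumes A: "A \<in> set_pmf (type1_choice b q N)" and s: "s < N"
  shows "s \<in> (\<Union>i<b. A i) \<longleftrightarrow> s \<in> A (block_of b N s)"
  using mem_type1D[OF A] block_of_less[OF s] by blast

lemma stub_class_eq_iff:
  assumes A: "A \<in> set_pmf (type1_choice b q N)" and s: "s < N"
  shows "i < b \<Longrightarrow> stub_class A s = i \<longleftrightarrow> s \<in> A i"
    and "stub_class A s = b \<longleftrightarrow> s \<notin> (\<Union>i<b. A i)"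
    and "stub_class A s \<le> b"
proof -
  show "stub_class A s = b \<longleftrightarrow> s \<notin> (\<Union>i<b. A i)" "stub_class A s \<le> b"
    unfolding mem_Union_type1[OF assms] stub_class_def using block_of_less[OF s] by simp_all
  assume i: "i < b"
  show "stub_class A s = i \<longleftrightarrow> s \<in> A i"
  proof
    assume "s \<in> A i"
    then show "stub_class A s = i"
      using mem_type1D(2)[OF A i] by (simp add: stub_class_def)
  next
    assume "stub_class A s = i"
    then show "s \<in> A i" using i by (simp add: stub_class_def split: if_splits)
  qed
qed

lemma partners_iff:
  assumes A: "A \<in> set_pmf (type1_choice b q N)" and s: "s < N" and t: "t < N"
  shows "t \<in> partners b h N A s \<longleftrightarrow> stub_class A t = h (stub_class A s)"
proof (cases "s \<in> A (block_of b N s)")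
  case True
  then show ?thesis
    using stub_class_eq_iff(1)[OF A t h_less[OF block_of_less[OF s]]]
    by (simp add: partners_def stub_class_def[of A s])
next
  case False
  then show ?thesis
    using stub_class_eq_iff(2)[OF A t] t
    by (simp add: partners_def stub_class_def[of A s] h_outside)
qed

lemma card_Union_type1:
  assumes A: "A \<in> set_pmf (type1_choice b q N)"
  shows "card (\<Union>i<b. A i) = b * T"
proof -
  have "A i \<inter> A j = {}" if "i < b" "j < b" "i \<noteq> j" for i j
    using mem_type1D[OF A] that by blast
  then show ?thesis
    using type1_choiceD[OF A] by (subst card_UN_disjoint) auto
qed

lemma card_type2:
  assumes A: "A \<in> set_pmf (type1_choice b q N)"
  shows "card ({..<N} - (\<Union>i<b. A i)) = N - b * T"
proof -
  have "finite (\<Union>i<b. A i)" using type1_choiceD[OF A] by blast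
  moreover have "(\<Union>i<b. A i) \<subseteq> {..<N}" using mem_type1D[OF A] by blast
  ultimately show ?thesis using card_Union_type1[OF A] by (simp add: card_Diff_subset)
qed

lemma balanced_stub_class:
  assumes A: "A \<in> set_pmf (type1_choice b q N)"
  shows "balanced (stub_class A) h {..<N}"
proof -
  have less: "{s\<in>{..<N}. stub_class A s = c} = A c" if "c < b" for c
    using stub_class_eq_iff(1)[OF A _ that] mem_type1D[OF A that] by blast
  have eq: "{s\<in>{..<N}. stub_class A s = b} = {..<N} - (\<Union>i<b. A i)"
    using stub_class_eq_iff(2)[OF A] by blast
  have greater: "{s\<in>{..<N}. stub_class A s = c} = {}" if "c > b" for c
    using stub_class_eq_iff(3)[OF A] that by fastforce
  show ?thesis
    unfolding balanced_def
  proof (intro allI conjI impI)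
    fix c
    show "card {s\<in>{..<N}. stub_class A s = c} = card {s\<in>{..<N}. stub_class A s = h c}"
    proof (cases "c < b")
      case True
      show ?thesis
        unfolding less[OF True] less[OF h_less[OF True]]
        using type1_choiceD(2)[OF A] True h_less by simp
    qed (simp add: h_outside)
  next
    fix c assume c: "h c = c"
    consider "c < b" | "c = b" | "c > b" by linarith
    then show "even (card {s\<in>{..<N}. stub_class A s = c})"
    proof cases
      case 1
      then show ?thesis unfolding less[OF 1] using type1_choiceD(2)[OF A] even_T c by simp
    next
      case 2
      show ?thesis unfolding 2 eq card_type2[OF A] using even_N even_bT by simp
    next
      case 3
      show ?thesis unfolding greater[OF 3] by simp
    qed
  qed
qed

lemma partners_never_stuck:
  assumes A: "A \<in> set_pmf (type1_choice b q N)"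
  shows "never_stuck (partners b h N A) (N div 2) {..<N}"
proof (rule balanced_never_stuck)
  show "balanced (stub_class A) h {..<N}" using balanced_stub_class[OF A] .
  show "card {..<N} = 2 * (N div 2)" using even_N by simp
  show "t \<in> partners b h N A s \<longleftrightarrow> stub_class A t = h (stub_class A s)"
    if "s \<in> {..<N}" "t \<in> {..<N}" for s t
    using partners_iff[OF A] that by simp
qed (simp_all add: h_involution)

text \<open>The partner of \<open>s\<close> is uniform on the partner class without
  \<open>s\<close>: the type 1 stubs of block \<open>h i\<close>, which include \<open>s\<close> if
  \<open>h i = i\<close>, or the type 2 stubs. Writing \<open>of_bool (i = j)\<close> in the first
  denominator is correct because that term vanishes unless \<open>j = h i\<close>.\<close>

lemma partner_prob_given_type1:
  assumes A: "A \<in> set_pmf (type1_choice b q N)"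
    and i: "i < b" and j: "j < b" and s: "s \<in> block b N i" and t: "t \<in> block b N j" and st: "s \<noteq> t"
  shows "measure_pmf.prob (connect (partners b h N A) (N div 2) {..<N}) {M. {s, t} \<in> M} =
     of_bool (j = h i) * (of_bool (s \<in> A i) * of_bool (t \<in> A j)) / (real T - of_bool (i = j)) +
     of_bool (s \<notin> A i) * of_bool (t \<notin> A j) / (real N - real b * real T - 1)"
proof -
  let ?C = "partners b h N A"
  have sN: "s < N" "block_of b N s = i" and tN: "t < N" "block_of b N t = j"
    using s t by (auto simp: mem_block_iff)
  have prob: "measure_pmf.prob (connect ?C (N div 2) {..<N}) {M. {s, t} \<in> M} =
      of_bool (t \<in> ?C s \<inter> {..<N} - {s}) / real (card (?C s \<inter> {..<N} - {s}))"
  proof (rule connect_partner_prob[OF _ partners_never_stuck[OF A] h_involution])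
    show "v \<in> ?C u \<longleftrightarrow> stub_class A v = h (stub_class A u)" if "u \<in> {..<N}" "v \<in> {..<N}" for u v
      using partners_iff[OF A] that by simp
  qed (use sN in simp_all)
  show ?thesis
  proof (cases "s \<in> A i")
    case True
    have hi: "h i < b" using h_less[OF i] .
    have "A (h i) \<subseteq> {..<N}" using mem_type1D(1)[OF A hi] by blast
    then have C: "?C s \<inter> {..<N} - {s} = A (h i) - {s}"
      using True sN(2) by (auto simp: partners_def)
    have mem: "t \<in> A (h i) - {s} \<longleftrightarrow> j = h i \<and> t \<in> A j"
    proof -
      have "h i = j" if "t \<in> A (h i)"
        using mem_type1D(2)[OF A hi that] tN(2) by simp
      then show ?thesis using st by (cases "h i = j") auto
    qed
    have card: "real (card (A (h i) - {s})) = real T - of_bool (i = h i)"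
    proof (cases "h i = i")
      case True
      have "s \<in> A (h i)" using True \<open>s \<in> A i\<close> by simp
      moreover from this have "card (A (h i)) > 0"
        using type1_choiceD(3)[OF A hi] by (auto simp: card_gt_0_iff)
      ultimately show ?thesis
        using type1_choiceD(2,3)[OF A i] True by (simp add: of_nat_diff)
    next
      case False
      then have "s \<notin> A (h i)" using mem_type1D(2)[OF A hi, of s] sN(2) by auto
      then show ?thesis using type1_choiceD(2)[OF A hi] False by simp
    qed
    show ?thesis
      unfolding prob C mem card using True by (cases "j = h i") simp_all
  next
    case False
    have C: "?C s \<inter> {..<N} - {s} = {..<N} - (\<Union>i<b. A i) - {s}"
      using False sN(2) by (auto simp: partners_def)
    have mem: "t \<in> {..<N} - (\<Union>i<b. A i) - {s} \<longleftrightarrow> t \<notin> A j"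
      using mem_Union_type1[OF A tN(1)] tN st by blast
    have s2: "s \<in> {..<N} - (\<Union>i<b. A i)"
      using mem_Union_type1[OF A sN(1)] sN False by blast
    then have "card ({..<N} - (\<Union>i<b. A i)) > 0" by (auto simp: card_gt_0_iff)
    then have "b * T < N" unfolding card_type2[OF A] by simp
    moreover have "card ({..<N} - (\<Union>i<b. A i) - {s}) = N - b * T - 1"
      using s2 unfolding card_type2[OF A, symmetric] by (rule card_Diff_singleton)
    ultimately have card: "real (card ({..<N} - (\<Union>i<b. A i) - {s})) = real N - real b * real T - 1"
      by (simp add: of_nat_diff)
    show ?thesis
      unfolding prob C mem card using False by simp
  qed
qed

text \<open>The mean of the preceding conditional probability over the choice of the type 1 stubs.
  The factor \<open>T - of_bool (i = j)\<close> of the joint expectation has cancelled against the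
  number of available partners.\<close>

definition partner_prob :: "nat \<Rightarrow> nat \<Rightarrow> real" where
  "partner_prob i j = (of_bool (j = h i) * (real T / real B) +
     (real B - real T) / real B * (real B - real T - of_bool (i = j)) / (real N - real b * real T - 1)) /
     (real B - of_bool (i = j))"

lemma random_matching_prob:
  assumes i: "i < b" and j: "j < b" and s: "s \<in> block b N i" and t: "t \<in> block b N j" and st: "s \<noteq> t"
  shows "measure_pmf.prob (type1_choice b q N \<bind> (\<lambda>A. connect (partners b h N A) (N div 2) {..<N}))
           {M. {s, t} \<in> M} = partner_prob i j"
proof -
  let ?e = "of_bool (i = j) :: real"
  have "measure_pmf.prob (type1_choice b q N \<bind> (\<lambda>A. connect (partners b h N A) (N div 2) {..<N}))
           {M. {s, t} \<in> M} =
     E (\<lambda>A. of_bool (j = h i) * (of_bool (s \<in> A i) * of_bool (t \<in> A j)) / (real T - ?e) +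
       of_bool (s \<notin> A i) * of_bool (t \<notin> A j) / (real N - real b * real T - 1))"
    unfolding prob_bind_pmf by (intro E_cong partner_prob_given_type1 assms)
  also have "\<dots> = of_bool (j = h i) * E (\<lambda>A. of_bool (s \<in> A i) * of_bool (t \<in> A j)) / (real T - ?e) +
       E (\<lambda>A. of_bool (s \<notin> A i) * of_bool (t \<notin> A j)) / (real N - real b * real T - 1)"
    by (simp add: integrable_E)
  \<comment> \<open>For \<open>j = h i\<close> and \<open>T > 0\<close> the cancelled factor
    \<open>T - of_bool (i = j)\<close> could vanish only if \<open>T = 1\<close> and
    \<open>i = j = h i\<close>, which the parity of \<open>T\<close> for a self-paired block
    excludes. In all other cases both sides are 0.\<close>
  also have "of_bool (j = h i) * E (\<lambda>A. of_bool (s \<in> A i) * of_bool (t \<in> A j)) / (real T - ?e) =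
      of_bool (j = h i) * (real T / real B) / (real B - ?e)"
  proof (cases "j = h i \<and> T \<noteq> 0")
    case True
    have "real T - ?e \<noteq> 0"
    proof
      assume e: "real T - ?e = 0"
      have "T \<noteq> 0" using True by blast
      then have ij: "i = j" using e by (metis (full_types) diff_zero of_bool_eq(1) of_nat_eq_0_iff)
      then have "T = 1" using e by simp
      moreover have "h i = i" using True ij by (metis (full_types))
      ultimately show False using even_T[OF i] by simp
    qed
    then show ?thesis unfolding E_type1_type1[OF assms] by simp
  next
    case False
    then have "of_bool (j = h i) = (0::real) \<or> T = 0" by (metis (full_types) of_bool_eq(1))
    then show ?thesis unfolding E_type1_type1[OF assms] by (elim disjE) (simp_all only: mult_zero_left div_0 of_nat_0)
  qed
  finally show ?thesis
    unfolding E_type2_type2[OF assms] partner_prob_def by (simp add: add_divide_distrib)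
qed

lemma random_matching_perfect:
  assumes "M \<in> set_pmf (type1_choice b q N \<bind> (\<lambda>A. connect (partners b h N A) (N div 2) {..<N}))"
  shows "perfect_matching {..<N} M"
proof -
  from assms obtain A where A: "A \<in> set_pmf (type1_choice b q N)"
    and "M \<in> set_pmf (connect (partners b h N A) (N div 2) {..<N})"
    by auto
  then show ?thesis
    by (intro connect_perfect_matching[OF _ partners_never_stuck[OF A]]) auto
qed

end

section \<open>Edge degrees for a given degree sequence\<close>

text \<open>The list of stub degrees depends on the sorted degrees alone, so that counting stubs and
  their monotonicity become statements about a list of numbers.\<close>

lemma concat_stub_degrees:
  "map k (stub_owners n k) = concat (map (\<lambda>x. replicate x x) (map k (sort_key k [0..<n])))"
  unfolding stub_owners_def map_concat by (simp add: comp_def)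

lemma sum_list_sort_key: "sum_list (map f (sort_key k [0..<n])) = (\<Sum>v<n. f v)" for f :: "nat \<Rightarrow> nat"
proof -
  have "sum_list (map f (sort_key k [0..<n])) = sum_mset (mset (map f (sort_key k [0..<n])))"
    by (simp only: sum_mset_sum_list)
  also have "\<dots> = sum_mset (mset (map f [0..<n]))" by simp
  also have "\<dots> = (\<Sum>v<n. f v)"
    by (simp only: sum_mset_sum_list) (simp add: sum_list_distinct_conv_sum_set lessThan_atLeast0)
  finally show ?thesis .
qed

lemma length_stub_owners: "length (stub_owners n k) = num_stubs n k"
  unfolding stub_owners_def num_stubs_def
  using sum_list_sort_key[of k k n] by (simp add: length_concat comp_def)

lemma stub_degree_conv: "s < num_stubs n k \<Longrightarrow> stub_degree n k s = map k (stub_owners n k) ! s"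
  unfolding stub_degree_def by (simp add: length_stub_owners)

lemma card_stubs:
  "card {s. s < num_stubs n k \<and> P (stub_degree n k s)} = (\<Sum>v<n. if P (k v) then k v else 0)"
proof -
  let ?ds = "map k (stub_owners n k)"
  have "{s. s < num_stubs n k \<and> P (stub_degree n k s)} = {s. s < length ?ds \<and> P (?ds ! s)}"
    using stub_degree_conv[of _ n k] by (auto simp: length_stub_owners)
  then have "card {s. s < num_stubs n k \<and> P (stub_degree n k s)} = length (filter P ?ds)"
    by (simp only: length_filter_conv_card)
  also have "\<dots> = sum_list (map (\<lambda>v. if P (k v) then k v else 0) (sort_key k [0..<n]))"
  proof -
    have "length (filter P (replicate m x)) = (if P x then m else 0)" for m x
      by (induction m) auto
    then show ?thesis
      unfolding concat_stub_degrees filter_concat length_concat map_map comp_def by simp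
  qed
  finally show ?thesis by (simp only: sum_list_sort_key)
qed

lemma stub_degree_mono:
  assumes "s \<le> t" "t < num_stubs n k"
  shows "stub_degree n k s \<le> stub_degree n k t"
proof -
  have "sorted (concat (map (\<lambda>x. replicate x x) xs))" if "sorted xs" for xs :: "nat list"
    using that by (induction xs) (auto simp: sorted_append sorted_replicate)
  from this[of "map k (sort_key k [0..<n])"] have "sorted (map k (stub_owners n k))"
    unfolding concat_stub_degrees by simp
  then show ?thesis
    using assms by (simp add: stub_degree_conv sorted_iff_nth_mono length_stub_owners del: nth_map)
qed

lemma stub_degree_pos:
  assumes "s < num_stubs n k"
  shows "\<exists>v<n. stub_degree n k s = k v \<and> 0 < k v"
proof -
  have "stub_degree n k s \<in> set (map k (stub_owners n k))"
    unfolding stub_degree_conv[OF assms] using assms by (intro nth_mem) (simp add: length_stub_owners)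
  then show ?thesis unfolding concat_stub_degrees by auto
qed

text \<open>
  A stub with degree in \<open>H i\<close> is preceded by all \<open>i * B\<close> stubs with degree in an earlier set, and
  only by those and other stubs with degree in \<open>H i\<close>.
\<close>

lemma block_of_stub_degree:
  assumes B: "0 < B" and N: "num_stubs n k = b * B"
    and supp: "\<And>v. v < n \<Longrightarrow> k v \<in> set_pmf p"
    and sorted: "blocks_sorted p b H" and disj: "disjoint_family_on H {..<b}" and cover: "(\<Union>i<b. H i) = UNIV"
    and blocks: "\<And>i. i < b \<Longrightarrow> (\<Sum>v<n. if k v \<in> H i then k v else 0) = B"
    and s: "s < num_stubs n k" and i: "i < b" and sH: "stub_degree n k s \<in> H i"
  shows "block_of b (num_stubs n k) s = i"
proof -
  define D where "D j = {s. s < num_stubs n k \<and> stub_degree n k s \<in> H j}" for j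
  have card_D: "card (D j) = B" if "j < b" for j
    unfolding D_def card_stubs[where P = "\<lambda>x. x \<in> H j"] using blocks[OF that] .
  have fin: "finite (D j)" for j unfolding D_def by simp
  have order: "u < v" if "j < l" "j < b" "l < b" "u \<in> D j" "v \<in> D l" for j l u v
  proof (rule ccontr)
    assume "\<not> u < v"
    then have "stub_degree n k v \<le> stub_degree n k u"
      using that by (intro stub_degree_mono) (auto simp: D_def)
    moreover have "stub_degree n k u < stub_degree n k v"
    proof -
      \<comment> \<open>\<open>blocks_sorted\<close> constrains only positive degrees of positive
        probability; the degree of a stub is always of this kind.\<close>
      have "stub_degree n k w \<in> set_pmf p \<and> 0 < stub_degree n k w" if "w < num_stubs n k" for w
        using stub_degree_pos[OF that] supp by auto
      then have "stub_degree n k u \<in> H j \<inter> set_pmf p" "0 < stub_degree n k u"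
        "stub_degree n k v \<in> H l \<inter> set_pmf p" "0 < stub_degree n k v"
        using that unfolding D_def by blast+
      then show ?thesis
        using sorted that unfolding blocks_sorted_def by blast
    qed
    ultimately show False by simp
  qed
  have card_Un: "card (\<Union>j<m. D j) = m * B" if "m \<le> b" for m
  proof -
    have "card (\<Union>j<m. D j) = (\<Sum>j<m. card (D j))"
      using disj that fin
      by (intro card_UN_disjoint) (auto simp: D_def disjoint_family_on_def, fastforce)
    also have "\<dots> = m * B" using card_D that by simp
    finally show ?thesis .
  qed
  have sD: "s \<in> D i" using s sH by (simp add: D_def)
  have "(\<Union>j<i. D j) \<subseteq> {..<s}"
  proof
    fix u assume "u \<in> (\<Union>j<i. D j)"
    then obtain j where j: "j < i" "u \<in> D j" by blast
    have "j < b" using j(1) i by simp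
    then show "u \<in> {..<s}" using order[OF j(1) _ i j(2) sD] by simp
  qed
  then have "card (\<Union>j<i. D j) \<le> card {..<s}" by (intro card_mono) auto
  then have lower: "i * B \<le> s" using card_Un[of i] i by simp
  have "t \<in> (\<Union>j<Suc i. D j)" if "t \<le> s" for t
  proof -
    have "t < num_stubs n k" using that s by simp
    moreover obtain j where j: "j < b" "stub_degree n k t \<in> H j" using cover by blast
    ultimately have t: "t \<in> D j" by (simp add: D_def)
    then have "\<not> i < j" using order[of i j s t] i j sD that by auto
    then show ?thesis using t by auto
  qed
  then have "{..<Suc s} \<subseteq> (\<Union>j<Suc i. D j)" by auto
  then have "card {..<Suc s} \<le> card (\<Union>j<Suc i. D j)" using fin by (intro card_mono) auto
  then have upper: "s < Suc i * B" using card_Un[of "Suc i"] i by simp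
  have "num_stubs n k div b = B" using N i by simp
  then show ?thesis unfolding block_of_def using lower upper by (simp add: div_nat_eqI mult.commute)
qed

section \<open>From stub matchings to the degrees at the ends of a random edge\<close>

lemma card_perfect_matching:
  assumes "finite U" "perfect_matching U M"
  shows "finite M" "card U = 2 * card M"
proof -
  have "M \<subseteq> Pow U" using assms(2) by (auto simp: perfect_matching_def)
  then show "finite M" using assms(1) finite_subset by blast
  have "card (\<Union>M) = (\<Sum>e\<in>M. card e)"
    using assms(2) by (intro card_Union_disjoint) (auto simp: perfect_matching_def card_ge_0_finite)
  then show "card U = 2 * card M" using assms(2) by (simp add: perfect_matching_def)
qed

text \<open>The last draws of \<open>edge_degrees\<close>, with the two stubs returned instead of
  their degrees. For a perfect matching this is the uniform law on its oriented edges, of which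
  there are as many as stubs.\<close>

definition oriented_edge :: "nat set set \<Rightarrow> (nat \<times> nat) pmf" where
  "oriented_edge M = do {
     e \<leftarrow> pmf_of_set M;
     s \<leftarrow> pmf_of_set e;
     t \<leftarrow> pmf_of_set (e - {s});
     return_pmf (s, t)
   }"

lemma pmf_oriented_edge:
  assumes M: "perfect_matching U M" and U: "finite U" "U \<noteq> {}"
  shows "pmf (oriented_edge M) (s, t) = of_bool ({s, t} \<in> M) / real (card U)"
proof -
  have fin: "finite M" and card: "card U = 2 * card M"
    using card_perfect_matching[OF U(1) M] .
  have ne: "M \<noteq> {}" using M U(2) by (auto simp: perfect_matching_def)
  have e: "pmf (pmf_of_set e \<bind> (\<lambda>s. pmf_of_set (e - {s}) \<bind> (\<lambda>t. return_pmf (s, t)))) (s, t) =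
      of_bool (e = {s, t}) / 2" if "e \<in> M" for e
  proof -
    have "card e = 2" using M that by (simp add: perfect_matching_def)
    then obtain a c where ac: "e = {a, c}" "a \<noteq> c" by (auto simp: card_2_iff)
    have diff: "{a, c} - {a} = {c}" "{a, c} - {c} = {a}" using ac by auto
    have "pmf (pmf_of_set e \<bind> (\<lambda>s. pmf_of_set (e - {s}) \<bind> (\<lambda>t. return_pmf (s, t)))) (s, t) =
        (\<Sum>s'\<in>{a, c}. pmf (pmf_of_set ({a, c} - {s'}) \<bind> (\<lambda>t. return_pmf (s', t))) (s, t)) / 2"
      unfolding ac(1) using ac(2) by (subst pmf_bind_pmf_of_set) simp_all
    also have "\<dots> = (of_bool (a = s \<and> c = t) + of_bool (c = s \<and> a = t)) / 2"
      using ac(2) diff by (simp add: pmf_of_set_singleton bind_return_pmf indicator_def)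
    also have "\<dots> = of_bool (e = {s, t}) / 2"
      using ac by (auto simp: doubleton_eq_iff)
    finally show ?thesis .
  qed
  have "pmf (oriented_edge M) (s, t) = (\<Sum>e\<in>M. of_bool (e = {s, t}) / 2) / real (card M)"
    unfolding oriented_edge_def
    by (subst pmf_bind_pmf_of_set[OF ne fin], rule arg_cong[where f = "\<lambda>x. x / real (card M)"])
      (rule sum.cong[OF refl e])
  also have "(\<Sum>e\<in>M. of_bool (e = {s, t}) / 2 :: real) = of_bool ({s, t} \<in> M) / 2"
    unfolding sum_divide_distrib[symmetric] using fin by (subst sum_of_bool_eq) auto
  finally show ?thesis unfolding card by simp
qed

text \<open>Every perfect matching of the \<open>N\<close> stubs has \<open>N / 2\<close> edges, so
  the normalisation of the edge choice does not depend on the matching, and the expectation can be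
  taken pair by pair.\<close>

lemma edge_law_perfect_matchings:
  fixes d :: "nat \<Rightarrow> 'b"
  assumes N: "0 < N" and M: "\<And>M. M \<in> set_pmf D \<Longrightarrow> perfect_matching {..<N} M"
  shows "pmf (D \<bind> (\<lambda>M. map_pmf (\<lambda>(s, t). (d s, d t)) (oriented_edge M))) (x, y) =
    (\<Sum>(s, t)\<in>{(s, t). s < N \<and> t < N \<and> s \<noteq> t \<and> d s = x \<and> d t = y}.
        measure_pmf.prob D {M. {s, t} \<in> M}) / real N"
proof -
  let ?S = "{(s, t). s < N \<and> t < N \<and> s \<noteq> t \<and> d s = x \<and> d t = y}"
  have finS: "finite ?S" by (rule finite_subset[of _ "{..<N} \<times> {..<N}"]) auto
  have *: "pmf (map_pmf (\<lambda>(s, t). (d s, d t)) (oriented_edge M)) (x, y) =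
      (\<Sum>(s, t)\<in>?S. of_bool ({s, t} \<in> M) / real N)" if "M \<in> set_pmf D" for M
  proof -
    have pm: "perfect_matching {..<N} M" using M that .
    have pmf: "pmf (oriented_edge M) (s, t) = of_bool ({s, t} \<in> M) / real N" for s t
      using pmf_oriented_edge[OF pm, of s t] N by (simp add: lessThan_empty_iff)
    have edge: "s < N" "t < N" "s \<noteq> t" if "(s, t) \<in> set_pmf (oriented_edge M)" for s t
    proof -
      have "{s, t} \<in> M" using that unfolding set_pmf_iff pmf by (auto split: if_splits)
      then show "s < N" "t < N" "s \<noteq> t" using perfect_matching_no_loop[OF pm] by auto
    qed
    have "pmf (map_pmf (\<lambda>(s, t). (d s, d t)) (oriented_edge M)) (x, y) =
        measure_pmf.prob (oriented_edge M) ((\<lambda>(s, t). (d s, d t)) -` {(x, y)})"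
      by (rule pmf_map)
    also have "\<dots> = measure_pmf.prob (oriented_edge M) ?S"
    proof (intro measure_pmf.finite_measure_eq_AE)
      show "AE z in measure_pmf (oriented_edge M). (z \<in> (\<lambda>(s, t). (d s, d t)) -` {(x, y)}) = (z \<in> ?S)"
        using edge by (fastforce simp: AE_measure_pmf_iff)
    qed simp_all
    also have "\<dots> = (\<Sum>(s, t)\<in>?S. of_bool ({s, t} \<in> M) / real N)"
      unfolding measure_measure_pmf_finite[OF finS] by (rule sum.cong[OF refl]) (simp only: pmf split_paired_all case_prod_conv)
    finally show ?thesis .
  qed
  have prob: "measure_pmf.expectation D (\<lambda>M. of_bool ({s, t} \<in> M)) = measure_pmf.prob D {M. {s, t} \<in> M}"
    for s t
  proof -
    have "(\<lambda>M. of_bool ({s, t} \<in> M) :: real) = indicator {M. {s, t} \<in> M}"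
      by (auto simp: indicator_def)
    then show ?thesis by simp
  qed
  have int: "integrable (measure_pmf D) (\<lambda>M. of_bool ({s, t} \<in> M) :: real)" for s t
    by (intro measure_pmf.integrable_const_bound[where B = 1]) auto
  have "pmf (D \<bind> (\<lambda>M. map_pmf (\<lambda>(s, t). (d s, d t)) (oriented_edge M))) (x, y) =
      measure_pmf.expectation D (\<lambda>M. \<Sum>(s, t)\<in>?S. of_bool ({s, t} \<in> M) / real N)"
    unfolding pmf_bind using * by (intro integral_cong_AE) (auto simp: AE_measure_pmf_iff)
  also have "\<dots> = (\<Sum>(s, t)\<in>?S. measure_pmf.prob D {M. {s, t} \<in> M} / real N)"
    by (simp add: case_prod_unfold int prob)
  finally show ?thesis by (simp add: sum_divide_distrib case_prod_unfold)
qed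

lemma card_off_diagonal_pairs:
  fixes d :: "nat \<Rightarrow> 'b"
  shows "real (card {(s, t). s < N \<and> t < N \<and> s \<noteq> t \<and> d s = x \<and> d t = y}) =
    real (card {s. s < N \<and> d s = x}) * (real (card {t. t < N \<and> d t = y}) - of_bool (x = y))"
proof -
  let ?X = "\<lambda>x. {s. s < N \<and> d s = x}"
  have "{(s, t). s < N \<and> t < N \<and> s \<noteq> t \<and> d s = x \<and> d t = y} = Sigma (?X x) (\<lambda>s. ?X y - {s})"
    by auto
  then have "real (card {(s, t). s < N \<and> t < N \<and> s \<noteq> t \<and> d s = x \<and> d t = y}) =
      (\<Sum>s\<in>?X x. real (card (?X y - {s})))"
    by (simp add: card_SigmaI)
  also have "\<dots> = (\<Sum>s\<in>?X x. real (card (?X y)) - of_bool (x = y))"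
  proof (rule sum.cong[OF refl])
    fix s assume s: "s \<in> ?X x"
    show "real (card (?X y - {s})) = real (card (?X y)) - of_bool (x = y)"
    proof (cases "x = y")
      case True
      then have "s \<in> ?X y" using s by blast
      moreover from this have "card (?X y) > 0" by (auto simp: card_gt_0_iff)
      ultimately show ?thesis using True by (simp add: card_Diff_singleton of_nat_diff)
    next
      case False
      then have "s \<notin> ?X y" using s by blast
      then have "?X y - {s} = ?X y" by blast
      then show ?thesis using False by simp
    qed
  qed
  finally show ?thesis by simp
qed

text \<open>A stub with degree in \<open>H i\<close> lies in block \<open>i\<close>, so all pairs of
  distinct stubs with degrees \<open>x\<close> and \<open>y\<close> have the same connection
  probability, and it remains to count them. Each vertex of degree \<open>z\<close> contributes
  \<open>z\<close> stubs.\<close>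

lemma (in block_model) edge_law_given_degrees:
  assumes N_eq: "num_stubs n k = N"
    and supp: "\<And>v. v < n \<Longrightarrow> k v \<in> set_pmf p"
    and sorted: "blocks_sorted p b H" and disj: "disjoint_family_on H {..<b}" and cover: "(\<Union>i<b. H i) = UNIV"
    and blocks: "\<And>i. i < b \<Longrightarrow> (\<Sum>v<n. if k v \<in> H i then k v else 0) = B"
    and i: "i < b" and j: "j < b" and x: "x \<in> H i" and y: "y \<in> H j"
  shows "pmf (random_graph b q h n k \<bind>
        (\<lambda>M. map_pmf (\<lambda>(s, t). (stub_degree n k s, stub_degree n k t)) (oriented_edge M))) (x, y) =
     (real x * real (card {v. v < n \<and> k v = x})) *
     (real y * real (card {v. v < n \<and> k v = y}) - of_bool (x = y)) * partner_prob i j / real N"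
proof -
  let ?d = "stub_degree n k"
  let ?S = "{(s, t). s < N \<and> t < N \<and> s \<noteq> t \<and> ?d s = x \<and> ?d t = y}"
  have graph: "random_graph b q h n k =
      type1_choice b q N \<bind> (\<lambda>A. connect (partners b h N A) (N div 2) {..<N})"
    by (simp add: random_graph_def N_eq)
  have Npos: "0 < N" using N b B by simp
  have block: "s \<in> block b N l" if "s < N" "?d s \<in> H l" "l < b" for s l
    unfolding mem_block_iff using that N
    by (intro conjI block_of_stub_degree[OF B _ supp sorted disj cover blocks, unfolded N_eq]) simp_all
  have prob: "measure_pmf.prob (random_graph b q h n k) {M. {s, t} \<in> M} = partner_prob i j"
    if "(s, t) \<in> ?S" for s t
    unfolding graph using that x y i j by (intro random_matching_prob block) auto
  have card: "card {s. s < N \<and> ?d s = z} = z * card {v. v < n \<and> k v = z}" for z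
  proof -
    have "card {s. s < N \<and> ?d s = z} = (\<Sum>v<n. if k v = z then k v else 0)"
      using card_stubs[of n k "\<lambda>u. u = z"] by (simp add: N_eq)
    also have "\<dots> = (\<Sum>v | v < n \<and> k v = z. z)"
      by (intro sum.mono_neutral_cong_right) auto
    finally show ?thesis by simp
  qed
  have "pmf (random_graph b q h n k \<bind> (\<lambda>M. map_pmf (\<lambda>(s, t). (?d s, ?d t)) (oriented_edge M))) (x, y) =
      (\<Sum>(s, t)\<in>?S. measure_pmf.prob (random_graph b q h n k) {M. {s, t} \<in> M}) / real N"
    by (rule edge_law_perfect_matchings[OF Npos]) (use random_matching_perfect graph in simp)
  also have "(\<Sum>(s, t)\<in>?S. measure_pmf.prob (random_graph b q h n k) {M. {s, t} \<in> M}) =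
      (\<Sum>z\<in>?S. partner_prob i j)"
    using prob by (intro sum.cong) auto
  also have "\<dots> = real (card ?S) * partner_prob i j" by simp
  also have "real (card ?S) = (real x * real (card {v. v < n \<and> k v = x})) *
     (real y * real (card {v. v < n \<and> k v = y}) - of_bool (x = y))"
    unfolding card_off_diagonal_pairs card by simp
  finally show ?thesis .
qed

section \<open>Lower bound for the probability of even placement\<close>

lemma has_sum_pmf: "(pmf p has_sum measure_pmf.prob p A) A"
proof -
  have "(\<lambda>x. norm (pmf p x)) summable_on A"
    using pmf_abs_summable[of p A] by (simp add: abs_summable_equivalent[symmetric])
  then have "pmf p summable_on A" by (rule abs_summable_summable)
  moreover have "infsum (pmf p) A = measure_pmf.prob p A"
    using pmf_abs_summable[of p A] by (simp add: measure_pmf_conv_infsetsum infsetsum_infsum)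
  ultimately show ?thesis using has_sum_infsum by metis
qed

text \<open>
  The tail that is cut off is replaced by a small correction of the weights of two fixed points,
  which suffices to restore both the mass and the first moment.
\<close>

lemma finite_support_same_moments:
  fixes w :: "nat \<Rightarrow> real"
  assumes a: "(w has_sum a) S" and m: "((\<lambda>x. real x * w x) has_sum m) S"
    and pos: "\<And>x. x \<in> S \<Longrightarrow> 0 < w x" and \<epsilon>: "0 < \<epsilon>"
  obtains F w' where "finite F" "F \<subseteq> S" "\<And>x. x \<in> F \<Longrightarrow> 0 < w' x" "\<And>x. x \<in> F \<Longrightarrow> w' x \<le> (1 + \<epsilon>) * w x"
    "(\<Sum>x\<in>F. w' x) = a" "(\<Sum>x\<in>F. real x * w' x) = m"
proof (cases "\<exists>x1\<in>S. \<exists>x2\<in>S. x1 \<noteq> x2")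
  case False
  then have "finite S" by (metis finite.simps finite_subset insertI1 subsetI)
  moreover have "sum w S = a" "(\<Sum>x\<in>S. real x * w x) = m"
    using has_sum_unique[OF has_sum_finite[OF \<open>finite S\<close>]] a m by blast+
  ultimately show thesis
    using that[of S w] pos \<epsilon> by (simp add: distrib_right less_imp_le)
next
  case True
  then obtain x1 x2 where x: "x1 \<in> S" "x2 \<in> S" "x1 \<noteq> x2" by blast
  let ?F = "finite_subsets_at_top S"
  \<comment> \<open>\<open>\<alpha>1 F\<close> and \<open>\<alpha>2 F\<close> solve the two linear
    equations by which corrections at \<open>x1\<close> and \<open>x2\<close> restore the missing
    mass and the missing first moment. The system is regular as \<open>x1 \<noteq> x2\<close>, and
    its solution tends to 0 as \<open>F\<close> exhausts \<open>S\<close>.\<close>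
  define \<alpha>2 where "\<alpha>2 F = ((m - (\<Sum>x\<in>F. real x * w x)) - real x1 * (a - sum w F)) / (real x2 - real x1)" for F
  define \<alpha>1 where "\<alpha>1 F = (a - sum w F) - \<alpha>2 F" for F
  \<comment> \<open>A correction below \<open>\<eta>\<close> is less than half of each of the two
    weights, so these stay positive, and less than \<open>\<epsilon>\<close> times each, as the
    upper bound demands.\<close>
  define \<eta> where "\<eta> = min 1 \<epsilon> * min (w x1) (w x2) / 2"
  have \<eta>: "0 < \<eta>" using \<epsilon> pos x by (simp add: \<eta>_def)
  have t0: "((\<lambda>F. a - sum w F) \<longlongrightarrow> 0) ?F"
    using tendsto_diff[OF tendsto_const[of a ?F] a[unfolded has_sum_def]] by simp
  have t1: "((\<lambda>F. m - (\<Sum>x\<in>F. real x * w x)) \<longlongrightarrow> 0) ?F"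
    using tendsto_diff[OF tendsto_const[of m ?F] m[unfolded has_sum_def]] by simp
  have "(\<alpha>2 \<longlongrightarrow> (0 - real x1 * 0) / (real x2 - real x1)) ?F"
    unfolding \<alpha>2_def[abs_def] using x(3) by (intro tendsto_intros t0 t1) simp
  then have \<alpha>2: "(\<alpha>2 \<longlongrightarrow> 0) ?F" by simp
  then have \<alpha>1: "(\<alpha>1 \<longlongrightarrow> 0) ?F"
    unfolding \<alpha>1_def[abs_def] using tendsto_diff[OF t0 \<alpha>2] by simp
  have "eventually (\<lambda>F. \<bar>\<alpha>1 F\<bar> < \<eta>) ?F" "eventually (\<lambda>F. \<bar>\<alpha>2 F\<bar> < \<eta>) ?F"
    using tendstoD[OF \<alpha>1 \<eta>] tendstoD[OF \<alpha>2 \<eta>] by (simp_all add: dist_real_def)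
  moreover have "eventually (\<lambda>F. finite F \<and> {x1, x2} \<subseteq> F \<and> F \<subseteq> S) ?F"
    using x by (auto simp: eventually_finite_subsets_at_top intro!: exI[of _ "{x1, x2}"])
  ultimately have "eventually (\<lambda>F. \<bar>\<alpha>1 F\<bar> < \<eta> \<and> \<bar>\<alpha>2 F\<bar> < \<eta> \<and> finite F \<and> {x1, x2} \<subseteq> F \<and> F \<subseteq> S) ?F"
    by eventually_elim simp
  then obtain F where F: "\<bar>\<alpha>1 F\<bar> < \<eta>" "\<bar>\<alpha>2 F\<bar> < \<eta>" "finite F" "x1 \<in> F" "x2 \<in> F" "F \<subseteq> S"
    using eventually_happens'[OF finite_subsets_at_top_neq_bot] by blast
  define w' where "w' x = w x + (if x = x1 then \<alpha>1 F else 0) + (if x = x2 then \<alpha>2 F else 0)" for x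
  have eta_le: "\<eta> \<le> w x / 2" "\<eta> \<le> \<epsilon> * w x" if "x = x1 \<or> x = x2" for x
  proof -
    have "0 < w x" using that pos x by auto
    have "min 1 \<epsilon> * min (w x1) (w x2) \<le> 1 * w x" "min 1 \<epsilon> * min (w x1) (w x2) \<le> \<epsilon> * w x"
      using that \<epsilon> pos[OF x(1)] pos[OF x(2)] by (intro mult_mono; auto)+
    moreover have "0 < \<epsilon> * w x" using \<open>0 < w x\<close> \<epsilon> by simp
    ultimately show "\<eta> \<le> w x / 2" "\<eta> \<le> \<epsilon> * w x"
      unfolding \<eta>_def by linarith+
  qed
  have pos': "0 < w' x" if "x \<in> F" for x
    using pos[of x] that F eta_le[of x] \<eta> x(3) by (auto simp: w'_def)
  have le': "w' x \<le> (1 + \<epsilon>) * w x" if "x \<in> F" for x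
  proof -
    have "0 < \<epsilon> * w x" using pos[of x] that F \<epsilon> by auto
    then show ?thesis
      using F(1,2) eta_le[of x] \<eta> x(3) by (auto simp: w'_def algebra_simps)
  qed
  have sum': "(\<Sum>x\<in>F. f x * w' x) = (\<Sum>x\<in>F. f x * w x) + f x1 * \<alpha>1 F + f x2 * \<alpha>2 F" for f
  proof -
    have "(\<Sum>x\<in>F. f x * w' x) = (\<Sum>x\<in>F. f x * w x + (if x = x1 then f x1 * \<alpha>1 F else 0) +
        (if x = x2 then f x2 * \<alpha>2 F else 0))"
      unfolding w'_def by (intro sum.cong) (auto simp: algebra_simps)
    then show ?thesis using F(3-5) by (simp add: sum.distrib)
  qed
  have "(\<Sum>x\<in>F. w' x) = a"
    using sum'[of "\<lambda>_. 1"] by (simp add: \<alpha>1_def)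
  moreover have "(\<Sum>x\<in>F. real x * w' x) = m"
  proof -
    have "(real x2 - real x1) * \<alpha>2 F = (m - (\<Sum>x\<in>F. real x * w x)) - real x1 * (a - sum w F)"
      using x(3) by (simp add: \<alpha>2_def)
    moreover have "real x1 * \<alpha>1 F + real x2 * \<alpha>2 F = real x1 * (a - sum w F) + (real x2 - real x1) * \<alpha>2 F"
      by (simp add: \<alpha>1_def algebra_simps)
    ultimately show ?thesis using sum'[of real] by simp
  qed
  ultimately show thesis using that[of F w'] F pos' le' by blast
qed

text \<open>Truncating inside each block separately preserves every block mean exactly. Each block
  also keeps its mass \<open>measure_pmf.prob p (H i)\<close>, and these masses add up to 1 because
  the blocks partition the naturals.\<close>

lemma finite_support_same_block_moments:
  fixes p :: "nat pmf" and b :: nat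
  assumes \<epsilon>: "0 < \<epsilon>" and disj: "disjoint_family_on H {..<b}" and cover: "(\<Union>i<b. H i) = UNIV"
    and mean: "\<And>i. i < b \<Longrightarrow> ((\<lambda>x. real x * pmf p x) has_sum m) (H i)"
  obtains F w where "finite F" "F \<subseteq> set_pmf p" "\<And>x. x \<in> F \<Longrightarrow> 0 < w x"
    "\<And>x. x \<in> F \<Longrightarrow> w x \<le> (1 + \<epsilon>) * pmf p x"
    "(\<Sum>x\<in>F. w x) = 1" "\<And>i. i < b \<Longrightarrow> (\<Sum>x\<in>F \<inter> H i. real x * w x) = m"
proof -
  let ?a = "\<lambda>i. measure_pmf.prob p (H i)"
  have "\<exists>F w. finite F \<and> F \<subseteq> H i \<inter> set_pmf p \<and> (\<forall>x\<in>F. 0 < w x \<and> w x \<le> (1 + \<epsilon>) * pmf p x) \<and>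
      sum w F = ?a i \<and> (\<Sum>x\<in>F. real x * w x) = m" if i: "i < b" for i
  proof -
    have "(pmf p has_sum ?a i) (H i \<inter> set_pmf p)"
      using has_sum_pmf[of p "H i"] by (rule has_sum_cong_neutral[THEN iffD1, rotated -1]) (auto simp: set_pmf_iff)
    moreover have "((\<lambda>x. real x * pmf p x) has_sum m) (H i \<inter> set_pmf p)"
      using mean[OF i] by (rule has_sum_cong_neutral[THEN iffD1, rotated -1]) (auto simp: set_pmf_iff)
    moreover have "0 < pmf p x" if "x \<in> H i \<inter> set_pmf p" for x
      using that by (simp add: pmf_positive)
    ultimately obtain F w where "finite F" "F \<subseteq> H i \<inter> set_pmf p" "\<And>x. x \<in> F \<Longrightarrow> 0 < w x"
      "\<And>x. x \<in> F \<Longrightarrow> w x \<le> (1 + \<epsilon>) * pmf p x" "sum w F = ?a i" "(\<Sum>x\<in>F. real x * w x) = m"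
      using \<epsilon> by (rule finite_support_same_moments) blast+
    then show ?thesis by blast
  qed
  then have "\<forall>i. \<exists>F w. i < b \<longrightarrow> finite F \<and> F \<subseteq> H i \<inter> set_pmf p \<and>
      (\<forall>x\<in>F. 0 < w x \<and> w x \<le> (1 + \<epsilon>) * pmf p x) \<and> sum w F = ?a i \<and> (\<Sum>x\<in>F. real x * w x) = m"
    by blast
  then obtain F' w' where "\<forall>i. i < b \<longrightarrow> finite (F' i) \<and> F' i \<subseteq> H i \<inter> set_pmf p \<and>
      (\<forall>x\<in>F' i. 0 < w' i x \<and> w' i x \<le> (1 + \<epsilon>) * pmf p x) \<and> sum (w' i) (F' i) = ?a i \<and>
      (\<Sum>x\<in>F' i. real x * w' i x) = m"
    unfolding choice_iff by blast
  then have F': "\<And>i. i < b \<Longrightarrow> finite (F' i)" "\<And>i. i < b \<Longrightarrow> F' i \<subseteq> H i \<inter> set_pmf p"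
    "\<And>i x. i < b \<Longrightarrow> x \<in> F' i \<Longrightarrow> 0 < w' i x" "\<And>i x. i < b \<Longrightarrow> x \<in> F' i \<Longrightarrow> w' i x \<le> (1 + \<epsilon>) * pmf p x"
    "\<And>i. i < b \<Longrightarrow> sum (w' i) (F' i) = ?a i" "\<And>i. i < b \<Longrightarrow> (\<Sum>x\<in>F' i. real x * w' i x) = m"
    by blast+
  define F where "F = (\<Union>i<b. F' i)"
  define w where "w x = w' (THE i. i < b \<and> x \<in> H i) x" for x
  have the: "(THE i. i < b \<and> x \<in> H i) = i" if "i < b" "x \<in> H i" for i x
    using that disj by (intro the_equality) (auto simp: disjoint_family_on_def)
  have w: "w x = w' i x" if "i < b" "x \<in> F' i" for i x
    using the[of i x] that F'(2)[of i] by (auto simp: w_def)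
  have FH: "F \<inter> H i = F' i" if i: "i < b" for i
  proof
    show "F \<inter> H i \<subseteq> F' i"
    proof
      fix x assume x: "x \<in> F \<inter> H i"
      then obtain j where j: "j < b" "x \<in> F' j" by (auto simp: F_def)
      then have "x \<in> H j" using F'(2) by blast
      then have "j = i" using x j(1) i the[of i x] the[of j x] by simp
      then show "x \<in> F' i" using j(2) by simp
    qed
  qed (use F'(2)[OF i] i in \<open>auto simp: F_def\<close>)
  have "(\<Sum>x\<in>F. w x) = (\<Sum>i<b. \<Sum>x\<in>F' i. w x)"
    unfolding F_def
  proof (intro sum.UNION_disjoint ballI impI)
    fix i j assume "i \<in> {..<b}" "j \<in> {..<b}" "i \<noteq> j"
    then have "H i \<inter> H j = {}" using disj by (auto simp: disjoint_family_on_def)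
    then show "F' i \<inter> F' j = {}" using F'(2) \<open>i \<in> {..<b}\<close> \<open>j \<in> {..<b}\<close> by blast
  qed (use F' in auto)
  also have "\<dots> = (\<Sum>i<b. ?a i)"
    using F'(5) w by (intro sum.cong) (auto cong: sum.cong)
  also have "\<dots> = measure_pmf.prob p (\<Union>i<b. H i)"
    using disj by (intro measure_pmf.finite_measure_finite_Union[symmetric]) auto
  also have "\<dots> = 1" by (simp add: cover)
  finally have "(\<Sum>x\<in>F. w x) = 1" .
  moreover have "(\<Sum>x\<in>F \<inter> H i. real x * w x) = m" if "i < b" for i
    unfolding FH[OF that] using F'(6)[OF that] w[OF that] by (simp cong: sum.cong)
  moreover have "finite F" "F \<subseteq> set_pmf p" using F'(1,2) by (auto simp: F_def)
  moreover have "0 < w x" "w x \<le> (1 + \<epsilon>) * pmf p x" if "x \<in> F" for x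
    using that F'(3,4) w by (auto simp: F_def)
  ultimately show thesis using that[of F w] by blast
qed

text \<open>
  By Dirichlet's theorem all \<open>Q * w x\<close> can be made so close to integers that the linear
  relations, which are rational, hold exactly for these integers.
\<close>

lemma integral_weights_same_block_moments:
  fixes w :: "nat \<Rightarrow> real" and b n1 B1 :: nat
  assumes fin: "finite F" and pos: "\<And>x. x \<in> F \<Longrightarrow> 0 < w x" and total: "(\<Sum>x\<in>F. w x) = 1"
    and mean: "\<And>i. i < b \<Longrightarrow> (\<Sum>x\<in>F \<inter> H i. real x * w x) = real B1 / real n1"
    and n1: "0 < n1" and \<epsilon>: "0 < \<epsilon>"
  obtains Q :: nat and c :: "nat \<Rightarrow> nat" where "0 < Q" "(\<Sum>x\<in>F. c x) = Q"
    "\<And>i. i < b \<Longrightarrow> n1 * (\<Sum>x\<in>F \<inter> H i. x * c x) = Q * B1"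
    "\<And>x. x \<in> F \<Longrightarrow> 0 < c x" "\<And>x. x \<in> F \<Longrightarrow> real (c x) \<le> (1 + \<epsilon>) * (real Q * w x)"
proof -
  have ne: "F \<noteq> {}" using total by auto
  \<comment> \<open>A rounding error below \<open>\<delta>\<close> keeps the integers positive and
    enlarges no \<open>Q * w x\<close> by more than the factor
    \<open>1 + \<epsilon>\<close>.\<close>
  define \<delta> where "\<delta> = min 1 \<epsilon> * Min (w ` F)"
  have minpos: "0 < Min (w ` F)" using fin ne pos by simp
  then have \<delta>: "0 < \<delta>" using \<epsilon> by (simp add: \<delta>_def)
  have \<delta>_le: "\<delta> \<le> w x" "\<delta> \<le> \<epsilon> * w x" if "x \<in> F" for x
  proof -
    have "Min (w ` F) \<le> w x" using fin that by simp
    then have "min 1 \<epsilon> * Min (w ` F) \<le> 1 * w x" "min 1 \<epsilon> * Min (w ` F) \<le> \<epsilon> * w x"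
      using minpos \<epsilon> by (intro mult_mono; auto)+
    then show "\<delta> \<le> w x" "\<delta> \<le> \<epsilon> * w x" by (auto simp: \<delta>_def)
  qed
  \<comment> \<open>\<open>K / real N\<close> will bound the rounding error of the total and, after
    multiplication by \<open>n1\<close>, that of every block mean. These errors are integers, so
    \<open>K / real N < 1\<close> makes them vanish.\<close>
  define K where "K = n1 * (\<Sum>F + card F)"
  obtain N :: nat where N: "real N > max (real K) (1 / \<delta>)"
    using reals_Archimedean2 by blast
  have "0 < real N" using N by (smt (verit) of_nat_0_le_iff)
  then have Npos: "0 < N" by simp
  have N\<delta>: "1 / real N < \<delta>" using N \<delta> Npos by (simp add: field_simps)
  have NK: "real K / real N < 1" using N Npos by (simp add: field_simps)
  obtain Q P where Q: "0 < Q" and P: "\<And>x. x < Suc (Max F) \<Longrightarrow> \<bar>of_int Q * w x - of_int (P x)\<bar> < 1 / real N"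
    using Dirichlet_approx_simult[OF Npos, of "Suc (Max F)" w] by metis
  have PF: "\<bar>of_int Q * w x - of_int (P x)\<bar> < 1 / real N" if "x \<in> F" for x
    using P[of x] Max_ge[OF fin that] by simp
  have Q1: "1 \<le> real_of_int Q" using Q by simp
  have Ppos: "0 < P x" if "x \<in> F" for x
  proof -
    have "w x \<le> of_int Q * w x" using Q1 pos[OF that] by simp
    then have "0 < real_of_int (P x)" using PF[OF that] N\<delta> \<delta>_le(1)[OF that] by linarith
    then show ?thesis by simp
  qed
  have Ple: "real_of_int (P x) \<le> (1 + \<epsilon>) * (of_int Q * w x)" if "x \<in> F" for x
  proof -
    have "\<epsilon> * w x * 1 \<le> \<epsilon> * w x * of_int Q" using Q1 pos[OF that] \<epsilon> by (intro mult_left_mono) auto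
    then have "real_of_int (P x) \<le> of_int Q * w x + \<epsilon> * (of_int Q * w x)"
      using PF[OF that] N\<delta> \<delta>_le(2)[OF that] by (simp add: ac_simps)
    then show ?thesis by (simp add: algebra_simps)
  qed
  have approx: "\<bar>(\<Sum>x\<in>G. f x * of_int (P x)) - of_int Q * (\<Sum>x\<in>G. f x * w x)\<bar> \<le> (\<Sum>x\<in>F. f x) / real N"
    if G: "G \<subseteq> F" and f: "\<And>x. 0 \<le> f x" for G and f :: "nat \<Rightarrow> real"
  proof -
    have "\<bar>(\<Sum>x\<in>G. f x * of_int (P x)) - of_int Q * (\<Sum>x\<in>G. f x * w x)\<bar> =
        \<bar>\<Sum>x\<in>G. f x * (of_int (P x) - of_int Q * w x)\<bar>"
      by (simp add: sum_distrib_left sum_subtractf algebra_simps)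
    also have "\<dots> \<le> (\<Sum>x\<in>G. \<bar>f x * (of_int (P x) - of_int Q * w x)\<bar>)" by (rule sum_abs)
    also have "\<dots> \<le> (\<Sum>x\<in>G. f x * (1 / real N))"
    proof (intro sum_mono)
      fix x assume "x \<in> G"
      then have "\<bar>of_int (P x) - of_int Q * w x\<bar> \<le> 1 / real N" using PF[of x] G by (auto simp: abs_minus_commute)
      then show "\<bar>f x * (of_int (P x) - of_int Q * w x)\<bar> \<le> f x * (1 / real N)"
        using f[of x] by (simp only: abs_mult abs_of_nonneg mult_left_mono)
    qed
    also have "\<dots> \<le> (\<Sum>x\<in>F. f x * (1 / real N))"
      using G f fin by (intro sum_mono2) auto
    finally show ?thesis by (simp add: sum_divide_distrib)
  qed
  have KF: "n1 * (\<Sum>x\<in>F. x) \<le> K" "card F \<le> K"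
  proof -
    have "1 * card F \<le> n1 * (\<Sum>F + card F)" using n1 by (intro mult_le_mono) auto
    then show "n1 * (\<Sum>x\<in>F. x) \<le> K" "card F \<le> K" by (auto simp: K_def)
  qed
  have "\<bar>real_of_int ((\<Sum>x\<in>F. P x) - Q)\<bar> \<le> real (card F) / real N"
    using approx[of F "\<lambda>_. 1"] total by simp
  also have "\<dots> \<le> real K / real N" using KF(2) by (intro divide_right_mono) auto
  finally have "\<bar>(\<Sum>x\<in>F. P x) - Q\<bar> < 1" using NK by linarith
  then have sumP: "(\<Sum>x\<in>F. P x) = Q" by linarith
  have meanP: "int n1 * (\<Sum>x\<in>F \<inter> H i. int x * P x) = Q * int B1" if i: "i < b" for i
  proof -
    have "\<bar>real_of_int (int n1 * (\<Sum>x\<in>F \<inter> H i. int x * P x) - Q * int B1)\<bar> =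
        real n1 * \<bar>(\<Sum>x\<in>F \<inter> H i. real x * of_int (P x)) - of_int Q * (\<Sum>x\<in>F \<inter> H i. real x * w x)\<bar>"
      unfolding mean[OF i] using n1 by (simp add: abs_mult_pos[symmetric] field_simps flip: abs_mult)
    also have "\<dots> \<le> real n1 * ((\<Sum>x\<in>F. real x) / real N)"
      using approx[of "F \<inter> H i" real] by (intro mult_left_mono) auto
    also have "\<dots> = real (n1 * (\<Sum>x\<in>F. x)) / real N" by simp
    also have "\<dots> \<le> real K / real N" using KF(1) by (intro divide_right_mono) (simp_all only: of_nat_le_iff of_nat_0_le_iff)
    finally have "\<bar>int n1 * (\<Sum>x\<in>F \<inter> H i. int x * P x) - Q * int B1\<bar> < 1" using NK by linarith
    then show ?thesis by linarith
  qed
  define c where "c x = nat (P x)" for x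
  have c: "int (c x) = P x" if "x \<in> F" for x using Ppos[OF that] by (simp add: c_def)
  show thesis
  proof (rule that[of "nat Q" c])
    show "0 < nat Q" using Q by simp
    have "int (\<Sum>x\<in>F. c x) = Q" using sumP c by simp
    then show "(\<Sum>x\<in>F. c x) = nat Q" by linarith
    show "n1 * (\<Sum>x\<in>F \<inter> H i. x * c x) = nat Q * B1" if "i < b" for i
    proof -
      have "int (n1 * (\<Sum>x\<in>F \<inter> H i. x * c x)) = int (nat Q * B1)"
        using meanP[OF that] c Q by simp
      then show ?thesis by (simp only: of_nat_eq_iff)
    qed
    show "0 < c x" if "x \<in> F" for x using Ppos[OF that] by (simp add: c_def)
    show "real (c x) \<le> (1 + \<epsilon>) * (real (nat Q) * w x)" if "x \<in> F" for x
      using Ple[OF that] Ppos[OF that] Q by (simp add: c_def)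
  qed
qed

section \<open>Crude Stirling bounds and the probability of a composition\<close>

lemma fact_lower_bound: "real n ^ n \<le> fact n * exp (real n)"
proof (induction n)
  case 0
  then show ?case by simp
next
  case (Suc n)
  show ?case
  proof (cases "n = 0")
    case True
    then show ?thesis using exp_ge_add_one_self[of 1] by simp
  next
    case False
    have "(1 + 1 / real n) ^ n \<le> exp 1"
      using False by (intro exp_ge_one_plus_x_over_n_power_n) auto
    then have "(1 + 1 / real n) ^ n * real n ^ n \<le> exp 1 * real n ^ n"
      by (rule mult_right_mono) simp
    moreover have "(1 + 1 / real n) * real n = real (Suc n)" using False by (simp add: field_simps)
    ultimately have "real (Suc n) ^ n \<le> exp 1 * real n ^ n"
      by (simp only: power_mult_distrib[symmetric])
    also have "\<dots> \<le> exp 1 * (fact n * exp (real n))" using Suc.IH by simp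
    finally have "real (Suc n) * real (Suc n) ^ n \<le> real (Suc n) * (exp 1 * (fact n * exp (real n)))"
      by (rule mult_left_mono) simp
    then show ?thesis by (simp add: exp_add algebra_simps)
  qed
qed

text \<open>The factor \<open>exp 1 * n\<close> is the price of an elementary induction and is
  harmless on an exponential scale. The inductive step rests on
  \<open>(1 - 1 / (n + 1)) ^ (n + 1) \<le> exp (-1)\<close>.\<close>

lemma fact_upper_bound: "0 < n \<Longrightarrow> fact n * exp (real n) \<le> exp 1 * real n * real n ^ n"
proof (induction n rule: nat_induct_non_zero)
  case 1
  then show ?case by simp
next
  case (Suc n)
  have "(1 + (-1) / real (Suc n)) ^ Suc n \<le> exp (-1)"
    by (intro exp_ge_one_plus_x_over_n_power_n) auto
  then have "(1 + (-1) / real (Suc n)) ^ Suc n * real (Suc n) ^ Suc n \<le> exp (-1) * real (Suc n) ^ Suc n"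
    by (rule mult_right_mono) simp
  moreover have "(1 + (-1) / real (Suc n)) * real (Suc n) = real n" by (simp add: field_simps)
  ultimately have "real n ^ Suc n \<le> exp (-1) * real (Suc n) ^ Suc n"
    by (simp only: power_mult_distrib[symmetric])
  then have "exp 1 * real n ^ Suc n \<le> exp 1 * (exp (-1) * real (Suc n) ^ Suc n)"
    by (rule mult_left_mono) simp
  then have *: "exp 1 * real n ^ Suc n \<le> real (Suc n) ^ Suc n"
    by (simp add: mult.assoc[symmetric] exp_add[symmetric] del: power_Suc)
  have "fact (Suc n) * exp (real (Suc n)) = real (Suc n) * exp 1 * (fact n * exp (real n))"
    by (simp add: exp_add algebra_simps)
  also have "\<dots> \<le> real (Suc n) * exp 1 * (exp 1 * real n * real n ^ n)"
    using Suc.IH by (intro mult_left_mono) auto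
  also have "\<dots> = real (Suc n) * exp 1 * (exp 1 * real n ^ Suc n)" by simp
  also have "\<dots> \<le> real (Suc n) * exp 1 * real (Suc n) ^ Suc n"
    using * by (intro mult_left_mono) auto
  finally show ?case by (simp only: mult_ac)
qed

text \<open>The probability of a sample with counts \<open>d\<close> is governed by the relative
  entropy of \<open>d / n\<close> with respect to \<open>p\<close>, here at most the logarithm of
  \<open>\<kappa>\<close>. Concretely, replacing each \<open>d x ^ d x\<close> by
  \<open>(\<kappa> * n * p x) ^ d x\<close> loses only \<open>\<kappa> ^ n\<close> in total, and
  each factorial in the denominator loses at most \<open>exp 1 * n\<close>.\<close>

lemma multinomial_lower_bound:
  fixes d :: "'a \<Rightarrow> nat" and p :: "'a \<Rightarrow> real"
  assumes fin: "finite F" and d: "\<And>x. x \<in> F \<Longrightarrow> 0 < d x" and n: "n = sum d F" and \<kappa>: "0 < \<kappa>"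
    and p: "\<And>x. x \<in> F \<Longrightarrow> real (d x) \<le> \<kappa> * real n * p x"
  shows "1 \<le> (exp 1 * real n) ^ card F * \<kappa> ^ n * (fact n / (\<Prod>x\<in>F. fact (d x)) * (\<Prod>x\<in>F. p x ^ d x))"
proof -
  let ?P = "\<Prod>x\<in>F. p x ^ d x"
  have p0: "0 \<le> p x" if "x \<in> F" for x
  proof -
    have "d x \<le> n" using fin that unfolding n by (intro member_le_sum) auto
    then have "0 < \<kappa> * real n" using d[OF that] \<kappa> by simp
    moreover have "0 < \<kappa> * real n * p x" using p[OF that] d[OF that] by linarith
    ultimately have "0 < p x" by (metis zero_less_mult_pos)
    then show ?thesis by simp
  qed
  have "(\<Prod>x\<in>F. fact (d x)) * exp (real n) = (\<Prod>x\<in>F. fact (d x) * exp (real (d x)))"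
    using fin by (simp add: n exp_sum prod.distrib)
  also have "\<dots> \<le> (\<Prod>x\<in>F. (exp 1 * real n) * real (d x) ^ d x)"
  proof (intro prod_mono conjI)
    fix x assume x: "x \<in> F"
    have "fact (d x) * exp (real (d x)) \<le> exp 1 * real (d x) * real (d x) ^ d x"
      by (rule fact_upper_bound[OF d[OF x]])
    also have "\<dots> \<le> exp 1 * real n * real (d x) ^ d x"
      using fin x unfolding n by (intro mult_right_mono mult_left_mono of_nat_mono member_le_sum) auto
    finally show "fact (d x) * exp (real (d x)) \<le> exp 1 * real n * real (d x) ^ d x" .
  qed simp
  also have "\<dots> = (exp 1 * real n) ^ card F * (\<Prod>x\<in>F. real (d x) ^ d x)"
    by (simp add: prod.distrib)
  also have "\<dots> \<le> (exp 1 * real n) ^ card F * (\<Prod>x\<in>F. (\<kappa> * real n * p x) ^ d x)"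
    using p by (intro mult_left_mono prod_mono conjI power_mono) auto
  also have "(\<Prod>x\<in>F. (\<kappa> * real n * p x) ^ d x) = \<kappa> ^ n * real n ^ n * ?P"
    unfolding power_mult_distrib prod.distrib by (simp add: n power_sum)
  also have "(exp 1 * real n) ^ card F * (\<kappa> ^ n * real n ^ n * ?P) \<le>
      (exp 1 * real n) ^ card F * (\<kappa> ^ n * (fact n * exp (real n)) * ?P)"
    using fact_lower_bound[of n] \<kappa> p0
    by (intro mult_left_mono mult_right_mono prod_nonneg zero_le_power) auto
  finally have "(\<Prod>x\<in>F. fact (d x)) * exp (real n) \<le>
      ((exp 1 * real n) ^ card F * \<kappa> ^ n * fact n * ?P) * exp (real n)"
    by (simp only: mult_ac)
  then have "(\<Prod>x\<in>F. fact (d x)) \<le> (exp 1 * real n) ^ card F * \<kappa> ^ n * fact n * ?P"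
    by simp
  moreover have "(0::real) < (\<Prod>x\<in>F. fact (d x))" by (intro prod_pos) auto
  ultimately show ?thesis by (simp add: field_simps)
qed

text \<open>Lists are convenient because the arrangements of a multiset are counted as lists. The
  value 0 beyond the length is the default value of \<open>iid_degrees\<close>, so that the sequence
  has the probability of the list.\<close>

definition list_seq :: "nat list \<Rightarrow> nat \<Rightarrow> nat" where
  "list_seq zs v = (if v < length zs then zs ! v else 0)"

lemma pmf_iid_degrees_list_seq:
  "pmf (iid_degrees p (length zs)) (list_seq zs) = prod_list (map (pmf p) zs)"
proof -
  have "pmf (iid_degrees p (length zs)) (list_seq zs) = (\<Prod>v<length zs. pmf p (zs ! v))"
    by (subst pmf_Pi') (auto simp: list_seq_def)
  then show ?thesis
    by (simp add: prod.list_conv_set_nth lessThan_atLeast0)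
qed

lemma prob_iid_degrees_ge_lists:
  assumes "finite Z" "\<And>zs. zs \<in> Z \<Longrightarrow> length zs = n" "\<And>zs. zs \<in> Z \<Longrightarrow> list_seq zs \<in> X"
  shows "(\<Sum>zs\<in>Z. prod_list (map (pmf p) zs)) \<le> measure_pmf.prob (iid_degrees p n) X"
proof -
  have inj: "inj_on list_seq Z"
  proof (rule inj_onI)
    fix xs ys assume *: "xs \<in> Z" "ys \<in> Z" "list_seq xs = list_seq ys"
    show "xs = ys"
    proof (rule nth_equalityI)
      show "length xs = length ys" using * assms(2) by simp
      show "xs ! v = ys ! v" if "v < length xs" for v
        using fun_cong[OF *(3), of v] that assms(2)[OF *(1)] assms(2)[OF *(2)] by (simp add: list_seq_def)
    qed
  qed
  have "(\<Sum>zs\<in>Z. prod_list (map (pmf p) zs)) = (\<Sum>zs\<in>Z. pmf (iid_degrees p n) (list_seq zs))"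
  proof (rule sum.cong[OF refl])
    fix zs assume "zs \<in> Z"
    then show "prod_list (map (pmf p) zs) = pmf (iid_degrees p n) (list_seq zs)"
      using pmf_iid_degrees_list_seq[where p = p and zs = zs] assms(2) by simp
  qed
  also have "\<dots> = measure_pmf.prob (iid_degrees p n) (list_seq ` Z)"
    using assms(1) by (simp add: measure_measure_pmf_finite sum.reindex[OF inj])
  also have "\<dots> \<le> measure_pmf.prob (iid_degrees p n) X"
    using assms(3) by (intro measure_pmf.finite_measure_mono) auto
  finally show ?thesis .
qed

definition block_sum :: "(nat \<Rightarrow> nat set) \<Rightarrow> nat \<Rightarrow> (nat \<Rightarrow> nat) \<Rightarrow> nat \<Rightarrow> nat" where
  "block_sum H n k i = (\<Sum>v<n. if k v \<in> H i then k v else 0)"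

text \<open>With \<open>m = mean_degree p / b\<close>, even placement becomes a condition linear in
  the length: concatenating two lists that satisfy it gives another one.\<close>

definition even_block_seqs :: "nat \<Rightarrow> (nat \<Rightarrow> nat set) \<Rightarrow> real \<Rightarrow> nat \<Rightarrow> (nat \<Rightarrow> nat) set" where
  "even_block_seqs b H m n = {k. \<forall>i<b. real (block_sum H n k i) = real n * m}"

definition even_block_sizes :: "nat pmf \<Rightarrow> nat \<Rightarrow> (nat \<Rightarrow> nat set) \<Rightarrow> real \<Rightarrow> nat set" where
  "even_block_sizes p b H m = {n. 0 < n \<and> set_pmf (iid_degrees p n) \<inter> even_block_seqs b H m n \<noteq> {}}"

lemma block_sum_list_seq:
  "block_sum H (length zs) (list_seq zs) i = sum_list (map (\<lambda>x. if x \<in> H i then x else 0) zs)"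
proof -
  have "block_sum H (length zs) (list_seq zs) i = (\<Sum>v<length zs. (\<lambda>x. if x \<in> H i then x else 0) (zs ! v))"
    unfolding block_sum_def list_seq_def by (intro sum.cong) auto
  then show ?thesis
    by (simp add: sum.list_conv_set_nth lessThan_atLeast0)
qed

lemma even_block_sizesE:
  assumes "n \<in> even_block_sizes p b H m"
  obtains ys where "length ys = n" "set ys \<subseteq> set_pmf p" "list_seq ys \<in> even_block_seqs b H m n"
proof -
  obtain k where k: "k \<in> set_pmf (iid_degrees p n)" "k \<in> even_block_seqs b H m n"
    using assms by (auto simp: even_block_sizes_def)
  have "set (map k [0..<n]) \<subseteq> set_pmf p"
    using k(1) by (auto simp: set_Pi_pmf PiE_dflt_def)
  moreover have "block_sum H n (list_seq (map k [0..<n])) i = block_sum H n k i" for i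
    unfolding block_sum_def list_seq_def by (intro sum.cong) auto
  then have "list_seq (map k [0..<n]) \<in> even_block_seqs b H m n"
    using k(2) by (simp add: even_block_seqs_def)
  ultimately show thesis using that[of "map k [0..<n]"] by simp
qed

lemma sum_replicate_mset:
  fixes f :: "'a \<Rightarrow> real" and g :: "'a \<Rightarrow> nat"
  assumes "finite F"
  shows "size (\<Sum>x\<in>F. replicate_mset (d x) x) = sum d F"
    and "count (\<Sum>x\<in>F. replicate_mset (d x) x) y = (if y \<in> F then d y else 0)"
    and "prod_mset (image_mset f (\<Sum>x\<in>F. replicate_mset (d x) x)) = (\<Prod>x\<in>F. f x ^ d x)"
    and "sum_mset (image_mset g (\<Sum>x\<in>F. replicate_mset (d x) x)) = (\<Sum>x\<in>F. d x * g x)"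
  using assms by (induction F) auto

text \<open>
  The arrangements of \<open>d x\<close> copies of each \<open>x \<in> F\<close> are put behind one fixed admissible list, which
  takes care of the residue class of the length.
\<close>

lemma prob_even_block_seqs_ge:
  assumes fin: "finite F" and FH: "\<And>i. i < b \<Longrightarrow> real (\<Sum>x\<in>F \<inter> H i. d x * x) = real (sum d F) * m"
    and ys: "list_seq ys \<in> even_block_seqs b H m (length ys)"
    and d: "\<And>x. x \<in> F \<Longrightarrow> 0 < d x"
  shows "prod_list (map (pmf p) ys) * (fact (sum d F) / (\<Prod>x\<in>F. fact (d x)) * (\<Prod>x\<in>F. pmf p x ^ d x)) \<le>
    measure_pmf.prob (iid_degrees p (length ys + sum d F)) (even_block_seqs b H m (length ys + sum d F))"
proof -
  define M where "M = (\<Sum>x\<in>F. replicate_mset (d x) x)"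
  define Z where "Z = (\<lambda>xs. ys @ xs) ` permutations_of_multiset M"
  note M = sum_replicate_mset[OF fin, where d = d, folded M_def]
  have setM: "set_mset M = F"
    using M(2) d by (auto simp: set_mset_def split: if_splits)
  have finZ: "finite Z" by (simp add: Z_def)
  have perm: "length xs = sum d F" "prod_list (map (pmf p) xs) = (\<Prod>x\<in>F. pmf p x ^ d x)"
    "sum_list (map (\<lambda>x. if x \<in> H i then x else 0) xs) = (\<Sum>x\<in>F \<inter> H i. d x * x)"
    if "xs \<in> permutations_of_multiset M" for xs i
  proof -
    have xs: "mset xs = M" using that by (rule permutations_of_multisetD)
    show "length xs = sum d F" using xs M(1) by (metis size_mset)
    have "prod_list (map (pmf p) xs) = prod_mset (image_mset (pmf p) M)"
      unfolding xs[symmetric] by (simp flip: prod_mset_prod_list)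
    then show "prod_list (map (pmf p) xs) = (\<Prod>x\<in>F. pmf p x ^ d x)" using M(3) by simp
    have "sum_list (map (\<lambda>x. if x \<in> H i then x else 0) xs) =
        sum_mset (image_mset (\<lambda>x. if x \<in> H i then x else 0) M)"
      unfolding xs[symmetric] by (simp flip: sum_mset_sum_list)
    also have "\<dots> = (\<Sum>x\<in>F. d x * (if x \<in> H i then x else 0))" by (rule M(4))
    also have "\<dots> = (\<Sum>x\<in>F \<inter> H i. d x * x)"
      using fin by (intro sum.mono_neutral_cong_right) auto
    finally show "sum_list (map (\<lambda>x. if x \<in> H i then x else 0) xs) = (\<Sum>x\<in>F \<inter> H i. d x * x)" .
  qed
  have len: "length zs = length ys + sum d F" if "zs \<in> Z" for zs
    using that perm(1) by (auto simp: Z_def)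
  have "list_seq zs \<in> even_block_seqs b H m (length ys + sum d F)" if "zs \<in> Z" for zs
  proof -
    obtain xs where xs: "xs \<in> permutations_of_multiset M" "zs = ys @ xs" using \<open>zs \<in> Z\<close> by (auto simp: Z_def)
    have "real (block_sum H (length zs) (list_seq zs) i) = real (length ys + sum d F) * m" if "i < b" for i
    proof -
      have "real (block_sum H (length ys) (list_seq ys) i) = real (length ys) * m"
        using ys that by (simp add: even_block_seqs_def)
      then show ?thesis
        unfolding block_sum_list_seq xs(2) map_append sum_list_append perm(3)[OF xs(1)] of_nat_add
          FH[OF that] by (simp add: distrib_right)
    qed
    then show ?thesis unfolding even_block_seqs_def len[OF \<open>zs \<in> Z\<close>, symmetric] by simp
  qed
  then have "(\<Sum>zs\<in>Z. prod_list (map (pmf p) zs)) \<le>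
      measure_pmf.prob (iid_degrees p (length ys + sum d F)) (even_block_seqs b H m (length ys + sum d F))"
    by (intro prob_iid_degrees_ge_lists finZ len)
  moreover have "(\<Sum>zs\<in>Z. prod_list (map (pmf p) zs)) =
      (\<Sum>xs\<in>permutations_of_multiset M. prod_list (map (pmf p) ys) * (\<Prod>x\<in>F. pmf p x ^ d x))"
    unfolding Z_def using perm(2) by (subst sum.reindex) (auto simp: inj_on_def)
  moreover have "real (card (permutations_of_multiset M)) = fact (sum d F) / (\<Prod>x\<in>F. fact (d x))"
  proof -
    have "(\<Prod>x\<in>F. fact (count M x)) = (\<Prod>x\<in>F. fact (d x) :: nat)"
      using M(2) by (intro prod.cong) auto
    moreover have "(\<Prod>x\<in>F. fact (count M x)) dvd (fact (size M) :: nat)"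
      using card_permutations_of_multiset(2)[of M] by (simp add: setM)
    ultimately show ?thesis
      using card_permutations_of_multiset(1)[of M] M(1)
      by (simp add: setM real_of_nat_div)
  qed
  ultimately show ?thesis by (simp add: mult_ac)
qed

text \<open>The counts \<open>c\<close> meet the constraints at length \<open>Q\<close>, hence
  \<open>L * c\<close> at length \<open>L * Q\<close>. Put behind one admissible list of length
  \<open>n1\<close>, they reach every larger \<open>n\<close> of the same residue, and the prefix
  costs only its own probability, a constant.\<close>

lemma prob_even_block_seqs_residue:
  fixes p :: "nat pmf" and b :: nat
  assumes \<kappa>: "1 \<le> \<kappa>" and fin: "finite F" and Q: "0 < Q" "sum c F = Q"
    and FH: "\<And>i. i < b \<Longrightarrow> real (\<Sum>x\<in>F \<inter> H i. c x * x) = real Q * m"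
    and c: "\<And>x. x \<in> F \<Longrightarrow> 0 < c x" "\<And>x. x \<in> F \<Longrightarrow> real (c x) \<le> \<kappa> * real Q * pmf p x"
    and n1: "n1 \<in> even_block_sizes p b H m"
  shows "\<exists>C>0. \<forall>n>n1. n mod Q = n1 mod Q \<longrightarrow>
    C \<le> (exp 1 * real n) ^ card F * \<kappa> ^ n * measure_pmf.prob (iid_degrees p n) (even_block_seqs b H m n)"
proof -
  obtain ys where ys: "length ys = n1" "set ys \<subseteq> set_pmf p" "list_seq ys \<in> even_block_seqs b H m n1"
    using n1 by (rule even_block_sizesE)
  define C where "C = prod_list (map (pmf p) ys)"
  have C: "0 < C"
  proof -
    have "0 < prod_list (map (pmf p) zs)" if "set zs \<subseteq> set_pmf p" for zs
      using that by (induction zs) (auto simp: pmf_positive)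
    then show ?thesis using ys(2) by (simp add: C_def)
  qed
  have "C \<le> (exp 1 * real n) ^ card F * \<kappa> ^ n *
      measure_pmf.prob (iid_degrees p n) (even_block_seqs b H m n)"
    if n: "n > n1" "n mod Q = n1 mod Q" for n
  proof -
    have "Q dvd n - n1" using n by (metis mod_eq_dvd_iff_nat less_imp_le)
    then obtain L where "n - n1 = Q * L" by (rule dvdE)
    then have L: "n = n1 + L * Q" "0 < L" using n(1) by (auto simp: mult.commute intro!: gr0I)
    define d where "d x = L * c x" for x
    have sum_d: "sum d F = L * Q" by (simp add: d_def Q(2) flip: sum_distrib_left)
    let ?R = "fact (sum d F) / (\<Prod>x\<in>F. fact (d x)) * (\<Prod>x\<in>F. pmf p x ^ d x)"
    have "C * ?R \<le> measure_pmf.prob (iid_degrees p (length ys + sum d F))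
        (even_block_seqs b H m (length ys + sum d F))"
      unfolding C_def
    proof (rule prob_even_block_seqs_ge[OF fin])
      fix i assume "i < b"
      have "real (\<Sum>x\<in>F \<inter> H i. d x * x) = real L * real (\<Sum>x\<in>F \<inter> H i. c x * x)"
        by (simp add: d_def sum_distrib_left mult.assoc)
      then show "real (\<Sum>x\<in>F \<inter> H i. d x * x) = real (sum d F) * m"
        unfolding FH[OF \<open>i < b\<close>] sum_d by simp
    qed (use ys c L in \<open>simp_all add: d_def\<close>)
    then have ge: "C * ?R \<le> measure_pmf.prob (iid_degrees p n) (even_block_seqs b H m n)"
      by (simp add: sum_d ys(1) L(1))
    have "1 \<le> (exp 1 * real (sum d F)) ^ card F * \<kappa> ^ sum d F * ?R"
    proof (rule multinomial_lower_bound[OF fin _ refl])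
      fix x assume x: "x \<in> F"
      show "0 < d x" using c(1)[OF x] L by (simp add: d_def)
      have "real L * real (c x) \<le> real L * (\<kappa> * real Q * pmf p x)"
        using c(2)[OF x] by (intro mult_left_mono) auto
      then show "real (d x) \<le> \<kappa> * real (sum d F) * pmf p x"
        unfolding sum_d by (simp add: d_def mult_ac)
    qed (use \<kappa> in simp)
    also have "\<dots> \<le> (exp 1 * real n) ^ card F * \<kappa> ^ n * ?R"
      using \<kappa> L(1) unfolding sum_d
      by (intro mult_right_mono mult_mono power_mono power_increasing mult_nonneg_nonneg prod_nonneg
          divide_nonneg_nonneg) auto
    finally have "C * 1 \<le> C * ((exp 1 * real n) ^ card F * \<kappa> ^ n * ?R)"
      using C by (intro mult_left_mono) auto
    also have "\<dots> = (exp 1 * real n) ^ card F * \<kappa> ^ n * (C * ?R)" by (simp only: mult_ac)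
    also have "\<dots> \<le> (exp 1 * real n) ^ card F * \<kappa> ^ n *
        measure_pmf.prob (iid_degrees p n) (even_block_seqs b H m n)"
      using ge \<kappa> by (intro mult_left_mono) auto
    finally show ?thesis by simp
  qed
  then show ?thesis using C by blast
qed

text \<open>There are only \<open>Q\<close> residue classes, so the smallest of their constants
  serves for all of them.\<close>

lemma finite_eventual_lower_bound:
  fixes f :: "nat \<Rightarrow> real"
  assumes "0 < (Q::nat)" "\<And>r. r < Q \<Longrightarrow> \<exists>C>0. eventually (\<lambda>n. n mod Q = r \<longrightarrow> P n \<longrightarrow> C \<le> f n) sequentially"
  shows "\<exists>C>0. eventually (\<lambda>n. P n \<longrightarrow> C \<le> f n) sequentially"
proof -
  have "\<exists>C. \<forall>r\<in>{..<Q}. C r > 0 \<and> eventually (\<lambda>n. n mod Q = r \<longrightarrow> P n \<longrightarrow> C r \<le> f n) sequentially"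
    using assms(2) by (intro bchoice) auto
  then obtain C where C: "\<And>r. r < Q \<Longrightarrow> C r > 0"
    "\<And>r. r < Q \<Longrightarrow> eventually (\<lambda>n. n mod Q = r \<longrightarrow> P n \<longrightarrow> C r \<le> f n) sequentially"
    by auto
  define D where "D = Min (C ` {..<Q})"
  have "0 < D" using assms(1) C(1) by (auto simp: D_def lessThan_empty_iff)
  have "eventually (\<lambda>n. \<forall>r\<in>{..<Q}. n mod Q = r \<longrightarrow> P n \<longrightarrow> C r \<le> f n) sequentially"
    using C(2) by (intro eventually_ball_finite) auto
  then have "eventually (\<lambda>n. P n \<longrightarrow> D \<le> f n) sequentially"
  proof eventually_elim
    case (elim n)
    have r: "n mod Q \<in> {..<Q}" using assms(1) by simp
    then have "D \<le> C (n mod Q)" unfolding D_def by (intro Min_le) auto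
    then show ?case using elim r by auto
  qed
  then show ?thesis using \<open>0 < D\<close> by blast
qed

lemma prob_even_block_seqs_subexponential:
  fixes p :: "nat pmf" and b :: nat
  assumes \<kappa>: "1 < \<kappa>" and disj: "disjoint_family_on H {..<b}" and cover: "(\<Union>i<b. H i) = UNIV"
    and mean: "\<And>i. i < b \<Longrightarrow> ((\<lambda>x. real x * pmf p x) has_sum m) (H i)"
  shows "\<exists>C>0. \<exists>r. eventually (\<lambda>n. n \<in> even_block_sizes p b H m \<longrightarrow>
    C \<le> (exp 1 * real n) ^ r * \<kappa> ^ n * measure_pmf.prob (iid_degrees p n) (even_block_seqs b H m n)) sequentially"
proof (cases "even_block_sizes p b H m = {}")
  case True
  then show ?thesis by (intro exI[of _ 1]) auto
next
  case False
  then obtain n1 k1 where n1: "0 < n1" "k1 \<in> even_block_seqs b H m n1"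
    by (auto simp: even_block_sizes_def)
  have "0 < b" using cover by (cases b) auto
  \<comment> \<open>One admissible sequence shows that \<open>m\<close> is rational with denominator
    \<open>n1\<close>. This is what turns the block means into relations between integers.\<close>
  then have m: "m = real (block_sum H n1 k1 0) / real n1"
    using n1 by (simp add: even_block_seqs_def)
  \<comment> \<open>Truncation and rounding each enlarge the weights by at most
    \<open>1 + \<epsilon>\<close>; the square root makes the two factors multiply to
    \<open>\<kappa>\<close>.\<close>
  define \<epsilon> where "\<epsilon> = sqrt \<kappa> - 1"
  have \<epsilon>: "0 < \<epsilon>" using \<kappa> by (simp add: \<epsilon>_def)
  have \<epsilon>\<kappa>: "(1 + \<epsilon>) * (1 + \<epsilon>) = \<kappa>" using \<kappa> by (simp add: \<epsilon>_def)
  obtain F w where F: "finite F" "F \<subseteq> set_pmf p" "\<And>x. x \<in> F \<Longrightarrow> 0 < w x"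
    "\<And>x. x \<in> F \<Longrightarrow> w x \<le> (1 + \<epsilon>) * pmf p x"
    "(\<Sum>x\<in>F. w x) = 1" "\<And>i. i < b \<Longrightarrow> (\<Sum>x\<in>F \<inter> H i. real x * w x) = m"
    by (rule finite_support_same_block_moments[OF \<epsilon> disj cover mean]) (assumption | rule that)+
  obtain Q c where c: "0 < Q" "(\<Sum>x\<in>F. c x) = Q"
    "\<And>i. i < b \<Longrightarrow> n1 * (\<Sum>x\<in>F \<inter> H i. x * c x) = Q * block_sum H n1 k1 0"
    "\<And>x. x \<in> F \<Longrightarrow> 0 < c x" "\<And>x. x \<in> F \<Longrightarrow> real (c x) \<le> (1 + \<epsilon>) * (real Q * w x)"
    by (rule integral_weights_same_block_moments[OF F(1,3,5) F(6)[unfolded m] n1(1) \<epsilon>]) (assumption | rule that)+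
  have FH: "real (\<Sum>x\<in>F \<inter> H i. c x * x) = real Q * m" if "i < b" for i
  proof -
    have "real n1 * real (\<Sum>x\<in>F \<inter> H i. x * c x) = real Q * real (block_sum H n1 k1 0)"
      using c(3)[OF that] by (metis of_nat_mult)
    then show ?thesis unfolding m using n1(1) by (simp add: field_simps)
  qed
  have cp: "real (c x) \<le> \<kappa> * real Q * pmf p x" if "x \<in> F" for x
  proof -
    have "real (c x) \<le> (1 + \<epsilon>) * (real Q * w x)" by (rule c(5)[OF that])
    also have "\<dots> \<le> (1 + \<epsilon>) * (real Q * ((1 + \<epsilon>) * pmf p x))"
      using F(4)[OF that] \<epsilon> by (intro mult_left_mono) auto
    also have "\<dots> = (1 + \<epsilon>) * (1 + \<epsilon>) * real Q * pmf p x" by (simp only: mult_ac)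
    finally show ?thesis unfolding \<epsilon>\<kappa> .
  qed
  have "\<exists>C>0. eventually (\<lambda>n. n \<in> even_block_sizes p b H m \<longrightarrow>
    C \<le> (exp 1 * real n) ^ card F * \<kappa> ^ n *
      measure_pmf.prob (iid_degrees p n) (even_block_seqs b H m n)) sequentially"
  proof (rule finite_eventual_lower_bound[OF c(1)])
    fix r assume "r < Q"
    show "\<exists>C>0. eventually (\<lambda>n. n mod Q = r \<longrightarrow> n \<in> even_block_sizes p b H m \<longrightarrow>
      C \<le> (exp 1 * real n) ^ card F * \<kappa> ^ n *
        measure_pmf.prob (iid_degrees p n) (even_block_seqs b H m n)) sequentially"
    proof (cases "\<exists>n\<in>even_block_sizes p b H m. n mod Q = r")
      case True
      then obtain n2 where n2: "n2 \<in> even_block_sizes p b H m" "n2 mod Q = r" by blast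
      obtain C where "C > 0" "\<forall>n>n2. n mod Q = n2 mod Q \<longrightarrow>
          C \<le> (exp 1 * real n) ^ card F * \<kappa> ^ n *
            measure_pmf.prob (iid_degrees p n) (even_block_seqs b H m n)"
        using prob_even_block_seqs_residue[OF _ F(1) c(1,2) FH c(4) cp n2(1)] \<kappa> by auto
      then show ?thesis
        using n2(2) by (intro exI[of _ C] conjI eventually_mono[OF eventually_gt_at_top[of n2]]) auto
    next
      case False
      \<comment> \<open>A residue class without any size of the set satisfies the bound vacuously,
        so any constant will do.\<close>
      then show ?thesis by (intro exI[of _ 1] conjI always_eventually) auto
    qed
  qed
  then show ?thesis by blast
qed

section \<open>Concentration of the degree proportions under the conditioning\<close>

definition degree_count :: "nat \<Rightarrow> (nat \<Rightarrow> nat) \<Rightarrow> nat \<Rightarrow> nat" where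
  "degree_count n k x = card {v. v < n \<and> k v = x}"

lemma degree_count_binomial:
  "map_pmf (\<lambda>k. degree_count n k x) (iid_degrees p n) = binomial_pmf n (pmf p x)"
proof -
  have bern: "map_pmf (\<lambda>y. y = x) p = bernoulli_pmf (pmf p x)"
  proof (rule pmf_eqI)
    fix t :: bool
    have "(\<lambda>y. y = x) -` {True} = {x}" "(\<lambda>y. y = x) -` {False} = UNIV - {x}" by auto
    then show "pmf (map_pmf (\<lambda>y. y = x) p) t = pmf (bernoulli_pmf (pmf p x)) t"
      using measure_pmf.prob_compl[of "{x}" p]
      by (cases t) (simp_all add: pmf_map measure_pmf_single pmf_le_1)
  qed
  have "binomial_pmf n (pmf p x) =
      map_pmf (\<lambda>f. card {v\<in>{..<n}. f v}) (Pi_pmf {..<n} (0 = x) (\<lambda>_. bernoulli_pmf (pmf p x)))"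
    by (intro binomial_pmf_altdef') (auto simp: pmf_le_1)
  also have "Pi_pmf {..<n} (0 = x) (\<lambda>_. bernoulli_pmf (pmf p x)) =
      map_pmf (\<lambda>k. (\<lambda>y. y = x) \<circ> k) (iid_degrees p n)"
    unfolding bern[symmetric] by (rule Pi_pmf_map) auto
  finally show ?thesis by (simp add: pmf.map_comp comp_def degree_count_def)
qed

lemma degree_count_hoeffding:
  assumes "0 < n" "0 \<le> \<delta>"
  shows "measure_pmf.prob (iid_degrees p n) {k. \<delta> \<le> \<bar>real (degree_count n k x) / real n - pmf p x\<bar>} \<le>
    2 * exp (- 2 * real n * \<delta>\<^sup>2)"
proof -
  interpret binomial_distribution n "pmf p x" by unfold_locales (auto simp: pmf_le_1)
  have "measure_pmf.prob (iid_degrees p n) {k. \<delta> \<le> \<bar>real (degree_count n k x) / real n - pmf p x\<bar>} =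
      measure_pmf.prob (map_pmf (\<lambda>k. degree_count n k x) (iid_degrees p n))
        {y. \<delta> \<le> \<bar>real y / real n - pmf p x\<bar>}"
    by (simp add: vimage_def)
  also have "\<dots> \<le> 2 * exp (- 2 * real n * \<delta>\<^sup>2)"
    unfolding degree_count_binomial using prob_abs_ge'[OF assms] by simp
  finally show ?thesis .
qed

text \<open>The quotient bounds the conditional probability of a deviation given the rare event, so
  it is the quotient, not its numerator alone, that has to vanish.\<close>

lemma cond_degree_count_concentrated:
  fixes p :: "nat pmf" and b :: nat
  assumes disj: "disjoint_family_on H {..<b}" and cover: "(\<Union>i<b. H i) = UNIV"
    and mean: "\<And>i. i < b \<Longrightarrow> ((\<lambda>x. real x * pmf p x) has_sum m) (H i)" and \<delta>: "0 < \<delta>"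
  shows "((\<lambda>n. measure_pmf.prob (iid_degrees p n) {k. \<delta> \<le> \<bar>real (degree_count n k x) / real n - pmf p x\<bar>} /
      measure_pmf.prob (iid_degrees p n) (even_block_seqs b H m n)) \<longlongrightarrow> 0)
    (inf sequentially (principal (even_block_sizes p b H m)))"
proof -
  let ?bad = "\<lambda>n. measure_pmf.prob (iid_degrees p n) {k. \<delta> \<le> \<bar>real (degree_count n k x) / real n - pmf p x\<bar>}"
  let ?ev = "\<lambda>n. measure_pmf.prob (iid_degrees p n) (even_block_seqs b H m n)"
  \<comment> \<open>Hoeffding's bound decays like \<open>exp (- 2 * n * a)\<close>. With
    \<open>\<kappa> = exp a\<close>, half of this exponent is spent on the conditioning event, and
    \<open>exp (- n * a)\<close> remains against a power of \<open>n\<close>.\<close>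
  define a where "a = \<delta>\<^sup>2"
  have a: "0 < a" using \<delta> by (simp add: a_def)
  have \<kappa>: "1 < exp a" using a by simp
  obtain C r where C: "0 < C" and ev: "eventually (\<lambda>n. n \<in> even_block_sizes p b H m \<longrightarrow>
    C \<le> (exp 1 * real n) ^ r * exp a ^ n * ?ev n) sequentially"
    using prob_even_block_seqs_subexponential[OF \<kappa> disj cover mean] by blast
  define g where "g n = 2 / C * (exp 1 / a) ^ r * ((real n * a) ^ r / exp (real n * a))" for n
  have "filterlim (\<lambda>n. real n * a) at_top sequentially"
    using filterlim_tendsto_pos_mult_at_top[OF tendsto_const a filterlim_real_sequentially]
    by (simp only: mult.commute)
  then have "((\<lambda>n. (real n * a) ^ r / exp (real n * a)) \<longlongrightarrow> 0) sequentially"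
    by (rule filterlim_compose[OF tendsto_power_div_exp_0])
  then have "g \<longlonglongrightarrow> 2 / C * (exp 1 / a) ^ r * 0"
    unfolding g_def[abs_def] by (intro tendsto_mult tendsto_const)
  then have g: "(g \<longlongrightarrow> 0) (inf sequentially (principal (even_block_sizes p b H m)))"
    by (intro tendsto_mono[OF inf_le1]) simp
  have le: "eventually (\<lambda>n. n \<in> even_block_sizes p b H m \<longrightarrow> ?bad n / ?ev n \<le> g n) sequentially"
    using ev eventually_gt_at_top[of 0]
  proof eventually_elim
    case (elim n)
    show ?case
    proof
      assume "n \<in> even_block_sizes p b H m"
      with elim have lower: "C \<le> (exp 1 * real n) ^ r * exp a ^ n * ?ev n" by blast
      define X where "X = (exp 1 * real n) ^ r * exp (real n * a)"
      have X: "0 < X" using elim by (simp add: X_def)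
      have CX: "C / X \<le> ?ev n"
      proof -
        have "C \<le> X * ?ev n" using lower unfolding X_def exp_of_nat_mult .
        then show ?thesis using X by (simp add: pos_divide_le_eq mult.commute)
      qed
      have "?bad n \<le> 2 * exp (- 2 * real n * a)"
        using degree_count_hoeffding[of n \<delta> p x] elim \<delta> by (simp add: a_def)
      then have "?bad n / ?ev n \<le> 2 * exp (- 2 * real n * a) / (C / X)"
        using CX C X by (intro frac_le) auto
      also have "\<dots> = 2 / C * (exp 1 * real n) ^ r * (exp (real n * a) * exp (- 2 * real n * a))"
        using C by (simp add: X_def)
      also have "exp (real n * a) * exp (- 2 * real n * a) = 1 / exp (real n * a)"
        by (simp add: exp_minus field_simps flip: exp_add)
      also have "2 / C * (exp 1 * real n) ^ r * (1 / exp (real n * a)) = g n"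
        using a by (simp add: g_def power_mult_distrib power_divide)
      finally show "?bad n / ?ev n \<le> g n" .
    qed
  qed
  show ?thesis
  proof (rule tendsto_sandwich[OF _ _ tendsto_const g])
    show "eventually (\<lambda>n. 0 \<le> ?bad n / ?ev n) (inf sequentially (principal (even_block_sizes p b H m)))"
      by simp
    show "eventually (\<lambda>n. ?bad n / ?ev n \<le> g n) (inf sequentially (principal (even_block_sizes p b H m)))"
      using le by (simp add: eventually_inf_principal)
  qed
qed

section \<open>Admissible degree sequences in terms of block sums\<close>

lemma num_stubs_eq_sum_block_sum:
  assumes disj: "disjoint_family_on H {..<b}" and cover: "(\<Union>i<b. H i) = UNIV"
  shows "num_stubs n k = (\<Sum>i<b. block_sum H n k i)"
proof -
  have "(\<Sum>i<b. if k v \<in> H i then k v else 0) = k v" for v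
  proof -
    obtain j where j: "j < b" "k v \<in> H j" using cover by blast
    have "(\<Sum>i<b. if k v \<in> H i then k v else 0) = (\<Sum>i\<in>{j}. k v)"
      using j disj by (intro sum.mono_neutral_cong_right) (auto simp: disjoint_family_on_def)
    then show ?thesis by simp
  qed
  then show ?thesis
    unfolding num_stubs_def block_sum_def by (subst sum.swap) simp
qed

text \<open>The sets \<open>V i\<close> are forced: as the \<open>H i\<close> are disjoint and cover
  all degrees, \<open>V i\<close> must consist of all vertices with degree in
  \<open>H i\<close>.\<close>

lemma evenly_placed_iff_block_sum:
  assumes disj: "disjoint_family_on H {..<b}" and cover: "(\<Union>i<b. H i) = UNIV"
  shows "evenly_placed b H n k \<longleftrightarrow> (\<forall>i<b. block_sum H n k i = num_stubs n k div b)"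
proof -
  have block: "block_sum H n k i = (\<Sum>v\<in>{v. v < n \<and> k v \<in> H i}. k v)" for i
    unfolding block_sum_def by (intro sum.mono_neutral_cong_right) auto
  have uniq: "i = j" if "x \<in> H i" "x \<in> H j" "i < b" "j < b" for x i j
    using disj that by (auto simp: disjoint_family_on_def)
  show ?thesis
  proof
    assume "evenly_placed b H n k"
    then obtain V where V: "(\<Union>i<b. V i) = {..<n}"
      "\<And>i. i < b \<Longrightarrow> (\<Sum>j\<in>V i. k j) = num_stubs n k div b" "\<And>i j. i < b \<Longrightarrow> j \<in> V i \<Longrightarrow> k j \<in> H i"
      unfolding evenly_placed_def by auto
    have "V i = {v. v < n \<and> k v \<in> H i}" if i: "i < b" for i
    proof (intro equalityI subsetI)
      fix v assume "v \<in> V i"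
      then show "v \<in> {v. v < n \<and> k v \<in> H i}" using V(1) V(3)[OF i] i by auto
    next
      fix v assume v: "v \<in> {v. v < n \<and> k v \<in> H i}"
      then have "v \<in> (\<Union>i<b. V i)" using V(1) by simp
      then obtain j where j: "j < b" "v \<in> V j" by blast
      then have "j = i" using uniq[of "k v" j i] V(3)[OF j] v i by simp
      then show "v \<in> V i" using j by simp
    qed
    then show "\<forall>i<b. block_sum H n k i = num_stubs n k div b" using V(2) block by simp
  next
    assume eq: "\<forall>i<b. block_sum H n k i = num_stubs n k div b"
    show "evenly_placed b H n k"
      unfolding evenly_placed_def
    proof (intro exI[of _ "\<lambda>i. {v. v < n \<and> k v \<in> H i}"] conjI allI impI ballI)
      have "v \<in> (\<Union>i<b. {v. v < n \<and> k v \<in> H i})" if "v < n" for v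
      proof -
        obtain j where "j < b" "k v \<in> H j" using cover by blast
        then show ?thesis using that by blast
      qed
      then show "(\<Union>i<b. {v. v < n \<and> k v \<in> H i}) = {..<n}" by auto
      show "disjoint_family_on (\<lambda>i. {v. v < n \<and> k v \<in> H i}) {..<b}"
        unfolding disjoint_family_on_def using uniq by blast
      fix l1 l2 i j
      assume "l1 < b" "l2 < b" "l1 \<noteq> l2" "i \<in> {v. v < n \<and> k v \<in> H l1}" "j \<in> {v. v < n \<and> k v \<in> H l2}"
      then show "k i \<noteq> k j" using uniq[of "k i" l1 l2] by auto
    qed (use eq block in auto)
  qed
qed

text \<open>One admissible sequence of length \<open>n\<close> fixes the number of stubs as
  \<open>n * mean_degree p\<close>. Divisibility by \<open>b\<close> and completability depend on
  this number alone, so for such \<open>n\<close> the conditioning event is just the linear event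
  about block sums.\<close>

lemma admissible_seqsD:
  assumes b: "0 < b" and \<mu>: "0 < mean_degree p"
    and disj: "disjoint_family_on H {..<b}" and cover: "(\<Union>i<b. H i) = UNIV"
    and k: "k \<in> admissible_seqs p b q h H n"
  shows "0 < n" "real (num_stubs n k) = real n * mean_degree p" "num_stubs n k = b * (num_stubs n k div b)"
    "0 < num_stubs n k div b" "completable b q h (num_stubs n k)"
    "\<And>i. i < b \<Longrightarrow> block_sum H n k i = num_stubs n k div b"
    "admissible_seqs p b q h H n = even_block_seqs b H (mean_degree p / real b) n"
proof -
  let ?N = "num_stubs n k"
  have kD: "b dvd ?N" "completable b q h ?N" "real ?N / real n = mean_degree p" "evenly_placed b H n k"
    using k by (auto simp: admissible_seqs_def)
  show n: "0 < n" using kD(3) \<mu> by (cases n) auto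
  show N: "real ?N = real n * mean_degree p" using kD(3) n by (simp add: field_simps)
  show NB: "?N = b * (?N div b)" using kD(1) by simp
  have "0 < ?N" using N n \<mu> by (metis of_nat_0_less_iff mult_pos_pos)
  then show "0 < ?N div b" using NB by (metis gr0I mult_0_right less_irrefl)
  show "completable b q h ?N" by (rule kD(2))
  show "\<And>i. i < b \<Longrightarrow> block_sum H n k i = ?N div b"
    using kD(4) evenly_placed_iff_block_sum[OF disj cover] by blast
  have realB: "real (?N div b) = real n * (mean_degree p / real b)"
    using N NB b by (metis nonzero_mult_div_cancel_left of_nat_0_less_iff of_nat_mult order_less_irrefl times_divide_eq_right)
  have adm_iff: "k' \<in> admissible_seqs p b q h H n \<longleftrightarrow> (\<forall>i<b. block_sum H n k' i = ?N div b)" for k'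
  proof
    assume k': "k' \<in> admissible_seqs p b q h H n"
    then have "real (num_stubs n k') / real n = real ?N / real n"
      using kD(3) by (simp add: admissible_seqs_def)
    then have "num_stubs n k' = ?N" using n by simp
    then show "\<forall>i<b. block_sum H n k' i = ?N div b"
      using k' evenly_placed_iff_block_sum[OF disj cover, of n k'] by (simp add: admissible_seqs_def)
  next
    assume eq: "\<forall>i<b. block_sum H n k' i = ?N div b"
    then have "num_stubs n k' = b * (?N div b)"
      unfolding num_stubs_eq_sum_block_sum[OF disj cover, of n k'] by simp
    then have N': "num_stubs n k' = ?N" using NB by simp
    then have "evenly_placed b H n k'" unfolding evenly_placed_iff_block_sum[OF disj cover] using eq by simp
    then show "k' \<in> admissible_seqs p b q h H n" using kD N' by (simp add: admissible_seqs_def)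
  qed
  show "admissible_seqs p b q h H n = even_block_seqs b H (mean_degree p / real b) n"
    unfolding even_block_seqs_def realB[symmetric] using adm_iff by auto
qed

lemma edge_degrees_eq:
  "edge_degrees p b q h H n = cond_pmf (iid_degrees p n) (admissible_seqs p b q h H n) \<bind>
     (\<lambda>k. random_graph b q h n k \<bind>
       (\<lambda>M. map_pmf (\<lambda>(s, t). (stub_degree n k s, stub_degree n k t)) (oriented_edge M)))"
  unfolding edge_degrees_def oriented_edge_def map_bind_pmf by simp

section \<open>Conditional averages and infinite sums\<close>

lemma prob_cond_pmf_le:
  assumes "set_pmf p \<inter> S \<noteq> {}"
  shows "measure_pmf.prob (cond_pmf p S) A \<le> measure_pmf.prob p A / measure_pmf.prob p S"
proof -
  have "measure_pmf.prob (cond_pmf p S) A = measure_pmf.prob p (S \<inter> A) / measure_pmf.prob p S"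
    unfolding cond_pmf.rep_eq[OF assms] using emeasure_measure_pmf_not_zero[OF assms]
    by (subst measure_uniform_measure) auto
  also have "\<dots> \<le> measure_pmf.prob p A / measure_pmf.prob p S"
    by (intro divide_right_mono measure_pmf.finite_measure_mono) auto
  finally show ?thesis .
qed

text \<open>On \<open>bad\<close> only the trivial estimate \<open>|G k - L| \<le> 1 + |L|\<close>
  is available.\<close>

lemma expectation_close:
  fixes G :: "'a \<Rightarrow> real"
  assumes bounds: "\<And>k. 0 \<le> G k" "\<And>k. G k \<le> 1" and \<eta>: "0 \<le> \<eta>"
    and good: "\<And>k. k \<in> set_pmf D \<Longrightarrow> k \<notin> bad \<Longrightarrow> \<bar>G k - L\<bar> \<le> \<eta>"
  shows "\<bar>measure_pmf.expectation D G - L\<bar> \<le> \<eta> + (1 + \<bar>L\<bar>) * measure_pmf.prob D bad"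
proof -
  have int: "integrable (measure_pmf D) G"
    using bounds by (intro measure_pmf.integrable_const_bound[where B = 1]) auto
  have int': "integrable (measure_pmf D) (indicator bad :: _ \<Rightarrow> real)"
    by (intro measure_pmf.integrable_const_bound[where B = 1]) auto
  have "measure_pmf.expectation D G - L = measure_pmf.expectation D (\<lambda>k. G k - L)"
    using int by simp
  also have "\<bar>\<dots>\<bar> \<le> measure_pmf.expectation D (\<lambda>k. \<bar>G k - L\<bar>)"
    by (rule integral_abs_bound)
  also have "\<dots> \<le> measure_pmf.expectation D (\<lambda>k. \<eta> + (1 + \<bar>L\<bar>) * indicator bad k)"
  proof (rule integral_mono_AE)
    show "AE k in measure_pmf D. \<bar>G k - L\<bar> \<le> \<eta> + (1 + \<bar>L\<bar>) * indicator bad k"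
    proof (rule AE_pmfI)
      fix k assume "k \<in> set_pmf D"
      then show "\<bar>G k - L\<bar> \<le> \<eta> + (1 + \<bar>L\<bar>) * indicator bad k"
        using good[of k] bounds[of k] \<eta> by (cases "k \<in> bad") auto
    qed
  qed (use int int' in simp_all)
  also have "\<dots> = \<eta> + (1 + \<bar>L\<bar>) * measure_pmf.prob D bad"
    using int' by simp
  finally show ?thesis .
qed

text \<open>Nonnegativity makes the product absolutely summable, which permits the passage from the
  iterated sum to the double sum.\<close>

lemma has_sum_times_nonneg:
  fixes f :: "'a \<Rightarrow> real" and g :: "'b \<Rightarrow> real"
  assumes f: "(f has_sum s) A" "\<And>x. x \<in> A \<Longrightarrow> 0 \<le> f x" and g: "(g has_sum t) B" "\<And>y. y \<in> B \<Longrightarrow> 0 \<le> g y"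
  shows "((\<lambda>(x, y). f x * g y) has_sum (s * t)) (A \<times> B)"
proof (rule has_sum_SigmaI)
  show *: "((\<lambda>y. case (x, y) of (x, y) \<Rightarrow> f x * g y) has_sum (f x * t)) B" for x
    using has_sum_cmult_right[OF g(1), of "f x"] by simp
  show st: "((\<lambda>x. f x * t) has_sum (s * t)) A"
    using has_sum_cmult_left[OF f(1), of t] .
  have "infsum (\<lambda>y. norm (f x * g y)) B = f x * t" if "x \<in> A" for x
  proof -
    have "infsum (\<lambda>y. norm (f x * g y)) B = infsum (\<lambda>y. f x * g y) B"
      using f(2)[OF that] g(2) by (intro infsum_cong) simp
    then show ?thesis using *[of x] by (simp add: infsumI)
  qed
  then have "(\<lambda>x. infsum (\<lambda>y. norm (f x * g y)) B) summable_on A \<longleftrightarrow> (\<lambda>x. f x * t) summable_on A"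
    by (rule summable_on_cong)
  then have "(\<lambda>x. infsum (\<lambda>y. norm (f x * g y)) B) summable_on A"
    using has_sum_imp_summable[OF st] by blast
  then have "Infinite_Sum.abs_summable_on (\<lambda>x. infsum (\<lambda>y. norm (f x * g y)) B) A"
    by (rule summable_on_iff_abs_summable_on_real[THEN iffD1])
  moreover have "Infinite_Sum.abs_summable_on (\<lambda>y. f x * g y) B" for x
    using has_sum_imp_summable[OF *[of x]] unfolding case_prod_conv
    by (rule summable_on_iff_abs_summable_on_real[THEN iffD1])
  ultimately have "Infinite_Sum.abs_summable_on (\<lambda>(x, y). f x * g y) (A \<times> B)"
    unfolding Infinite_Sum.abs_summable_on_Sigma_iff case_prod_conv by blast
  then show "(\<lambda>(x, y). f x * g y) summable_on (A \<times> B)"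
    by (rule abs_summable_summable)
qed

lemma expectation_pmf_has_sum:
  fixes f :: "'a \<Rightarrow> real"
  assumes "((\<lambda>x. pmf D x * f x) has_sum s) UNIV"
  shows "measure_pmf.expectation D f = s"
proof -
  have "(\<lambda>x. pmf D x * f x) summable_on UNIV" using assms by (rule has_sum_imp_summable)
  then have "Infinite_Sum.abs_summable_on (\<lambda>x. pmf D x * f x) UNIV"
    by (rule summable_on_iff_abs_summable_on_real[THEN iffD1])
  then have "infsetsum (\<lambda>x. pmf D x * f x) UNIV = infsum (\<lambda>x. pmf D x * f x) UNIV"
    by (intro infsetsum_infsum) (simp only: abs_summable_equivalent)
  then show ?thesis using infsumI[OF assms] by (simp add: pmf_expectation_eq_infsetsum)
qed

section \<open>The limit law and its correlation\<close>

lemma pmf_embed_pmf_has_sum: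
  fixes f :: "'a \<Rightarrow> real"
  assumes "\<And>x. 0 \<le> f x" "(f has_sum 1) UNIV"
  shows "pmf (embed_pmf f) x = f x"
proof (rule pmf_embed_pmf)
  have "Infinite_Sum.abs_summable_on f UNIV"
    using has_sum_imp_summable[OF assms(2)] by (rule summable_on_iff_abs_summable_on_real[THEN iffD1])
  then have "Infinite_Set_Sum.abs_summable_on f UNIV" by (rule abs_summable_equivalent[THEN iffD1])
  then show "(\<integral>\<^sup>+ x. ennreal (f x) \<partial>count_space UNIV) = 1"
    using assms(1) infsumI[OF assms(2)] by (simp add: nn_integral_conv_infsetsum infsetsum_infsum)
qed (rule assms(1))

locale degree_blocks =
  fixes p :: "nat pmf" and b :: nat and q :: real and h :: "nat \<Rightarrow> nat" and H :: "nat \<Rightarrow> nat set"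
  assumes mean_pos: "0 < mean_degree p"
    and third_moment: "summable (\<lambda>k. real k ^ 3 * pmf p k)"
    and b_pos: "0 < b" and q: "0 \<le> q" "q < 1"
    and h_permutes: "h permutes {..<b}" and h_invol: "\<And>i. i < b \<Longrightarrow> h (h i) = i"
    and disj: "disjoint_family_on H {..<b}" and cover: "(\<Union>i<b. H i) = UNIV"
    and mean: "\<And>i. i < b \<Longrightarrow> (\<Sum>\<^sub>\<infinity>k\<in>H i. real k * pmf p k) = mean_degree p / real b"
begin

abbreviation \<mu> where "\<mu> \<equiv> mean_degree p"

definition m where "m = \<mu> / real b"

lemma m_pos: "0 < m"
  using mean_pos b_pos by (simp add: m_def)

lemma h_lt: "i < b \<Longrightarrow> h i < b"
  using h_permutes permutes_in_image by fastforce

definition blk :: "nat \<Rightarrow> nat" where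
  "blk x = (THE i. i < b \<and> x \<in> H i)"

lemma blk_eq: "i < b \<Longrightarrow> x \<in> H i \<Longrightarrow> blk x = i"
  unfolding blk_def using disj by (intro the_equality) (auto simp: disjoint_family_on_def)

lemma blk: "blk x < b" "x \<in> H (blk x)"
proof -
  obtain i where i: "i < b" "x \<in> H i" using cover by blast
  then show "blk x < b" "x \<in> H (blk x)" using blk_eq[OF i] by simp_all
qed

lemma moment_summable:
  assumes "r \<le> 3"
  shows "(\<lambda>x. real x ^ r * pmf p x) summable_on A"
proof -
  have "summable (\<lambda>x. norm (real x ^ r * pmf p x))"
  proof (rule summable_comparison_test')
    \<comment> \<open>The added \<open>pmf p x\<close> covers \<open>r = 0\<close> at
      \<open>x = 0\<close>, where the cubic term vanishes. For \<open>x \<ge> 1\<close> the cubic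
      term dominates by itself.\<close>
    show "summable (\<lambda>x. real x ^ 3 * pmf p x + pmf p x)"
    proof (rule summable_add[OF third_moment])
      have "(pmf p has_sum measure_pmf.prob p UNIV) UNIV" by (rule has_sum_pmf)
      then show "summable (pmf p)" using has_sum_imp_sums sums_summable by blast
    qed
    show "norm (norm (real x ^ r * pmf p x)) \<le> real x ^ 3 * pmf p x + pmf p x" if "x \<ge> 0" for x
    proof (cases "x = 0")
      case True
      then show ?thesis by (cases "r = 0") (auto simp: zero_power)
    next
      case False
      then have "real x ^ r \<le> real x ^ 3" using assms by (intro power_increasing) auto
      then have "real x ^ r * pmf p x \<le> real x ^ 3 * pmf p x" by (intro mult_right_mono) auto
      then show ?thesis using pmf_nonneg[of p x] by (simp add: abs_mult del: pmf_nonneg)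
    qed
  qed
  then have "(\<lambda>x. real x ^ r * pmf p x) summable_on UNIV" by (rule norm_summable_imp_summable_on)
  then show ?thesis by (rule summable_on_subset_banach) auto
qed

lemma mean_has_sum: "i < b \<Longrightarrow> ((\<lambda>x. real x * pmf p x) has_sum m) (H i)"
  using has_sum_infsum[OF moment_summable[of 1 "H i"]] mean[of i] by (simp add: m_def)

definition u where "u = block_moment p H"

lemma u_has_sum: "((\<lambda>x. real x * (real x * pmf p x)) has_sum u i) (H i)"
  using has_sum_infsum[OF moment_summable[of 2 "H i"]]
  by (simp add: u_def block_moment_def power2_eq_square mult.assoc)

text \<open>The limit law is built from factors constant on blocks, so its marginals and moments
  reduce to the block sums \<open>s i\<close> of \<open>f\<close>.\<close>

lemma has_sum_blocks:
  fixes f :: "nat \<Rightarrow> real"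
  assumes "\<And>i. i < b \<Longrightarrow> (f has_sum s i) (H i)"
  shows "((\<lambda>x. c (blk x) * f x) has_sum (\<Sum>i<b. c i * s i)) UNIV"
proof -
  have "((\<lambda>x. c (blk x) * f x) has_sum (c i * s i)) (H i)" if i: "i < b" for i
  proof -
    have "((\<lambda>x. c i * f x) has_sum (c i * s i)) (H i)"
      using assms[OF i] by (rule has_sum_cmult_right)
    then show ?thesis
      using blk_eq[OF i] by (rule_tac has_sum_cong[THEN iffD1, rotated]) auto
  qed
  then have "((\<lambda>x. c (blk x) * f x) has_sum (\<Sum>i<b. c i * s i)) (\<Union>i<b. H i)"
    using disj by (intro sum_has_sum) (auto simp: disjoint_family_on_def)
  then show ?thesis by (simp only: cover)
qed

lemma has_sum_block_pairs:
  fixes f :: "nat \<Rightarrow> real"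
  assumes f: "\<And>i. i < b \<Longrightarrow> (f has_sum s i) (H i)" and nonneg: "\<And>x. 0 \<le> f x"
  shows "((\<lambda>(x, y). c (blk x) (blk y) * (f x * f y)) has_sum (\<Sum>i<b. \<Sum>j<b. c i j * (s i * s j))) UNIV"
proof -
  have "((\<lambda>(x, y). c (blk x) (blk y) * (f x * f y)) has_sum (c i j * (s i * s j))) (H i \<times> H j)"
    if ij: "i < b" "j < b" for i j
  proof -
    have "((\<lambda>z. c i j * (case z of (x, y) \<Rightarrow> f x * f y)) has_sum (c i j * (s i * s j))) (H i \<times> H j)"
      using f[OF ij(1)] f[OF ij(2)] nonneg by (intro has_sum_cmult_right has_sum_times_nonneg)
    moreover have "c i j * (case z of (x, y) \<Rightarrow> f x * f y) =
        (case z of (x, y) \<Rightarrow> c (blk x) (blk y) * (f x * f y))" if "z \<in> H i \<times> H j" for z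
      using that blk_eq[OF ij(1)] blk_eq[OF ij(2)] by auto
    ultimately show ?thesis by (rule has_sum_cong[THEN iffD1, rotated])
  qed
  then have "((\<lambda>(x, y). c (blk x) (blk y) * (f x * f y)) has_sum
      (\<Sum>ij\<in>{..<b} \<times> {..<b}. c (fst ij) (snd ij) * (s (fst ij) * s (snd ij))))
      (\<Union>ij\<in>{..<b} \<times> {..<b}. H (fst ij) \<times> H (snd ij))"
  proof (intro sum_has_sum)
    fix ij kl assume "ij \<in> {..<b} \<times> {..<b}" "kl \<in> {..<b} \<times> {..<b}" "ij \<noteq> kl"
    then show "H (fst ij) \<times> H (snd ij) \<inter> H (fst kl) \<times> H (snd kl) = {}"
      using disj unfolding disjoint_family_on_def by (cases ij; cases kl) auto
  qed auto
  moreover have "z \<in> (\<Union>ij\<in>{..<b} \<times> {..<b}. H (fst ij) \<times> H (snd ij))" for z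
    using blk[of "fst z"] blk[of "snd z"]
    by (intro UN_I[of "(blk (fst z), blk (snd z))"]) (auto simp: mem_Times_iff)
  then have "(\<Union>ij\<in>{..<b} \<times> {..<b}. H (fst ij) \<times> H (snd ij)) = UNIV" by blast
  ultimately show ?thesis by (simp add: sum.cartesian_product case_prod_unfold)
qed

text \<open>Density of the limit law relative to \<open>(x * p x) * (y * p y)\<close>. Independent
  ends would give \<open>1 / \<mu>\<^sup>2\<close>. This holds for the type 2 share
  \<open>1 - q\<close>; the type 1 share \<open>q\<close> is confined to block \<open>h i\<close>,
  which holds one \<open>b\<close>-th of the stubs, whence the factor \<open>b\<close>.\<close>

definition affinity :: "nat \<Rightarrow> nat \<Rightarrow> real" where
  "affinity i j = (real b * q * of_bool (j = h i) + (1 - q)) / \<mu>\<^sup>2"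

lemma affinity_nonneg: "0 \<le> affinity i j"
  using q by (simp add: affinity_def)

lemma affinity_sym:
  assumes "i < b" "j < b" shows "affinity i j = affinity j i"
proof -
  have "j = h i \<longleftrightarrow> i = h j" using h_invol[OF assms(1)] h_invol[OF assms(2)] by metis
  then show ?thesis by (simp add: affinity_def)
qed

lemma sum_affinity: "(\<Sum>j<b. affinity i j * g j) =
    (real b * q * (if h i < b then g (h i) else 0) + (1 - q) * (\<Sum>j<b. g j)) / \<mu>\<^sup>2"
proof -
  have "(\<Sum>j<b. affinity i j * g j) =
      (real b * q * (\<Sum>j<b. of_bool (j = h i) * g j) + (1 - q) * (\<Sum>j<b. g j)) / \<mu>\<^sup>2"
  proof -
    have "affinity i j * g j =
        real b * q / \<mu>\<^sup>2 * (of_bool (j = h i) * g j) + (1 - q) / \<mu>\<^sup>2 * g j" for j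
      by (simp add: affinity_def add_divide_distrib distrib_right)
    then show ?thesis
      by (simp only: sum.distrib sum_distrib_left[symmetric]) (simp add: add_divide_distrib)
  qed
  also have "(\<Sum>j<b. of_bool (j = h i) * g j) = (\<Sum>j<b. if j = h i then g j else 0)"
    by (intro sum.cong) auto
  also have "\<dots> = (if h i < b then g (h i) else 0)" by simp
  finally show ?thesis .
qed

text \<open>Since \<open>b * m = \<mu>\<close>, the two terms of the numerator are
  \<open>q * \<mu>\<close> and \<open>(1 - q) * \<mu>\<close>. This yields both the total mass 1 of
  the limit law and its size-biased marginals.\<close>

lemma sum_affinity_m: "i < b \<Longrightarrow> (\<Sum>j<b. affinity i j * m) = 1 / \<mu>"
  unfolding sum_affinity using h_lt[of i] b_pos mean_pos
  by (simp add: m_def power2_eq_square field_simps)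

definition edge_law :: "(nat \<times> nat) pmf" where
  "edge_law = embed_pmf (\<lambda>(x, y). affinity (blk x) (blk y) * ((real x * pmf p x) * (real y * pmf p y)))"

lemma pmf_edge_law:
  "pmf edge_law (x, y) = affinity (blk x) (blk y) * ((real x * pmf p x) * (real y * pmf p y))"
proof -
  let ?f = "\<lambda>(x, y). affinity (blk x) (blk y) * ((real x * pmf p x) * (real y * pmf p y))"
  have "(?f has_sum (\<Sum>i<b. \<Sum>j<b. affinity i j * (m * m))) UNIV"
    by (rule has_sum_block_pairs) (simp_all add: mean_has_sum)
  moreover have "(\<Sum>i<b. \<Sum>j<b. affinity i j * (m * m)) = (\<Sum>i<b. (\<Sum>j<b. affinity i j * m) * m)"
    by (simp add: sum_distrib_right mult.assoc)
  moreover have "\<dots> = 1"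
    using sum_affinity_m mean_pos b_pos by (simp add: m_def)
  ultimately have "(?f has_sum 1) UNIV" by simp
  then have "pmf (embed_pmf ?f) (x, y) = ?f (x, y)"
    by (intro pmf_embed_pmf_has_sum) (auto intro!: mult_nonneg_nonneg affinity_nonneg)
  then show ?thesis by (simp add: edge_law_def)
qed

lemma pmf_size_biased: "pmf (size_biased p) x = real x * pmf p x / \<mu>"
proof -
  have "((\<lambda>x. (1 / \<mu>) * (real x * pmf p x)) has_sum (\<Sum>i<b. (1 / \<mu>) * m)) UNIV"
    using has_sum_blocks[of "\<lambda>x. real x * pmf p x" "\<lambda>_. m" "\<lambda>_. 1 / \<mu>"] mean_has_sum by simp
  also have "(\<Sum>i<b. (1 / \<mu>) * m) = 1" using b_pos mean_pos by (simp add: m_def)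
  finally have "((\<lambda>x. real x * pmf p x / \<mu>) has_sum 1) UNIV" by simp
  then show ?thesis
    unfolding size_biased_def using mean_pos by (intro pmf_embed_pmf_has_sum) auto
qed

lemma edge_law_sym: "pmf edge_law (x, y) = pmf edge_law (y, x)"
  unfolding pmf_edge_law using affinity_sym[OF blk(1)[of x] blk(1)[of y]] by simp

lemma map_fst_edge_law: "map_pmf fst edge_law = size_biased p"
proof (rule pmf_eqI)
  fix x
  have "((\<lambda>y. affinity (blk x) (blk y) * (real y * pmf p y)) has_sum 1 / \<mu>) UNIV"
    using has_sum_blocks[OF mean_has_sum, of "affinity (blk x)"] sum_affinity_m[OF blk(1)] by simp
  then have "((\<lambda>y. (real x * pmf p x) * (affinity (blk x) (blk y) * (real y * pmf p y))) has_sum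
      (real x * pmf p x) * (1 / \<mu>)) UNIV"
    by (rule has_sum_cmult_right)
  then have "((\<lambda>y. pmf edge_law (x, y)) has_sum real x * pmf p x / \<mu>) UNIV"
    unfolding pmf_edge_law by (simp add: mult_ac)
  moreover have "bij_betw (Pair x) UNIV (fst -` {x})"
    by (auto simp: bij_betw_def inj_on_def)
  ultimately have "(pmf edge_law has_sum real x * pmf p x / \<mu>) (fst -` {x})"
    by (subst has_sum_reindex_bij_betw[symmetric])
  then have "measure_pmf.prob edge_law (fst -` {x}) = real x * pmf p x / \<mu>"
    using has_sum_unique[OF has_sum_pmf] by blast
  then show "pmf (map_pmf fst edge_law) x = pmf (size_biased p) x"
    by (simp add: pmf_map pmf_size_biased)
qed

text \<open>As \<open>h\<close> is an involution, \<open>affinity\<close> is symmetric on blocks;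
  the second marginal is thereby reduced to the first.\<close>

lemma map_swap_edge_law: "map_pmf prod.swap edge_law = edge_law"
proof (rule pmf_eqI)
  fix z :: "nat \<times> nat"
  obtain x y where z: "z = (x, y)" by (cases z)
  have "pmf (map_pmf prod.swap edge_law) (prod.swap (y, x)) = pmf edge_law (y, x)"
    by (rule pmf_map_inj') simp
  then show "pmf (map_pmf prod.swap edge_law) z = pmf edge_law z"
    unfolding z using edge_law_sym[of x y] by simp
qed

lemma map_snd_edge_law: "map_pmf snd edge_law = size_biased p"
proof -
  have "map_pmf snd edge_law = map_pmf fst (map_pmf prod.swap edge_law)"
    by (simp add: pmf.map_comp comp_def)
  then show ?thesis unfolding map_swap_edge_law map_fst_edge_law .
qed

section \<open>Moments and correlation of the limit law\<close>

lemma expectation_size_biased: "measure_pmf.expectation (size_biased p) real = (\<Sum>i<b. u i) / \<mu>"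
proof (rule expectation_pmf_has_sum)
  have "((\<lambda>x. 1 / \<mu> * (real x * (real x * pmf p x))) has_sum (\<Sum>i<b. 1 / \<mu> * u i)) UNIV"
    using has_sum_blocks[OF u_has_sum, of "\<lambda>_. 1 / \<mu>"] .
  then show "((\<lambda>x. pmf (size_biased p) x * real x) has_sum (\<Sum>i<b. u i) / \<mu>) UNIV"
    by (simp add: pmf_size_biased mult_ac sum_divide_distrib)
qed

lemma expectation_edge_law_prod:
  "measure_pmf.expectation edge_law (\<lambda>(x, y). real x * real y) =
     (real b * q * (\<Sum>i<b. u i * u (h i)) + (1 - q) * (\<Sum>i<b. \<Sum>j<b. u i * u j)) / \<mu>\<^sup>2"
proof (rule expectation_pmf_has_sum)
  have "((\<lambda>(x, y). affinity (blk x) (blk y) * ((real x * (real x * pmf p x)) * (real y * (real y * pmf p y))))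
      has_sum (\<Sum>i<b. \<Sum>j<b. affinity i j * (u i * u j))) UNIV"
    by (rule has_sum_block_pairs[OF u_has_sum]) simp
  also have "(\<Sum>i<b. \<Sum>j<b. affinity i j * (u i * u j)) = (\<Sum>i<b. u i * (\<Sum>j<b. affinity i j * u j))"
    by (simp add: sum_distrib_left mult_ac)
  also have "\<dots> = (\<Sum>i<b. u i * ((real b * q * u (h i) + (1 - q) * (\<Sum>j<b. u j)) / \<mu>\<^sup>2))"
    unfolding sum_affinity using h_lt by (intro sum.cong) auto
  also have "\<dots> = (real b * q * (\<Sum>i<b. u i * u (h i)) + (1 - q) * (\<Sum>i<b. \<Sum>j<b. u i * u j)) / \<mu>\<^sup>2"
    by (simp add: sum_distrib_left sum_divide_distrib sum.distrib distrib_left add_divide_distrib mult_ac)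
  also have "(\<lambda>(x, y). affinity (blk x) (blk y) *
      ((real x * (real x * pmf p x)) * (real y * (real y * pmf p y)))) =
      (\<lambda>z. pmf edge_law z * (case z of (x, y) \<Rightarrow> real x * real y))"
    by (simp add: fun_eq_iff pmf_edge_law mult_ac)
  finally show "((\<lambda>z. pmf edge_law z * (case z of (x, y) \<Rightarrow> real x * real y)) has_sum
      (real b * q * (\<Sum>i<b. u i * u (h i)) + (1 - q) * (\<Sum>i<b. \<Sum>j<b. u i * u j)) / \<mu>\<^sup>2) UNIV" .
qed

text \<open>Both means are \<open>(\<Sum>i<b. u i) / \<mu>\<close>, so subtracting their product
  turns the coefficient \<open>1 - q\<close> of the double sum into \<open>- q\<close>, and
  \<open>q\<close> factors out. If the standard deviation is 0, both sides are 0, being quotients by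
  0.\<close>

lemma pearson_edge_law: "pearson edge_law = corr_coeff p b h H * q"
proof -
  have fst: "measure_pmf.expectation edge_law (\<lambda>(x, y). g x) = measure_pmf.expectation (size_biased p) g"
    and snd: "measure_pmf.expectation edge_law (\<lambda>(x, y). g y) = measure_pmf.expectation (size_biased p) g"
    for g :: "nat \<Rightarrow> real"
    using arg_cong[OF map_fst_edge_law, of "\<lambda>D. measure_pmf.expectation D g"]
      arg_cong[OF map_snd_edge_law, of "\<lambda>D. measure_pmf.expectation D g"]
    by (simp_all add: case_prod_unfold)
  have std: "std_dev edge_law (\<lambda>(x, y). real x) = std_dev (size_biased p) real"
    "std_dev edge_law (\<lambda>(x, y). real y) = std_dev (size_biased p) real"
    unfolding std_dev_def fst snd
    using fst[of "\<lambda>x. (real x - measure_pmf.expectation (size_biased p) real)\<^sup>2"]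
      snd[of "\<lambda>x. (real x - measure_pmf.expectation (size_biased p) real)\<^sup>2"]
    by (simp_all add: case_prod_unfold)
  have "(\<Sum>i<b. u i) / \<mu> * ((\<Sum>i<b. u i) / \<mu>) = (\<Sum>i<b. \<Sum>j<b. u i * u j) / \<mu>\<^sup>2"
    by (simp add: sum_product power2_eq_square)
  then have "measure_pmf.expectation edge_law (\<lambda>(x, y). real x * real y) -
      measure_pmf.expectation edge_law (\<lambda>(x, y). real x) * measure_pmf.expectation edge_law (\<lambda>(x, y). real y) =
      q * (real b * (\<Sum>i<b. u i * u (h i)) - (\<Sum>i<b. \<Sum>j<b. u i * u j)) / \<mu>\<^sup>2"
    unfolding expectation_edge_law_prod fst snd expectation_size_biased
    by (simp add: diff_divide_distrib[symmetric] algebra_simps)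
  then show ?thesis
    unfolding pearson_def std corr_coeff_def Let_def u_def[symmetric]
    by (simp add: mult_ac)
qed

end

section \<open>Convergence to the limit law\<close>

text \<open>
  \<open>B * partner_prob i j\<close> in terms of \<open>\<tau> = T / B\<close> and \<open>v = 1 / B\<close>, which have limits;
  \<open>a\<close> and \<open>e\<close> stand for the indicators of \<open>j = h i\<close> and \<open>i = j\<close>.
\<close>

definition scaled_partner_prob :: "real \<Rightarrow> real \<Rightarrow> real \<Rightarrow> real \<Rightarrow> real \<Rightarrow> real" where
  "scaled_partner_prob b a e \<tau> v = (a * \<tau> + (1 - \<tau>) * (1 - \<tau> - e * v) / (b - b * \<tau> - v)) / (1 - e * v)"

lemma (in block_model) partner_prob_scaled:
  "partner_prob i j =
     scaled_partner_prob (real b) (of_bool (j = h i)) (of_bool (i = j)) (real T / real B) (1 / real B) / real B"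
proof -
  let ?B = "real B" and ?T = "real T"
  have B0: "?B \<noteq> 0" using B by simp
  have scale: "x / y = (x / ?B) / (y / ?B)" for x y
    using B0 by simp
  have 1: "(?B - ?T) / ?B = 1 - ?T / ?B" using B0 by (simp add: diff_divide_distrib)
  have 2: "(?B - ?T - of_bool (i = j)) / (real N - real b * ?T - 1) =
      (1 - ?T / ?B - of_bool (i = j) * (1 / ?B)) / (real b - real b * (?T / ?B) - 1 / ?B)"
    using B0 by (subst scale) (simp add: diff_divide_distrib N)
  have 3: "?B - of_bool (i = j) = (1 - of_bool (i = j) * (1 / ?B)) * ?B"
    using B0 by (simp add: left_diff_distrib)
  show ?thesis
    unfolding partner_prob_def scaled_partner_prob_def 1 times_divide_eq_right[symmetric] 2 3
    by simp
qed

context degree_blocks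
begin

text \<open>\<open>T / B\<close> as a function of \<open>n\<close>: for admissible \<open>n\<close>
  one has \<open>N = n * \<mu>\<close> and \<open>B = n * m\<close>, whatever the degree sequence.
  The formula is defined for all \<open>n\<close>, so an ordinary limit can be taken.\<close>

definition type1_fraction :: "nat \<Rightarrow> real" where
  "type1_fraction n = real (nat \<lceil>real n * \<mu> * q / real b\<rceil>) / (real n * m)"

text \<open>\<open>partner_prob i j / N\<close> multiplied by \<open>n ^ 2\<close>; the divisor
  \<open>m * \<mu>\<close> is \<open>B * N / n ^ 2\<close>.\<close>

definition edge_density :: "nat \<Rightarrow> nat \<Rightarrow> nat \<Rightarrow> real" where
  "edge_density i j n = scaled_partner_prob (real b) (of_bool (j = h i)) (of_bool (i = j))
     (type1_fraction n) (1 / (real n * m)) / (m * \<mu>)"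

lemma inverse_block_size_tendsto: "(\<lambda>n. 1 / (real n * m)) \<longlonglongrightarrow> 0"
proof -
  have "(\<lambda>n. (1 / m) * (1 / real n)) \<longlonglongrightarrow> (1 / m) * 0"
    by (intro tendsto_mult tendsto_const lim_1_over_n)
  then show ?thesis by (simp add: mult.commute)
qed

lemma type1_fraction_tendsto: "type1_fraction \<longlonglongrightarrow> q"
proof -
  have "\<bar>type1_fraction n - q\<bar> \<le> 1 / (real n * m)" if n: "0 < n" for n
  proof -
    let ?z = "real n * \<mu> * q / real b"
    have nm: "0 < real n * m" using n m_pos by simp
    have z: "0 \<le> ?z" using q mean_pos by simp
    have zq: "?z = q * (real n * m)" by (simp add: m_def)
    have "real (nat \<lceil>?z\<rceil>) = of_int \<lceil>?z\<rceil>" using z by simp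
    then have "\<bar>real (nat \<lceil>?z\<rceil>) - ?z\<bar> \<le> 1" by linarith
    then have "\<bar>real (nat \<lceil>?z\<rceil>) - q * (real n * m)\<bar> / (real n * m) \<le> 1 / (real n * m)"
      unfolding zq using nm by (intro divide_right_mono) auto
    moreover have "\<bar>real (nat \<lceil>?z\<rceil>) - q * (real n * m)\<bar> / (real n * m) = \<bar>type1_fraction n - q\<bar>"
    proof -
      have "type1_fraction n - q = (real (nat \<lceil>?z\<rceil>) - q * (real n * m)) / (real n * m)"
      proof -
        have "q * (real n * m) / (real n * m) = q"
          by (intro nonzero_mult_div_cancel_right less_imp_neq[OF nm, symmetric])
        then show ?thesis unfolding type1_fraction_def diff_divide_distrib by simp
      qed
      then show ?thesis using nm by (simp only: abs_divide abs_of_pos)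
    qed
    ultimately show ?thesis by simp
  qed
  then have "eventually (\<lambda>n. norm (type1_fraction n - q) \<le> 1 / (real n * m)) sequentially"
    by (intro eventually_sequentiallyI[of 1]) simp
  then have "(\<lambda>n. type1_fraction n - q) \<longlonglongrightarrow> 0"
    using inverse_block_size_tendsto by (rule Lim_null_comparison)
  then show ?thesis by (rule Lim_null[THEN iffD2])
qed

text \<open>At \<open>\<tau> = q\<close> and \<open>v = 0\<close> the type 2 term is
  \<open>(1 - q) * (1 - q) / (b * (1 - q))\<close>, that is, \<open>(1 - q) / b\<close>; here
  \<open>q < 1\<close> keeps the denominator away from 0. Division by \<open>m = \<mu> / b\<close>
  then brings in the factor \<open>b\<close>.\<close>

lemma edge_density_tendsto: "edge_density i j \<longlonglongrightarrow> affinity i j"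
proof -
  have "edge_density i j \<longlonglongrightarrow> scaled_partner_prob (real b) (of_bool (j = h i)) (of_bool (i = j)) q 0 / (m * \<mu>)"
    unfolding edge_density_def[abs_def] scaled_partner_prob_def
    using q b_pos m_pos mean_pos
    by (intro tendsto_intros type1_fraction_tendsto inverse_block_size_tendsto) auto
  moreover have "scaled_partner_prob (real b) (of_bool (j = h i)) (of_bool (i = j)) q 0 / (m * \<mu>) = affinity i j"
  proof -
    have "(1 - q) * (1 - q) / (real b - real b * q) = (1 - q) / real b"
      using q b_pos by (simp add: field_simps)
    then show ?thesis
      unfolding scaled_partner_prob_def affinity_def m_def using b_pos mean_pos
      by (simp add: power2_eq_square field_simps)
  qed
  ultimately show ?thesis by simp
qed

text \<open>For a fixed admissible sequence this will be the exact probability of the degrees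
  \<open>(x, y)\<close>, with \<open>a\<close> and \<open>c\<close> the proportions of vertices of
  degree \<open>x\<close> and \<open>y\<close>. Nothing else of the sequence enters.\<close>

definition approx_law :: "nat \<Rightarrow> nat \<Rightarrow> nat \<Rightarrow> real \<Rightarrow> real \<Rightarrow> real" where
  "approx_law x y n a c =
     (real x * a) * (real y * c - of_bool (x = y) / real n) * edge_density (blk x) (blk y) n"

lemma edge_law_given_degrees_approx:
  assumes sorted: "blocks_sorted p b H"
    and k: "k \<in> set_pmf (iid_degrees p n)" "k \<in> admissible_seqs p b q h H n"
  shows "pmf (random_graph b q h n k \<bind>
        (\<lambda>M. map_pmf (\<lambda>(s, t). (stub_degree n k s, stub_degree n k t)) (oriented_edge M))) (x, y) =
     approx_law x y n (real (degree_count n k x) / real n) (real (degree_count n k y) / real n)"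
proof -
  let ?N = "num_stubs n k" and ?B = "num_stubs n k div b"
  note adm = admissible_seqsD[OF b_pos mean_pos disj cover k(2)]
  interpret M: block_model b ?B ?N "type1_count b q ?N" q h
    using b_pos adm(3-5) q h_permutes h_invol by unfold_locales auto
  have supp: "k v \<in> set_pmf p" if "v < n" for v
    using k(1) that by (auto simp: set_Pi_pmf PiE_dflt_def)
  have "real ?N = real b * real ?B" using adm(3) by (metis of_nat_mult)
  then have B: "real ?B = real n * m" using adm(2) b_pos by (simp add: m_def field_simps)
  have \<tau>: "real (type1_count b q ?N) / real ?B = type1_fraction n"
    unfolding type1_count_def type1_fraction_def adm(2) B ..
  have "pmf (random_graph b q h n k \<bind>
        (\<lambda>M. map_pmf (\<lambda>(s, t). (stub_degree n k s, stub_degree n k t)) (oriented_edge M))) (x, y) =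
     (real x * real (degree_count n k x)) * (real y * real (degree_count n k y) - of_bool (x = y)) *
     M.partner_prob (blk x) (blk y) / real ?N"
    unfolding degree_count_def
    using adm(6) unfolding block_sum_def
    by (intro M.edge_law_given_degrees[OF refl supp sorted disj cover] blk) auto
  also have "\<dots> = (real x * real (degree_count n k x)) * (real y * real (degree_count n k y) - of_bool (x = y)) *
     (edge_density (blk x) (blk y) n / (real n * real n))"
  proof -
    have "w * (s / (real n * m)) / (real n * \<mu>) = w * (s / (m * \<mu>) / (real n * real n))" for w s
      by simp
    then show ?thesis
      unfolding M.partner_prob_scaled \<tau> unfolding B adm(2) edge_density_def .
  qed
  also have "\<dots> = approx_law x y n (real (degree_count n k x) / real n) (real (degree_count n k y) / real n)"
    using adm(1) by (simp add: approx_law_def field_simps)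
  finally show ?thesis .
qed

abbreviation large_sizes :: "nat filter" where
  "large_sizes \<equiv> inf sequentially (principal (admissible_sizes p b q h H))"

lemma admissible_sizesD:
  assumes "n \<in> admissible_sizes p b q h H"
  shows "n \<in> even_block_sizes p b H m" "admissible_seqs p b q h H n = even_block_seqs b H m n"
proof -
  obtain k where k: "k \<in> set_pmf (iid_degrees p n)" "k \<in> admissible_seqs p b q h H n"
    using assms by (auto simp: admissible_sizes_def)
  note adm = admissible_seqsD[OF b_pos mean_pos disj cover k(2), folded m_def]
  show "admissible_seqs p b q h H n = even_block_seqs b H m n" by (rule adm(7))
  then show "n \<in> even_block_sizes p b H m"
    using k adm(1) by (auto simp: even_block_sizes_def)
qed

text \<open>The proportions are random and vary with \<open>n\<close>, so a limit in
  \<open>n\<close> for fixed proportions would not suffice. The product filter makes the estimate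
  uniform over all proportions near \<open>pmf p x\<close> and \<open>pmf p y\<close>.\<close>

lemma approx_law_tendsto:
  "((\<lambda>z. approx_law x y (fst z) (fst (snd z)) (snd (snd z))) \<longlongrightarrow> pmf edge_law (x, y))
     (large_sizes \<times>\<^sub>F (nhds (pmf p x) \<times>\<^sub>F nhds (pmf p y)))"
proof -
  let ?G = "large_sizes \<times>\<^sub>F (nhds (pmf p x) \<times>\<^sub>F nhds (pmf p y))"
  have n: "filterlim fst sequentially ?G"
    using filterlim_mono[OF filterlim_fst[of large_sizes] inf_le1 order_refl] .
  have a: "((\<lambda>z. fst (snd z)) \<longlongrightarrow> pmf p x) ?G" and c: "((\<lambda>z. snd (snd z)) \<longlongrightarrow> pmf p y) ?G"
    by (rule filterlim_compose[OF filterlim_fst filterlim_snd],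
        rule filterlim_compose[OF filterlim_snd filterlim_snd])
  have d: "((\<lambda>z. edge_density (blk x) (blk y) (fst z)) \<longlongrightarrow> affinity (blk x) (blk y)) ?G"
    by (rule filterlim_compose[OF edge_density_tendsto n])
  have diag: "((\<lambda>z. of_bool (x = y) * (1 / real (fst z))) \<longlongrightarrow> of_bool (x = y) * 0) ?G"
    by (intro tendsto_mult tendsto_const filterlim_compose[OF lim_1_over_n n])
  have "((\<lambda>z. (real x * fst (snd z)) * (real y * snd (snd z) - of_bool (x = y) * (1 / real (fst z))) *
      edge_density (blk x) (blk y) (fst z)) \<longlongrightarrow>
      (real x * pmf p x) * (real y * pmf p y - of_bool (x = y) * 0) * affinity (blk x) (blk y)) ?G"
    by (intro tendsto_mult tendsto_diff tendsto_const a c d diag)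
  then show ?thesis
    by (simp add: approx_law_def pmf_edge_law mult_ac)
qed

text \<open>Averages the exact law over the conditioned degree sequence: it is close to the limit
  when both proportions are, and the remaining sequences have vanishing conditional
  probability.\<close>

lemma edge_degrees_tendsto:
  assumes sorted: "blocks_sorted p b H"
  shows "((\<lambda>n. pmf (edge_degrees p b q h H n) (x, y)) \<longlongrightarrow> pmf edge_law (x, y)) large_sizes"
proof (rule tendstoI)
  fix \<epsilon> :: real assume \<epsilon>: "0 < \<epsilon>"
  let ?L = "pmf edge_law (x, y)"
  define \<eta> where "\<eta> = \<epsilon> / 4"
  have \<eta>: "0 < \<eta>" using \<epsilon> by (simp add: \<eta>_def)
  have "eventually (\<lambda>z. dist (approx_law x y (fst z) (fst (snd z)) (snd (snd z))) ?L < \<eta>)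
      (large_sizes \<times>\<^sub>F (nhds (pmf p x) \<times>\<^sub>F nhds (pmf p y)))"
    by (rule tendstoD[OF approx_law_tendsto \<eta>])
  then obtain P R where P: "eventually P large_sizes" and R: "eventually R (nhds (pmf p x) \<times>\<^sub>F nhds (pmf p y))"
    and PR: "\<And>n z. P n \<Longrightarrow> R z \<Longrightarrow> dist (approx_law x y n (fst z) (snd z)) ?L < \<eta>"
    unfolding eventually_prod_filter by (metis fst_conv snd_conv prod.collapse)
  from R obtain R1 R2 where R1: "eventually R1 (nhds (pmf p x))" and R2: "eventually R2 (nhds (pmf p y))"
    and R12: "\<And>a c. R1 a \<Longrightarrow> R2 c \<Longrightarrow> R (a, c)"
    unfolding eventually_prod_filter by blast
  obtain \<delta>1 \<delta>2 where \<delta>1: "0 < \<delta>1" "\<And>a. dist a (pmf p x) < \<delta>1 \<Longrightarrow> R1 a"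
    and \<delta>2: "0 < \<delta>2" "\<And>c. dist c (pmf p y) < \<delta>2 \<Longrightarrow> R2 c"
    using R1 R2 unfolding eventually_nhds_metric by blast
  define bad where "bad \<delta> x n = {k. \<delta> \<le> \<bar>real (degree_count n k x) / real n - pmf p x\<bar>}" for \<delta> x n
  have conc: "((\<lambda>n. measure_pmf.prob (iid_degrees p n) (bad \<delta> x n) /
      measure_pmf.prob (iid_degrees p n) (even_block_seqs b H m n)) \<longlongrightarrow> 0) large_sizes" if "0 < \<delta>" for \<delta> x
    unfolding bad_def
  proof (rule tendsto_mono[OF _ cond_degree_count_concentrated[OF disj cover mean_has_sum that]])
    show "large_sizes \<le> inf sequentially (principal (even_block_sizes p b H m))"
      using admissible_sizesD(1) by (intro inf_mono) auto
  qed
  \<comment> \<open>The two bad events contribute at most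
    \<open>(1 + |?L|) * (2 * \<theta>) = 2 * \<eta>\<close>. Together with the \<open>\<eta>\<close>
    of the good sequences this gives \<open>3 * \<eta> < \<epsilon>\<close>.\<close>
  define \<theta> where "\<theta> = \<eta> / (1 + \<bar>?L\<bar>)"
  have \<theta>: "0 < \<theta>" using \<eta> by (simp add: \<theta>_def add_pos_nonneg)
  have "eventually (\<lambda>n. n \<in> admissible_sizes p b q h H) large_sizes"
    by (simp add: eventually_inf_principal)
  with P tendstoD[OF conc[OF \<delta>1(1), of x] \<theta>] tendstoD[OF conc[OF \<delta>2(1), of y] \<theta>]
  show "eventually (\<lambda>n. dist (pmf (edge_degrees p b q h H n) (x, y)) ?L < \<epsilon>) large_sizes"
  proof eventually_elim
    case (elim n)
    let ?S = "admissible_seqs p b q h H n"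
    let ?D = "cond_pmf (iid_degrees p n) ?S"
    let ?G = "\<lambda>k. pmf (random_graph b q h n k \<bind>
        (\<lambda>M. map_pmf (\<lambda>(s, t). (stub_degree n k s, stub_degree n k t)) (oriented_edge M))) (x, y)"
    let ?bad = "bad \<delta>1 x n \<union> bad \<delta>2 y n"
    have ne: "set_pmf (iid_degrees p n) \<inter> ?S \<noteq> {}"
      using elim(4) by (simp add: admissible_sizes_def)
    have S: "?S = even_block_seqs b H m n" by (rule admissible_sizesD(2)[OF elim(4)])
    have small: "measure_pmf.prob ?D (bad \<delta>1 x n) < \<theta>" "measure_pmf.prob ?D (bad \<delta>2 y n) < \<theta>"
      using elim(2,3) prob_cond_pmf_le[OF ne, of "bad \<delta>1 x n"] prob_cond_pmf_le[OF ne, of "bad \<delta>2 y n"]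
      unfolding S by (auto simp: dist_real_def)
    have "measure_pmf.prob ?D ?bad \<le> measure_pmf.prob ?D (bad \<delta>1 x n) + measure_pmf.prob ?D (bad \<delta>2 y n)"
      by (rule measure_Un_le) auto
    then have prob: "measure_pmf.prob ?D ?bad \<le> 2 * \<theta>" using small by linarith
    have "\<bar>measure_pmf.expectation ?D ?G - ?L\<bar> \<le> \<eta> + (1 + \<bar>?L\<bar>) * measure_pmf.prob ?D ?bad"
    proof (rule expectation_close)
      fix k assume k: "k \<in> set_pmf ?D" "k \<notin> ?bad"
      then have k': "k \<in> set_pmf (iid_degrees p n)" "k \<in> ?S" using set_cond_pmf[OF ne] by auto
      have "R1 (real (degree_count n k x) / real n)" "R2 (real (degree_count n k y) / real n)"
        using k(2) by (auto simp: bad_def dist_real_def intro!: \<delta>1(2) \<delta>2(2))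
      then have "dist (approx_law x y n (real (degree_count n k x) / real n) (real (degree_count n k y) / real n)) ?L < \<eta>"
        using PR[OF elim(1) R12] by simp
      then show "\<bar>?G k - ?L\<bar> \<le> \<eta>"
        unfolding edge_law_given_degrees_approx[OF sorted k'] by (simp add: dist_real_def)
    qed (use \<eta> in \<open>simp_all add: pmf_le_1\<close>)
    also have "\<dots> \<le> \<eta> + (1 + \<bar>?L\<bar>) * (2 * \<theta>)"
      using prob by (intro add_left_mono mult_left_mono) auto
    also have "\<dots> = 3 * \<eta>"
    proof -
      have "(1 + \<bar>?L\<bar>) * \<theta> = \<eta>" unfolding \<theta>_def by (simp add: add_pos_nonneg order_less_imp_not_eq2)
      then show ?thesis by (simp add: mult.left_commute)
    qed
    also have "\<dots> < \<epsilon>" using \<epsilon> by (simp add: \<eta>_def)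
    finally show ?case unfolding edge_degrees_eq pmf_bind dist_real_def .
  qed
qed

text \<open>Infinitely many admissible sizes make the filter proper, and limits along a proper
  filter are unique; so the pointwise limits determine the law.\<close>

lemma limit_edge_degrees_iff:
  assumes "blocks_sorted p b H" "infinite (admissible_sizes p b q h H)"
  shows "limit_edge_degrees p b q h H D \<longleftrightarrow> D = edge_law"
proof
  have "large_sizes \<noteq> bot"
  proof
    assume "large_sizes = bot"
    then have "eventually (\<lambda>n. n \<notin> admissible_sizes p b q h H) sequentially"
      unfolding trivial_limit_def eventually_inf_principal by simp
    then show False
      using assms(2) by (simp add: cofinite_eq_sequentially[symmetric] eventually_cofinite)
  qed
  moreover assume "limit_edge_degrees p b q h H D"
  ultimately have "pmf D (x, y) = pmf edge_law (x, y)" for x y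
    using tendsto_unique[OF _ _ edge_degrees_tendsto[OF assms(1)]]
    unfolding limit_edge_degrees_def by blast
  then show "D = edge_law" by (intro pmf_eqI) auto
next
  assume "D = edge_law"
  then show "limit_edge_degrees p b q h H D"
    unfolding limit_edge_degrees_def using edge_degrees_tendsto[OF assms(1)] by blast
qed

end

theorem theorem2:
  fixes p :: "nat pmf" and b :: nat and q :: real
    and h :: "nat \<Rightarrow> nat" and H :: "nat \<Rightarrow> nat set"
  assumes "0 < mean_degree p"
    and "summable (\<lambda>k. real k ^ 3 * pmf p k)"
    and "0 < b"
    and "0 \<le> q" and "q < 1"
    and "h permutes {..<b}" and "\<And>i. i < b \<Longrightarrow> h (h i) = i"
    and "disjoint_family_on H {..<b}" and "(\<Union>i<b. H i) = UNIV"
    and "\<And>i. i < b \<Longrightarrow> (\<Sum>\<^sub>\<infinity>k\<in>H i. real k * pmf p k) = mean_degree p / real b"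
    and "blocks_sorted p b H"
    and "infinite (admissible_sizes p b q h H)"
  shows "(\<exists>D. limit_edge_degrees p b q h H D) \<and>
         (\<forall>D. limit_edge_degrees p b q h H D \<longrightarrow> pearson D = corr_coeff p b h H * q)"
proof -
  interpret degree_blocks p b q h H
    using assms by unfold_locales
  show ?thesis
    using limit_edge_degrees_iff[OF assms(11,12)] pearson_edge_law by auto
qed


end
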